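(* Let $p_1,p_2$ be real polynomials and let $L: x'=x+p_1(y),\ y'=y+p_2(x')$ be the corresponding map of $\mathbb{R}^2$ in generalised standard form. Let $\mathcal{S}(L)$ be its symmetry group and $\mathcal{R}(L)$ its reversing symmetry group within the group $\mathcal{G}$ of polynomial automorphisms of $\mathbb{R}^2$. Write $\rtimes$ for (internal) semidirect product, with the left factor normal. **(I)** Suppose one of $p_1,p_2$ has degree $1$ and the other has degree at least $2$. If $p_1(y)=Ay+B$, $A\ne0$, put $q=p_2$ and $R_2: x'=x,\ y'=-y+p_2(x)-2B/A$, and, if $q$ is odd around $e/2$, $S_1: x'=-x+e,\ y'=-y-2B/A$. If $p_2(x)=Ax+B$, $A\neq 0$, put $q=p_1$ and $R_2: x'=-x-p_1(y)-2B/A,\ y'=y$, and, if $q$ is odd around $e/2$, $S_1: x'=-x-2B/A,\ y'=-y+e$. Then: - if $q$ is not odd around any point, then $\mathcal{S}(L)=\langle L\rangle\simeq C_\infty$ and $\mathcal{R}(L)=\langle L\rangle\rtimes\langle R_2\rangle\simeq D_\infty$; - if $q$ is odd around some point, then $\mathcal{S}(L)=\langle L\rangle\times\langle S_1\rangle\simeq C_\infty\times C_2$ and $\mathcal{R}(L)=(\langle L\rangle\rtimes\langle R_2\rangle)\times\langle S_1\rangle\simeq D_\infty\times C_2$. **(II)** Suppose $\deg p_1\ge2$ and $\deg p_2\ge2$. With the conditions S1–S3, R1–R5 and the associated maps $S_i,R_i$ defined in the context, exactly one of the following possibilities occurs, and $\mathcal{S}(L)$ and $\mathcal{R}(L)$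 are as stated: 1. None of S1, S2, S3 and none of R1,…,R5 holds: $\mathcal{S}(L)=\mathcal{R}(L)=\langle L\rangle\simeq C_\infty$. 2. S2 holds and none of R1,…,R5 holds: $\mathcal{S}(L)=\mathcal{R}(L)=\langle S_2\rangle\simeq C_\infty$. 3. None of S1, S2, S3 holds and exactly one R$i$ with $i\in\{1,2,3,4\}$ holds: $\mathcal{S}(L)=\langle L\rangle\simeq C_\infty$ and $\mathcal{R}(L)=\langle L\rangle\rtimes\langle R_i\rangle\simeq D_\infty$. 4. S2 and R3 hold (equivalently, S2 and R4 hold): $\mathcal{S}(L)=\langle S_2\rangle\simeq C_\infty$ and $\mathcal{R}(L)=\langle S_2\rangle\rtimes\langle R_3\rangle\simeq D_\infty$. 5. S1 holds and neither S2 nor S3 holds (then R1 and R2 hold): $\mathcal{S}(L)=\langle L\rangle\times\langle S_1\rangle\simeq C_\infty\times C_2$ and $\mathcal{R}(L)=(\langle L\rangle\rtimes\langle R_1\rangle)\times\langle S_1\rangle\simeq D_\infty\times C_2$. 6. S3 holds (then S1, R1, R2 and R4 hold): $\mathcal{S}(L)=\langle S_3\rangle\times\langle S_1\rangle\simeq C_\infty\times C_2$ and $\mathcal{R}(L)=(\langle S_3\rangle\rtimes\langle R_1\rangle)\times\langle S_1\rangle\simeq D_\infty\times C_2$. 7. S1 and S2 hold (equivalently, R5 holds; then R1 and R2 hold): $\mathcal{S}(L)=\langle S_2\rangle\times\langle S_1\rangle\simeq C_\infty\times C_2$ and $\mathcal{R}(L)=(\langle S_2\rangle\times\langle S_1\rangle)\rtimes\langle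 R_1\rangle\simeq(C_\infty\times C_2)\rtimes C_2$, where $R_1\circ S_2\circ R_1=S_1\circ S_2^{-1}$.
   Context: A polynomial automorphism of $\mathbb{R}^2$ is a bijective polynomial map $\mathbb{R}^2\to\mathbb{R}^2$ whose inverse is also polynomial; these form the group $\mathcal{G}$. A map written "$x'=\dots,\ y'=\dots$" sends $(x,y)$ to $(x',y')$; where $x'$ occurs in the formula for $y'$, the already computed value of $x'$ is substituted. The map $L$ belongs to $\mathcal{G}$. $\mathcal{S}(L)=\{S\in\mathcal{G}: S\circ L\circ S^{-1}=L\}$, and $\mathcal{R}(L)=\mathcal{S}(L)\cup\{R\in\mathcal{G}: R\circ L\circ R^{-1}=L^{-1}\}$; both are groups. $C_n$ is the cyclic group of order $n$, $C_\infty$ the infinite cyclic group, and $D_\infty\simeq C_\infty\rtimes C_2$ the infinite dihedral group. A polynomial $p$ is odd (respectively even) around $b\in\mathbb{R}$ if $p(b+x)=-p(b-x)$ (respectively $p(b+x)=p(b-x)$) for all $x$. Conditions and associated maps for part (II). Here $a,c,e$ are real parameters with $a\neq0$, chosen separately for each condition; a condition holds if it holds for some values of its parameters, and the associated map is formed with such values. - S1: $p_1$ is odd around $e/2$ and $p_2$ is odd around $c/2$; $S_1: x'=-x+c,\ y'=-y+e$. - S2: $p_2(y)=\frac1a p_1(\frac ya+e)$; $S_2: x'=ay-ea,\ y'=\frac{x+p_1(y)}a+e$. - S3: $p_1$ is odd around $\frac12(e-\frac ca)$ and $p_2(y)=-\frac1a p_1(\frac{y-c}a)$; $S_3: x'=ay+c,\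 y'=-\frac{x+p_1(y)}a+e$. - R1: $p_2$ is odd around $c/2$; $R_1: x'=-x-p_1(y)+c,\ y'=y$. - R2: $p_1$ is odd around $e/2$; $R_2: x'=x+p_1(y),\ y'=-y+e$. - R3: $p_1$ is even around $e/2$ and $p_2$ is even around $c/2$; $R_3: x'=-x-p_1(y)+c,\ y'=-y+e$. - R4: $p_2(y)=-\frac1a p_1(\frac ya+e)$; $R_4: x'=ay-ea,\ y'=\frac xa+e$. - R5: $p_1$ is odd around $\frac12(e-\frac ca)$ and $p_2(y)=\frac1a p_1(\frac{y-c}a)$; $R_5: x'=ay+c,\ y'=-\frac xa+e$. *)

theory Defs
  imports
    "HOL-Analysis.Analysis"
    "HOL-Algebra.Elementary_Groups"
    "HOL-Computational_Algebra.Polynomial"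
begin

section \<open>The group of polynomial automorphisms of the plane\<close>

type_synonym plane_map = "real \<times> real \<Rightarrow> real \<times> real"

text \<open>
  Plain \<open>inv\<close> is ambiguous between function inverse and group inverse here,
  so the inverse of a bijection is written \<open>inv_into UNIV\<close> throughout.
\<close>

definition PolyAut :: "plane_map monoid" where
  "PolyAut =
     \<lparr>carrier = {f. bij f \<and> polynomial_function f \<and> polynomial_function (inv_into UNIV f)},
      monoid.mult = (\<circ>), one = id\<rparr>"

lemma group_PolyAut: "group PolyAut"
proof (rule groupI)
  fix f g assume "f \<in> carrier PolyAut" "g \<in> carrier PolyAut"
  then show "f \<otimes>\<^bsub>PolyAut\<^esub> g \<in> carrier PolyAut"
    by (auto simp: PolyAut_def bij_comp o_inv_distrib intro: polynomial_function_compose)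
next
  show "\<one>\<^bsub>PolyAut\<^esub> \<in> carrier PolyAut"
    using bij_id polynomial_function_id by (simp add: PolyAut_def inv_id) (simp add: id_def)
next
  fix f assume "f \<in> carrier PolyAut"
  then show "\<exists>g\<in>carrier PolyAut. g \<otimes>\<^bsub>PolyAut\<^esub> f = \<one>\<^bsub>PolyAut\<^esub>"
    by (intro bexI[of _ "inv_into UNIV f"])
       (auto simp: PolyAut_def bij_imp_bij_inv inv_inv_eq bij_is_inj)
qed (auto simp: PolyAut_def comp_assoc)

definition symmetries :: "plane_map \<Rightarrow> plane_map set" where
  "symmetries L = {S \<in> carrier PolyAut. S \<circ> L \<circ> inv_into UNIV S = L}"

definition reversing_symmetries :: "plane_map \<Rightarrow> plane_map set" where
  "reversing_symmetries L =
     symmetries L \<union> {R \<in> carrier PolyAut. R \<circ> L \<circ> inv_into UNIV R = inv_into UNIV L}"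

abbreviation cyc :: "plane_map \<Rightarrow> plane_map set" where
  "cyc f \<equiv> generate PolyAut {f}"

abbreviation as_group :: "plane_map set \<Rightarrow> plane_map monoid" where
  "as_group H \<equiv> PolyAut\<lparr>carrier := H\<rparr>"


section \<open>Direct and semidirect products\<close>

text \<open>\<open>K = N \<rtimes> H\<close> and \<open>K = N \<times> H\<close> for subgroups of a given group \<open>G\<close>.\<close>

definition internal_semidirect ::
    "('a, 'b) monoid_scheme \<Rightarrow> 'a set \<Rightarrow> 'a set \<Rightarrow> 'a set \<Rightarrow> bool" where
  "internal_semidirect G N H K \<longleftrightarrow>
     subgroup K G \<and> subgroup H G \<and> normal N (G\<lparr>carrier := K\<rparr>) \<and>
     N \<inter> H = {\<one>\<^bsub>G\<^esub>} \<and> K = N <#>\<^bsub>G\<^esub> H"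

definition internal_direct ::
    "('a, 'b) monoid_scheme \<Rightarrow> 'a set \<Rightarrow> 'a set \<Rightarrow> 'a set \<Rightarrow> bool" where
  "internal_direct G N H K \<longleftrightarrow>
     internal_semidirect G N H K \<and> normal H (G\<lparr>carrier := K\<rparr>)"

definition semidirect_prod ::
    "('a, 'c) monoid_scheme \<Rightarrow> ('b, 'd) monoid_scheme \<Rightarrow> ('b \<Rightarrow> 'a \<Rightarrow> 'a) \<Rightarrow> ('a \<times> 'b) monoid" where
  "semidirect_prod N H \<phi> =
     \<lparr>carrier = carrier N \<times> carrier H,
      monoid.mult = (\<lambda>(n, h) (n', h'). (n \<otimes>\<^bsub>N\<^esub> \<phi> h n', h \<otimes>\<^bsub>H\<^esub> h')),
      one = (\<one>\<^bsub>N\<^esub>, \<one>\<^bsub>H\<^esub>)\<rparr>"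

abbreviation C_inf :: "int monoid" where
  "C_inf \<equiv> integer_group"

abbreviation C2 :: "int monoid" where
  "C2 \<equiv> integer_mod_group 2"

definition D_inf :: "(int \<times> int) monoid" where
  "D_inf = semidirect_prod C_inf C2 (\<lambda>h n. if h = 0 then n else - n)"

text \<open>
  The semidirect product of \<open>C_inf \<times>\<times> C2\<close> by \<open>C2\<close> in which the generator \<open>r\<close> of the
  right factor fixes the generator \<open>t\<close> of \<open>C2\<close> and sends the generator \<open>s\<close> of \<open>C_inf\<close>
  to \<open>t s\<^sup>-\<^sup>1\<close>; hence it sends \<open>s\<^sup>m t\<^sup>k\<close> to \<open>s\<^sup>-\<^sup>m t\<^sup>k\<^sup>+\<^sup>m\<close>.
\<close>

definition twisted_prod :: "((int \<times> int) \<times> int) monoid" where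
  "twisted_prod =
     semidirect_prod (C_inf \<times>\<times> C2) C2
       (\<lambda>h (m, k). if h = 0 then (m, k) else (- m, (k + m) mod 2))"


section \<open>Maps in generalised standard form and the conditions on the polynomials\<close>

definition std_map :: "real poly \<Rightarrow> real poly \<Rightarrow> plane_map" where
  "std_map p1 p2 = (\<lambda>(x, y). let x' = x + poly p1 y in (x', y + poly p2 x'))"

definition odd_around :: "real poly \<Rightarrow> real \<Rightarrow> bool" where
  "odd_around p b \<longleftrightarrow> (\<forall>x. poly p (b + x) = - poly p (b - x))"

definition even_around :: "real poly \<Rightarrow> real \<Rightarrow> bool" where
  "even_around p b \<longleftrightarrow> (\<forall>x. poly p (b + x) = poly p (b - x))"

text \<open>
  \<open>assoc_S p1 p2 i T\<close> says that condition S\<open>i\<close> is satisfied for some values of its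
  parameters and that \<open>T\<close> is the map S\<open>i\<close> formed with these values; likewise
  \<open>assoc_R\<close>. The parameters need not be unique, so a condition may have several
  associated maps.
\<close>

inductive assoc_S :: "real poly \<Rightarrow> real poly \<Rightarrow> nat \<Rightarrow> plane_map \<Rightarrow> bool"
  for p1 p2 :: "real poly" where
  S1: "odd_around p1 (e / 2) \<Longrightarrow> odd_around p2 (c / 2) \<Longrightarrow>
       assoc_S p1 p2 1 (\<lambda>(x, y). (- x + c, - y + e))"
| S2: "a \<noteq> 0 \<Longrightarrow> (\<forall>y. poly p2 y = 1 / a * poly p1 (y / a + e)) \<Longrightarrow>
       assoc_S p1 p2 2 (\<lambda>(x, y). (a * y - e * a, (x + poly p1 y) / a + e))"
| S3: "a \<noteq> 0 \<Longrightarrow> odd_around p1 (1 / 2 * (e - c / a)) \<Longrightarrow>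
       (\<forall>y. poly p2 y = - (1 / a) * poly p1 ((y - c) / a)) \<Longrightarrow>
       assoc_S p1 p2 3 (\<lambda>(x, y). (a * y + c, - ((x + poly p1 y) / a) + e))"

inductive assoc_R :: "real poly \<Rightarrow> real poly \<Rightarrow> nat \<Rightarrow> plane_map \<Rightarrow> bool"
  for p1 p2 :: "real poly" where
  R1: "odd_around p2 (c / 2) \<Longrightarrow>
       assoc_R p1 p2 1 (\<lambda>(x, y). (- x - poly p1 y + c, y))"
| R2: "odd_around p1 (e / 2) \<Longrightarrow>
       assoc_R p1 p2 2 (\<lambda>(x, y). (x + poly p1 y, - y + e))"
| R3: "even_around p1 (e / 2) \<Longrightarrow> even_around p2 (c / 2) \<Longrightarrow>
       assoc_R p1 p2 3 (\<lambda>(x, y). (- x - poly p1 y + c, - y + e))"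
| R4: "a \<noteq> 0 \<Longrightarrow> (\<forall>y. poly p2 y = - (1 / a) * poly p1 (y / a + e)) \<Longrightarrow>
       assoc_R p1 p2 4 (\<lambda>(x, y). (a * y - e * a, x / a + e))"
| R5: "a \<noteq> 0 \<Longrightarrow> odd_around p1 (1 / 2 * (e - c / a)) \<Longrightarrow>
       (\<forall>y. poly p2 y = 1 / a * poly p1 ((y - c) / a)) \<Longrightarrow>
       assoc_R p1 p2 5 (\<lambda>(x, y). (a * y + c, - (x / a) + e))"

definition holds_S :: "real poly \<Rightarrow> real poly \<Rightarrow> nat \<Rightarrow> bool" where
  "holds_S p1 p2 i \<longleftrightarrow> (\<exists>T. assoc_S p1 p2 i T)"

definition holds_R :: "real poly \<Rightarrow> real poly \<Rightarrow> nat \<Rightarrow> bool" where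
  "holds_R p1 p2 i \<longleftrightarrow> (\<exists>T. assoc_R p1 p2 i T)"

inductive possibility :: "real poly \<Rightarrow> real poly \<Rightarrow> nat \<Rightarrow> bool"
  for p1 p2 :: "real poly" where
  "(\<forall>i\<in>{1,2,3}. \<not> holds_S p1 p2 i) \<Longrightarrow> (\<forall>i\<in>{1,2,3,4,5}. \<not> holds_R p1 p2 i) \<Longrightarrow>
     possibility p1 p2 1"
| "holds_S p1 p2 2 \<Longrightarrow> (\<forall>i\<in>{1,2,3,4,5}. \<not> holds_R p1 p2 i) \<Longrightarrow> possibility p1 p2 2"
| "(\<forall>i\<in>{1,2,3}. \<not> holds_S p1 p2 i) \<Longrightarrow> (\<exists>!i. i \<in> {1,2,3,4} \<and> holds_R p1 p2 i) \<Longrightarrow>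
     possibility p1 p2 3"
| "holds_S p1 p2 2 \<Longrightarrow> holds_R p1 p2 3 \<Longrightarrow> possibility p1 p2 4"
| "holds_S p1 p2 1 \<Longrightarrow> \<not> holds_S p1 p2 2 \<Longrightarrow> \<not> holds_S p1 p2 3 \<Longrightarrow> possibility p1 p2 5"
| "holds_S p1 p2 3 \<Longrightarrow> possibility p1 p2 6"
| "holds_S p1 p2 1 \<Longrightarrow> holds_S p1 p2 2 \<Longrightarrow> possibility p1 p2 7"

end

theory Submission
  imports Defs
begin

text \<open>
  Idea. Write \<open>L\<close> as a product of two Henon maps \<open>(x, y) \<mapsto> (y, x + p y)\<close>. If \<open>S = (h\<^sub>0, h\<^sub>1)\<close>
  conjugates \<open>L\<close> to another such product, then \<open>h\<^sub>0, h\<^sub>1\<close> extend to a two-sided sequence with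
  \<open>h\<^sub>k\<^sub>+\<^sub>2 = h\<^sub>k + p (h\<^sub>k\<^sub>+\<^sub>1)\<close> and \<open>h\<^sub>k\<^sub>+\<^sub>2 = h\<^sub>k \<circ> L\<close>, so the degrees of the \<open>h\<^sub>k\<close> grow geometrically in
  both directions away from a minimum. Near the minimum there is a pair \<open>(h\<^sub>k, h\<^sub>k\<^sub>+\<^sub>1)\<close> whose degrees scale
  exactly under all iterates, forwards for one component and backwards for the other. The degrees of
  two such balanced pairs multiply under composition; applied to \<open>S\<close> and \<open>S\<^sup>-\<^sup>1\<close> this forces all four
  degrees to be 1, so that the pair is affine. Hence every symmetry or reversor is
  an explicit affine or Henon-like map times a power of \<open>L\<close>, without appeal to Jung's theorem.
\<close>

section \<open>The total degree of polynomial functions on the plane\<close>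

text \<open>Cancellation is the obstacle: the degree of a composite is bounded by the product of the
  degrees, with equality only if leading terms survive. When one inner component dominates, survival
  depends on a single coefficient of the outer function, so one substitution of known degree settles
  all similar ones; this is what makes the degrees of balanced pairs multiply. The rigidity theorem
  speaks of conjugacies between two possibly different compositions. The inverse of
  \<open>L\<close>, with coordinates exchanged, is again a standard map, with polynomials
  \<open>- p2\<close> and \<open>- p1\<close>, so one theorem treats symmetries and reversors. A
  shift by a single Henon map exchanges the two polynomials; for symmetries it is the source of S2
  and S3, for reversors that of R1, R2 and R3. The sign \<open>d\<close> in the Henon maps serves
  the case of one linear polynomial, where eliminating a coordinate gives a Henon map of sign
  -1.\<close>

text \<open>
  The substitution \<open>(x, y) = (x t, t)\<close> sends \<open>x\<^sup>i y\<^sup>j\<close> to \<open>x\<^sup>i t\<^sup>i\<^sup>+\<^sup>j\<close>. Distinct monomials stay distinct, so the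
  total degree is the degree in \<open>t\<close> over the domain of polynomials in \<open>x\<close>.
\<close>

definition homog_rep :: "(real \<times> real \<Rightarrow> real) \<Rightarrow> real poly poly \<Rightarrow> bool" where
  "homog_rep h Q \<longleftrightarrow> (\<forall>k. degree (coeff Q k) \<le> k) \<and> (\<forall>x t. h (x * t, t) = poly (poly Q [:t:]) x)"

lemma homog_rep_const: "homog_rep (\<lambda>z. c) [:[:c:]:]"
  by (auto simp: homog_rep_def coeff_pCons split: nat.split)

lemma homog_rep_add:
  "homog_rep f P \<Longrightarrow> homog_rep g Q \<Longrightarrow> homog_rep (\<lambda>z. f z + g z) (P + Q)"
  by (auto simp: homog_rep_def intro!: degree_add_le)

lemma homog_rep_mult:
  assumes "homog_rep f P" "homog_rep g Q" shows "homog_rep (\<lambda>z. f z * g z) (P * Q)"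
proof -
  have "degree (coeff (P * Q) k) \<le> k" for k
    unfolding coeff_mult
  proof (intro degree_sum_le)
    fix i assume "i \<in> {..k}"
    moreover have "degree (coeff P i * coeff Q (k - i)) \<le> degree (coeff P i) + degree (coeff Q (k - i))"
      by (rule degree_mult_le)
    moreover have "degree (coeff P i) \<le> i" "degree (coeff Q (k - i)) \<le> k - i"
      using assms by (auto simp: homog_rep_def)
    ultimately show "degree (coeff P i * coeff Q (k - i)) \<le> k" by simp
  qed simp
  then show ?thesis using assms by (auto simp: homog_rep_def)
qed

lemma homog_rep_linear:
  assumes "bounded_linear h" shows "homog_rep h [:0, [:h (0, 1), h (1, 0):]:]"
proof -
  interpret bounded_linear h by fact
  have "h (x * t, t) = t * (h (0, 1) + x * h (1, 0))" for x t
  proof -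
    have "(x * t, t) = (x * t) *\<^sub>R (1, 0) + t *\<^sub>R (0, 1::real)" by simp
    then have "h (x * t, t) = (x * t) *\<^sub>R h (1, 0) + t *\<^sub>R h (0, 1)" by (metis add scaleR)
    then show ?thesis by (simp add: algebra_simps)
  qed
  then have "\<forall>x t. h (x * t, t) = poly (poly [:0, [:h (0, 1), h (1, 0):]:] [:t:]) x"
    by (auto simp: algebra_simps)
  then show ?thesis
    by (auto simp: homog_rep_def coeff_pCons split: nat.split)
qed

lemma homog_rep_exists: "real_polynomial_function h \<Longrightarrow> \<exists>Q. homog_rep h Q"
proof (induction rule: real_polynomial_function.induct)
qed (blast intro: homog_rep_const homog_rep_add homog_rep_mult homog_rep_linear)+

text \<open>The elements \<open>[:t:]\<close> form an infinite subset of the domain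
  \<open>real poly\<close>, whereas a nonzero \<open>Q\<close> has finitely many roots
  there.\<close>

lemma homog_rep_zero:
  assumes "homog_rep (\<lambda>z. 0) Q" shows "Q = 0"
proof (rule ccontr)
  assume "Q \<noteq> 0"
  then have fin: "finite {c. poly Q c = 0}" by (rule poly_roots_finite)
  have "poly Q [:t:] = 0" for t
  proof -
    have "\<forall>x. poly (poly Q [:t:]) x = 0" using assms by (simp add: homog_rep_def)
    then show ?thesis by (simp add: poly_all_0_iff_0)
  qed
  then have "range (\<lambda>t::real. [:t:]) \<subseteq> {c. poly Q c = 0}" by auto
  then have "finite (range (\<lambda>t::real. [:t:]))" using fin finite_subset by blast
  moreover have "inj (\<lambda>t::real. [:t:])" by (simp add: inj_on_def)
  ultimately show False using finite_imageD infinite_UNIV_char_0 by blast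
qed

lemma homog_rep_unique:
  assumes "homog_rep h P" "homog_rep h Q" shows "P = Q"
proof -
  have "homog_rep (\<lambda>z. h z + (- 1) * h z) (P + [:[:- 1:]:] * Q)"
    by (intro homog_rep_add homog_rep_mult homog_rep_const assms)
  moreover have "P + [:[:- 1:]:] * Q = P - Q"
    by (intro poly_eqI) simp
  ultimately have "homog_rep (\<lambda>z. 0) (P - Q)" by simp
  then show ?thesis using homog_rep_zero by fastforce
qed

text \<open>The zero function gets degree 0 like every other constant, so the exact product rules
  carry the hypothesis that both factors are nonzero functions. Outside polynomial functions the
  value is unspecified.\<close>

definition dg :: "(real \<times> real \<Rightarrow> real) \<Rightarrow> nat" where
  "dg h = degree (THE Q. homog_rep h Q)"

lemma dg_eq: "homog_rep h Q \<Longrightarrow> dg h = degree Q"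
  unfolding dg_def using homog_rep_unique by (metis the_equality)

abbreviation rpf :: "(real \<times> real \<Rightarrow> real) \<Rightarrow> bool" where
  "rpf \<equiv> real_polynomial_function"

lemma rpf_fst [intro, simp]: "rpf fst" and rpf_snd [intro, simp]: "rpf snd"
  by (auto intro: real_polynomial_function.intros(1) bounded_linear_fst bounded_linear_snd)

lemma rpf_poly [intro]: "rpf f \<Longrightarrow> rpf (\<lambda>z. poly p (f z))"
  by (induction p) auto

text \<open>Taking \<open>t = y\<close> and \<open>x / y\<close> in place of \<open>x\<close> undoes
  the substitution off the line \<open>y = 0\<close>. Of this line the substitution reaches only the
  origin; the rest is filled in by continuity of both sides.\<close>

lemma homog_rep_expansion:
  assumes h: "rpf h" and Q: "homog_rep h Q"
  shows "h (x, y) = (\<Sum>k\<le>degree Q. \<Sum>i\<le>k. coeff (coeff Q k) i * x ^ i * y ^ (k - i))"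
    (is "_ = ?r x y")
proof -
  have nz: "h (x, y) = ?r x y" if "y \<noteq> 0" for y
  proof -
    have "h (x, y) = poly (poly Q [:y:]) (x / y)"
      using Q that unfolding homog_rep_def by (metis nonzero_divide_eq_eq)
    also have "\<dots> = (\<Sum>k\<le>degree Q. poly (coeff Q k) (x / y) * y ^ k)"
      by (simp add: poly_altdef[of Q] poly_sum poly_power)
    also have "\<dots> = ?r x y"
    proof (intro sum.cong refl)
      fix k
      \<comment> \<open>Summing up to \<open>k\<close> instead of up to the degree keeps
        \<open>k - i\<close> an honest difference, so that no negative power of \<open>y\<close>
        remains.\<close>
      have "poly (coeff Q k) (x / y) = (\<Sum>i\<le>k. coeff (coeff Q k) i * (x / y) ^ i)"
        using Q unfolding poly_altdef homog_rep_def
        by (intro sum.mono_neutral_left) (auto simp: coeff_eq_0)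
      then have "poly (coeff Q k) (x / y) * y ^ k
          = (\<Sum>i\<le>k. coeff (coeff Q k) i * (x / y) ^ i * y ^ k)" by (simp add: sum_distrib_right)
      also have "\<dots> = (\<Sum>i\<le>k. coeff (coeff Q k) i * x ^ i * y ^ (k - i))"
        using that by (intro sum.cong refl) (auto simp: power_divide power_diff)
      finally show "poly (coeff Q k) (x / y) * y ^ k = \<dots>" .
    qed
    finally show ?thesis .
  qed
  have "continuous (at (x, 0)) h"
    using h by (rule continuous_real_polymonial_function)
  then have "isCont (\<lambda>y. h (x, y)) 0"
    by (intro isCont_o2[where g = h and f = "\<lambda>y. (x, y)"]) (auto intro!: continuous_intros)
  then have "((\<lambda>y. h (x, y)) \<longlongrightarrow> h (x, 0)) (at 0)" by (simp add: isCont_def)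
  moreover have "\<forall>\<^sub>F y in at 0. h (x, y) = ?r x y"
    using nz by (auto simp: eventually_at intro!: exI[of _ 1])
  ultimately have "(?r x \<longlongrightarrow> h (x, 0)) (at 0)"
    by (auto elim: Lim_transform_eventually)
  moreover have "isCont (?r x) 0" by (intro continuous_intros)
  then have "(?r x \<longlongrightarrow> ?r x 0) (at 0)" by (simp only: isCont_def)
  ultimately have "h (x, 0) = ?r x 0" using LIM_unique by blast
  then show ?thesis using nz by (cases "y = 0") auto
qed

lemma poly_function_expansion:
  assumes "rpf h"
  obtains c where "\<And>x y. h (x, y) = (\<Sum>k\<le>dg h. \<Sum>i\<le>k. c k i * x ^ i * y ^ (k - i))"
proof -
  obtain Q where Q: "homog_rep h Q" using homog_rep_exists assms by blast
  show ?thesis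
    by (rule that[of "\<lambda>k i. coeff (coeff Q k) i"])
       (use homog_rep_expansion[OF assms Q] dg_eq[OF Q] in simp)
qed

section \<open>Degree rules for sums, products and powers\<close>

lemma dg_const [simp]: "dg (\<lambda>z. c) = 0"
  using dg_eq[OF homog_rep_const] by simp

lemma dg_fst [simp]: "dg fst = 1" and dg_snd [simp]: "dg snd = 1"
  using dg_eq[OF homog_rep_linear[OF bounded_linear_fst]] dg_eq[OF homog_rep_linear[OF bounded_linear_snd]]
  by simp_all

lemma dg_mult:
  assumes "rpf f" "rpf g" "\<exists>z. f z \<noteq> 0" "\<exists>z. g z \<noteq> 0"
  shows "dg (\<lambda>z. f z * g z) = dg f + dg g"
proof -
  obtain P Q where *: "homog_rep f P" "homog_rep g Q" using homog_rep_exists assms by blast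
  have "P \<noteq> 0" using homog_rep_expansion[OF assms(1) *(1)] assms(3) by auto
  moreover have "Q \<noteq> 0" using homog_rep_expansion[OF assms(2) *(2)] assms(4) by auto
  ultimately show ?thesis
    using dg_eq[OF homog_rep_mult[OF *]] dg_eq[OF *(1)] dg_eq[OF *(2)] by (simp add: degree_mult_eq)
qed

lemma dg_mult_le:
  assumes "rpf f" "rpf g" shows "dg (\<lambda>z. f z * g z) \<le> dg f + dg g"
proof -
  obtain P Q where *: "homog_rep f P" "homog_rep g Q" using homog_rep_exists assms by blast
  then show ?thesis
    using dg_eq[OF homog_rep_mult[OF *]] dg_eq[OF *(1)] dg_eq[OF *(2)] by (simp add: degree_mult_le)
qed

lemma dg_cmult:
  assumes "rpf f" "c \<noteq> 0" shows "dg (\<lambda>z. c * f z) = dg f"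
proof -
  obtain P where *: "homog_rep f P" using homog_rep_exists assms by blast
  from dg_eq[OF homog_rep_mult[OF homog_rep_const this, of c]] dg_eq[OF this] assms
  show ?thesis by simp
qed

lemma dg_add_le:
  assumes "rpf f" "rpf g" "dg f \<le> n" "dg g \<le> n" shows "dg (\<lambda>z. f z + g z) \<le> n"
proof -
  obtain P Q where *: "homog_rep f P" "homog_rep g Q" using homog_rep_exists assms by blast
  then show ?thesis
    using dg_eq[OF homog_rep_add[OF *]] dg_eq[OF *(1)] dg_eq[OF *(2)] assms by (simp add: degree_add_le)
qed

lemma dg_add_eq:
  assumes "rpf f" "rpf g" "dg g < dg f" shows "dg (\<lambda>z. f z + g z) = dg f"
proof -
  obtain P Q where *: "homog_rep f P" "homog_rep g Q" using homog_rep_exists assms by blast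
  then show ?thesis
    using dg_eq[OF homog_rep_add[OF *]] dg_eq[OF *(1)] dg_eq[OF *(2)] assms by (simp add: degree_add_eq_left)
qed

lemma rpf_sum: "finite I \<Longrightarrow> (\<And>i. i \<in> I \<Longrightarrow> rpf (f i)) \<Longrightarrow> rpf (\<lambda>z. \<Sum>i\<in>I. f i z)"
  by (induction I rule: finite_induct) auto

lemma dg_sum_le:
  "finite I \<Longrightarrow> (\<And>i. i \<in> I \<Longrightarrow> rpf (f i)) \<Longrightarrow> (\<And>i. i \<in> I \<Longrightarrow> dg (f i) \<le> n)
    \<Longrightarrow> dg (\<lambda>z. \<Sum>i\<in>I. f i z) \<le> n"
  by (induction I rule: finite_induct) (auto intro!: dg_add_le rpf_sum)

lemma rpf_power [intro]: "rpf f \<Longrightarrow> rpf (\<lambda>z. f z ^ n)"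
  by (induction n) auto

lemma dg_power_le:
  assumes "rpf f" shows "dg (\<lambda>z. f z ^ n) \<le> n * dg f"
proof (induction n)
  case (Suc n)
  then show ?case using dg_mult_le[of f "\<lambda>z. f z ^ n"] assms by fastforce
qed simp

lemma dg_power:
  assumes "rpf f" "\<exists>z. f z \<noteq> 0" shows "dg (\<lambda>z. f z ^ n) = n * dg f"
proof (induction n)
  case (Suc n)
  have "\<exists>z. f z ^ n \<noteq> 0" using assms(2) by auto
  then show ?case using Suc dg_mult[of f "\<lambda>z. f z ^ n"] assms by auto
qed simp

lemma dg_pos_nonzero: "dg f > 0 \<Longrightarrow> \<exists>z. f z \<noteq> 0"
  by (metis dg_const ext less_irrefl)

lemma dg_eq_0_imp_const:
  assumes "rpf h" "dg h = 0" obtains c where "h = (\<lambda>z. c)"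
proof -
  obtain c where "\<And>x y. h (x, y) = (\<Sum>k\<le>dg h. \<Sum>i\<le>k. c k i * x ^ i * y ^ (k - i))"
    using poly_function_expansion assms(1) by blast
  then show ?thesis using assms(2) by (intro that[of "c 0 0"]) auto
qed

lemma dg_le_1_imp_affine:
  assumes "rpf h" "dg h \<le> 1"
  obtains a b c where "\<And>x y. h (x, y) = a * x + b * y + c"
proof -
  obtain c where c: "\<And>x y. h (x, y) = (\<Sum>k\<le>dg h. \<Sum>i\<le>k. c k i * x ^ i * y ^ (k - i))"
    using poly_function_expansion assms(1) by blast
  consider "dg h = 0" | "dg h = 1" using assms(2) by linarith
  then show ?thesis
  proof cases
    case 1
    then show ?thesis using c by (intro that[of 0 0 "c 0 0"]) auto
  next
    case 2
    then show ?thesis using c by (intro that[of "c 1 1" "c 1 0" "c 0 0"]) auto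
  qed
qed

lemma dg_poly:
  assumes f: "rpf f" and pos: "dg f > 0"
  shows "dg (\<lambda>z. poly p (f z)) = degree p * dg f"
proof (induction p)
  case (pCons a p)
  show ?case
  proof (cases "p = 0")
    case False
    have "\<exists>z. poly p (f z) \<noteq> 0"
    proof (cases "degree p = 0")
      case True
      then obtain c where "p = [:c:]" using degree_eq_zeroE by blast
      with False show ?thesis by simp
    next
      case False
      with pCons.IH pos show ?thesis by (intro dg_pos_nonzero) simp
    qed
    then have "dg (\<lambda>z. f z * poly p (f z)) = dg f + degree p * dg f"
      using dg_mult[of f "\<lambda>z. poly p (f z)"] f dg_pos_nonzero[OF pos] pCons.IH by auto
    moreover from this have "dg (\<lambda>z. f z * poly p (f z) + a) = dg (\<lambda>z. f z * poly p (f z))"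
      using f pos by (intro dg_add_eq) auto
    ultimately show ?thesis using False by (simp add: add.commute)
  qed simp
qed simp

section \<open>Degrees of composites and the loss of leading terms\<close>

lemma rpf_monomial: "rpf f \<Longrightarrow> rpf g \<Longrightarrow> rpf (\<lambda>z. c * f z ^ i * g z ^ j)"
  by (intro real_polynomial_function.intros(4) rpf_power) (rule real_polynomial_function.intros(2))

lemma rpf_comp:
  assumes "rpf h" "rpf f" "rpf g" shows "rpf (\<lambda>z. h (f z, g z))"
proof -
  obtain c where c: "\<And>x y. h (x, y) = (\<Sum>k\<le>dg h. \<Sum>i\<le>k. c k i * x ^ i * y ^ (k - i))"
    using poly_function_expansion assms(1) by blast
  show ?thesis unfolding c by (intro rpf_sum rpf_monomial assms) auto
qed

lemma dg_monomial_le: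
  assumes "rpf f" "rpf g"
  shows "dg (\<lambda>z. c * f z ^ i * g z ^ j) \<le> i * dg f + j * dg g"
proof -
  have "dg (\<lambda>z. c * f z ^ i * g z ^ j) \<le> dg (\<lambda>z. c * f z ^ i) + dg (\<lambda>z. g z ^ j)"
    using assms by (intro dg_mult_le) auto
  also have "dg (\<lambda>z. c * f z ^ i) \<le> dg (\<lambda>z. f z ^ i)"
    using dg_mult_le[of "\<lambda>z. c" "\<lambda>z. f z ^ i"] assms by auto
  finally show ?thesis using dg_power_le[of f i] dg_power_le[of g j] assms by linarith
qed

lemma dg_comp_le:
  assumes "rpf h" "rpf f" "rpf g" "dg f \<le> b" "dg g \<le> b"
  shows "dg (\<lambda>z. h (f z, g z)) \<le> dg h * b"
proof -
  obtain c where c: "\<And>x y. h (x, y) = (\<Sum>k\<le>dg h. \<Sum>i\<le>k. c k i * x ^ i * y ^ (k - i))"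
    using poly_function_expansion assms(1) by blast
  have *: "dg (\<lambda>z. c k i * f z ^ i * g z ^ (k - i)) \<le> dg h * b" if "k \<le> dg h" "i \<le> k" for k i
  proof -
    have "dg (\<lambda>z. c k i * f z ^ i * g z ^ (k - i)) \<le> i * dg f + (k - i) * dg g"
      by (rule dg_monomial_le) fact+
    also have "\<dots> \<le> i * b + (k - i) * b" using assms by (intro add_mono mult_le_mono) auto
    also have "\<dots> = k * b" using that by (simp flip: add_mult_distrib)
    finally show ?thesis using that by (meson mult_le_mono1 order_trans)
  qed
  show ?thesis unfolding c
    by (intro dg_sum_le rpf_sum) (auto intro!: rpf_monomial assms *)
qed

lemma dg_swap [simp]: 
  assumes "rpf h" shows "dg (\<lambda>z. h (snd z, fst z)) = dg h"
proof (rule antisym)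
  show 1: "dg (\<lambda>z. h (snd z, fst z)) \<le> dg h"
    using dg_comp_le[OF assms rpf_snd rpf_fst, of 1] by simp
  have "rpf (\<lambda>z. h (snd z, fst z))" using assms by (intro rpf_comp) auto
  from dg_comp_le[OF this rpf_snd rpf_fst, of 1] show "dg h \<le> dg (\<lambda>z. h (snd z, fst z))" by simp
qed

text \<open>The constant \<open>c\<close> is the coefficient of \<open>y\<^sup>N\<close>, \<open>N = dg h\<close>; it decides, for
  every substitution in which the second component dominates, whether there is cancellation.\<close>

lemma dg_comp_dominant_snd:
  assumes h: "rpf h" and pos: "dg h > 0"
  obtains c :: real where
    "\<And>f g. rpf f \<Longrightarrow> rpf g \<Longrightarrow> dg f < dg g \<Longrightarrow> c \<noteq> 0 \<Longrightarrow> dg (\<lambda>z. h (f z, g z)) = dg h * dg g"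
    "\<And>f g. rpf f \<Longrightarrow> rpf g \<Longrightarrow> dg f < dg g \<Longrightarrow> c = 0 \<Longrightarrow> dg (\<lambda>z. h (f z, g z)) < dg h * dg g"
proof -
  obtain c where c: "\<And>x y. h (x, y) = (\<Sum>k\<le>dg h. \<Sum>i\<le>k. c k i * x ^ i * y ^ (k - i))"
    using poly_function_expansion assms(1) by blast
  define N where "N = dg h"
  \<comment> \<open>All monomials except \<open>y ^ N\<close>. When the second component dominates,
    each of them falls strictly below degree \<open>N * dg g\<close>.\<close>
  define I where "I = (SIGMA k:{..N}. {..k}) - {(N, 0)}"
  have fin: "finite I" by (simp add: I_def)
  have exp: "h (x, y) = c N 0 * y ^ N + (\<Sum>(k, i)\<in>I. c k i * x ^ i * y ^ (k - i))" for x y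
  proof -
    have "h (x, y) = (\<Sum>(k, i)\<in>(SIGMA k:{..N}. {..k}). c k i * x ^ i * y ^ (k - i))"
      unfolding c N_def by (subst sum.Sigma) auto
    also have "\<dots> = (\<Sum>(k, i)\<in>{(N, 0)}. c k i * x ^ i * y ^ (k - i)) + (\<Sum>(k, i)\<in>I. c k i * x ^ i * y ^ (k - i))"
      unfolding I_def by (subst sum.subset_diff[of "{(N, 0)}"]) auto
    finally show ?thesis by simp
  qed
  have *: "dg (\<lambda>z. \<Sum>(k, i)\<in>I. c k i * f z ^ i * g z ^ (k - i)) < N * dg g"
    (is "dg ?r < _") and rpfr: "rpf (\<lambda>z. \<Sum>(k, i)\<in>I. c k i * f z ^ i * g z ^ (k - i))"
    if fg: "rpf f" "rpf g" "dg f < dg g" for f g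
  proof -
    show "rpf ?r" using fin fg by (intro rpf_sum) (auto intro!: rpf_monomial)
    \<comment> \<open>Strictness is encoded by subtracting 1, since the rule for sums takes a weak
      bound; the truncated subtraction is harmless because \<open>N * dg g\<close> is
      positive.\<close>
    have "dg (\<lambda>z. c k i * f z ^ i * g z ^ (k - i)) \<le> N * dg g - 1" if "(k, i) \<in> I" for k i
    proof -
      have le: "dg (\<lambda>z. c k i * f z ^ i * g z ^ (k - i)) \<le> i * dg f + (k - i) * dg g"
        by (rule dg_monomial_le) fact+
      have "i * dg f + (k - i) * dg g < N * dg g"
      proof (cases "i = 0")
        case True
        then show ?thesis using that fg by (auto simp: I_def)
      next
        case False
        then have "i * dg f + (k - i) * dg g < i * dg g + (k - i) * dg g" using fg by simp
        also have "\<dots> = k * dg g" using that by (auto simp: I_def simp flip: add_mult_distrib)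
        also have "\<dots> \<le> N * dg g" using that by (auto simp: I_def)
        finally show ?thesis .
      qed
      with le show ?thesis by linarith
    qed
    then have "dg ?r \<le> N * dg g - 1"
      using fin fg by (intro dg_sum_le) (auto intro!: rpf_monomial)
    moreover have "N * dg g > 0" using pos fg by (simp add: N_def)
    ultimately show "dg ?r < N * dg g" by linarith
  qed
  show ?thesis
  proof (rule that[of "c N 0"])
    fix f g assume fg: "rpf f" "rpf g" "dg f < dg g" and nz: "c N 0 \<noteq> 0"
    have "dg (\<lambda>z. c N 0 * g z ^ N) = N * dg g"
      using fg nz dg_pos_nonzero[of g] by (subst dg_cmult) (auto intro: dg_power)
    then show "dg (\<lambda>z. h (f z, g z)) = dg h * dg g"
      unfolding exp using *[OF fg] rpfr[OF fg] fg by (subst dg_add_eq) (auto simp: N_def)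
  next
    fix f g assume fg: "rpf f" "rpf g" "dg f < dg g" and nz: "c N 0 = 0"
    then show "dg (\<lambda>z. h (f z, g z)) < dg h * dg g"
      unfolding exp using *[OF fg] by (simp add: N_def)
  qed
qed

text \<open>Whether the top power of the second variable occurs is a property of \<open>h\<close>
  alone. A single substitution without loss of degree therefore certifies it for all substitutions
  with dominant second component.\<close>

lemma dg_comp_transfer_snd:
  assumes "rpf h" "rpf f" "rpf g" "rpf f'" "rpf g'" "dg f < dg g" "dg f' < dg g'"
    and "dg h > 0" "dg (\<lambda>z. h (f z, g z)) = dg h * dg g"
  shows "dg (\<lambda>z. h (f' z, g' z)) = dg h * dg g'"
  using dg_comp_dominant_snd[OF assms(1) assms(8)] assms by (metis less_irrefl)

lemma dg_comp_transfer_fst: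
  assumes h: "rpf h" and fg: "rpf f" "rpf g" "rpf f'" "rpf g'" "dg g < dg f" "dg g' < dg f'"
    and "dg h > 0" "dg (\<lambda>z. h (f z, g z)) = dg h * dg f"
  shows "dg (\<lambda>z. h (f' z, g' z)) = dg h * dg f'"
proof -
  have "rpf (\<lambda>z. h (snd z, fst z))" using h by (intro rpf_comp) auto
  from dg_comp_transfer_snd[OF this fg(2,1,4,3)] show ?thesis using assms by simp
qed

section \<open>Groups generated by an element of infinite order and involutions\<close>

context group begin

lemma internal_semidirect_set_mult:
  assumes N: "subgroup N G" and H: "subgroup H G"
    and conj: "\<And>h n. h \<in> H \<Longrightarrow> n \<in> N \<Longrightarrow> h \<otimes> n \<otimes> inv h \<in> N"
    and int: "N \<inter> H = {\<one>}"
  shows "internal_semidirect G N H (N <#> H)"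
proof -
  note sub = subgroup.mem_carrier[OF N] subgroup.mem_carrier[OF H]
  have K: "subgroup (N <#> H) G"
  proof (rule subgroupI)
    show "N <#> H \<subseteq> carrier G" using sub by (auto simp: set_mult_def)
    have "\<one> \<otimes> \<one> \<in> N <#> H"
      using subgroup.one_closed[OF N] subgroup.one_closed[OF H] unfolding set_mult_def by blast
    then show "N <#> H \<noteq> {}" by blast
  next
    fix x assume "x \<in> N <#> H"
    then obtain n h where nh: "n \<in> N" "h \<in> H" "x = n \<otimes> h" by (auto simp: set_mult_def)
    have "inv x = (inv h \<otimes> inv n \<otimes> inv (inv h)) \<otimes> inv h"
      using nh sub by (simp add: inv_mult_group m_assoc)
    moreover have "inv h \<otimes> inv n \<otimes> inv (inv h) \<in> N"
      using nh subgroup.m_inv_closed[OF N] subgroup.m_inv_closed[OF H] by (intro conj) auto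
    ultimately show "inv x \<in> N <#> H"
      using nh subgroup.m_inv_closed[OF H] unfolding set_mult_def by blast
  next
    fix x y assume "x \<in> N <#> H" "y \<in> N <#> H"
    then obtain n h n' h' where nh: "n \<in> N" "h \<in> H" "x = n \<otimes> h" "n' \<in> N" "h' \<in> H" "y = n' \<otimes> h'"
      by (auto simp: set_mult_def)
    have "x \<otimes> y = (n \<otimes> (h \<otimes> n' \<otimes> inv h)) \<otimes> (h \<otimes> h')"
    proof -
      have "inv h \<otimes> (h \<otimes> h') = h'" using nh sub by (simp flip: m_assoc)
      then show ?thesis using nh sub by (simp add: m_assoc)
    qed
    moreover have "n \<otimes> (h \<otimes> n' \<otimes> inv h) \<in> N" "h \<otimes> h' \<in> H"
      using nh conj subgroup.m_closed[OF N] subgroup.m_closed[OF H] by auto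
    ultimately show "x \<otimes> y \<in> N <#> H" unfolding set_mult_def by blast
  qed
  have "N \<subseteq> N <#> H"
  proof
    fix n assume "n \<in> N"
    moreover from this have "n = n \<otimes> \<one>" using sub by simp
    ultimately show "n \<in> N <#> H" using subgroup.one_closed[OF H] unfolding set_mult_def by blast
  qed
  then have NK: "subgroup N (G\<lparr>carrier := N <#> H\<rparr>)" by (rule subgroup_incl[OF N K])
  have "x \<otimes> m \<otimes> inv x \<in> N" if "x \<in> N <#> H" "m \<in> N" for x m
  proof -
    from that obtain n h where nh: "n \<in> N" "h \<in> H" "x = n \<otimes> h" by (auto simp: set_mult_def)
    have "x \<otimes> m \<otimes> inv x = n \<otimes> (h \<otimes> m \<otimes> inv h) \<otimes> inv n"
      using nh sub that by (simp add: inv_mult_group m_assoc)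
    then show ?thesis
      using nh that conj subgroup.m_closed[OF N] subgroup.m_inv_closed[OF N] by auto
  qed
  then have "normal N (G\<lparr>carrier := N <#> H\<rparr>)"
    unfolding group.normal_inv_iff[OF subgroup.subgroup_is_group[OF K group_axioms]]
    using NK m_inv_consistent[OF K] by simp
  then show ?thesis using K H int unfolding internal_semidirect_def by blast
qed

lemma internal_direct_set_mult:
  assumes N: "subgroup N G" and H: "subgroup H G"
    and comm: "\<And>h n. h \<in> H \<Longrightarrow> n \<in> N \<Longrightarrow> h \<otimes> n = n \<otimes> h"
    and int: "N \<inter> H = {\<one>}"
  shows "internal_direct G N H (N <#> H)"
proof -
  note sub = subgroup.mem_carrier[OF N] subgroup.mem_carrier[OF H]
  have 1: "internal_semidirect G N H (N <#> H)"
  proof (rule internal_semidirect_set_mult[OF N H _ int])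
    fix h n assume "h \<in> H" "n \<in> N"
    then show "h \<otimes> n \<otimes> inv h \<in> N" using comm[of h n] sub by (simp add: m_assoc)
  qed
  have "internal_semidirect G H N (H <#> N)"
  proof (rule internal_semidirect_set_mult[OF H N])
    fix h n assume "n \<in> N" "h \<in> H"
    then show "n \<otimes> h \<otimes> inv n \<in> H" using comm[of h n, symmetric] sub by (simp add: m_assoc)
  qed (use int in blast)
  moreover have "H <#> N = N <#> H" using comm unfolding set_mult_def by force
  ultimately show ?thesis using 1 unfolding internal_direct_def internal_semidirect_def by simp
qed

text \<open>The parametrisation runs from the model to the subgroup because normal forms such as
  \<open>a [^] n \<otimes> r\<close> are written down in this direction. Closure under
  multiplication is included since the model may be a bare semidirect product record.\<close>

definition iso_param :: "('x \<Rightarrow> 'a) \<Rightarrow> ('x, 'y) monoid_scheme \<Rightarrow> 'a set \<Rightarrow> bool" where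
  "iso_param \<phi> D K \<longleftrightarrow> bij_betw \<phi> (carrier D) K \<and>
     (\<forall>x\<in>carrier D. \<forall>y\<in>carrier D.
        x \<otimes>\<^bsub>D\<^esub> y \<in> carrier D \<and> \<phi> (x \<otimes>\<^bsub>D\<^esub> y) = \<phi> x \<otimes> \<phi> y)"

lemma iso_param_is_iso:
  assumes "iso_param \<phi> D K"
  shows "G\<lparr>carrier := K\<rparr> \<cong> D"
proof -
  have bij: "bij_betw \<phi> (carrier D) K"
    and hom: "\<And>x y. x \<in> carrier D \<Longrightarrow> y \<in> carrier D \<Longrightarrow>
       x \<otimes>\<^bsub>D\<^esub> y \<in> carrier D \<and> \<phi> (x \<otimes>\<^bsub>D\<^esub> y) = \<phi> x \<otimes> \<phi> y"
    using assms unfolding iso_param_def by blast+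
  let ?\<psi> = "inv_into (carrier D) \<phi>"
  have bij': "bij_betw ?\<psi> K (carrier D)" using bij by (rule bij_betw_inv_into)
  have "?\<psi> (u \<otimes> v) = ?\<psi> u \<otimes>\<^bsub>D\<^esub> ?\<psi> v" if "u \<in> K" "v \<in> K" for u v
  proof -
    have in_D: "?\<psi> u \<in> carrier D" "?\<psi> v \<in> carrier D" using bij' that by (auto dest: bij_betwE)
    then have "\<phi> (?\<psi> u \<otimes>\<^bsub>D\<^esub> ?\<psi> v) = u \<otimes> v"
      using hom bij_betw_inv_into_right[OF bij] that by simp
    then show ?thesis using hom[OF in_D] bij_betw_inv_into_left[OF bij] by metis
  qed
  then have "?\<psi> \<in> iso (G\<lparr>carrier := K\<rparr>) D"
    unfolding iso_def hom_def using bij' by (auto dest: bij_betwE)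
  then show ?thesis by (rule is_isoI)
qed

text \<open>Normal forms multiply by moving \<open>g h\<close> to the right past
  \<open>f n'\<close>, which is what the relation for \<open>act\<close> provides; the trivial
  intersection makes normal forms unique.\<close>

lemma iso_param_semidirect:
  assumes f: "iso_param f A N" and g: "iso_param g B H"
    and N: "subgroup N G" and H: "subgroup H G" and int: "N \<inter> H = {\<one>}"
    and act: "\<And>n h. n \<in> carrier A \<Longrightarrow> h \<in> carrier B \<Longrightarrow>
      act h n \<in> carrier A \<and> g h \<otimes> f n = f (act h n) \<otimes> g h"
  shows "iso_param (\<lambda>(n, h). f n \<otimes> g h) (semidirect_prod A B act) (N <#> H)"
proof -
  note sub = subgroup.mem_carrier[OF N] subgroup.mem_carrier[OF H]
  have bf: "bij_betw f (carrier A) N" and bg: "bij_betw g (carrier B) H"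
    using f g unfolding iso_param_def by blast+
  have car: "carrier (semidirect_prod A B act) = carrier A \<times> carrier B"
    by (simp add: semidirect_prod_def)
  have fN: "f n \<in> N" if "n \<in> carrier A" for n using bf that by (auto dest: bij_betwE)
  have gH: "g h \<in> H" if "h \<in> carrier B" for h using bg that by (auto dest: bij_betwE)
  have "bij_betw (\<lambda>(n, h). f n \<otimes> g h) (carrier A \<times> carrier B) (N <#> H)"
  proof (rule bij_betw_imageI)
    show "inj_on (\<lambda>(n, h). f n \<otimes> g h) (carrier A \<times> carrier B)"
    proof (rule inj_onI, clarify)
      fix n h n' h' assume nh: "n \<in> carrier A" "h \<in> carrier B" "n' \<in> carrier A" "h' \<in> carrier B"
        and eq: "f n \<otimes> g h = f n' \<otimes> g h'"
      have c: "f n \<in> carrier G" "g h \<in> carrier G" "f n' \<in> carrier G" "g h' \<in> carrier G"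
        using nh fN gH sub by auto
      have "f n \<otimes> g h \<otimes> inv (g h) = f n' \<otimes> g h' \<otimes> inv (g h)" using eq by simp
      then have fn: "f n = f n' \<otimes> (g h' \<otimes> inv (g h))" using c by (simp add: m_assoc)
      then have "inv (f n') \<otimes> f n = inv (f n') \<otimes> (f n' \<otimes> (g h' \<otimes> inv (g h)))" by simp
      also have "\<dots> = g h' \<otimes> inv (g h)" using c by (simp flip: m_assoc)
      finally have "inv (f n') \<otimes> f n = g h' \<otimes> inv (g h)" .
      moreover have "inv (f n') \<otimes> f n \<in> N" "g h' \<otimes> inv (g h) \<in> H"
        using nh fN gH by (simp_all add: subgroup.m_closed[OF N] subgroup.m_inv_closed[OF N]
            subgroup.m_closed[OF H] subgroup.m_inv_closed[OF H])
      ultimately have 1: "g h' \<otimes> inv (g h) = \<one>" using int by auto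
      then have "f n = f n'" using fn c by simp
      moreover have "g h' \<otimes> inv (g h) \<otimes> g h = \<one> \<otimes> g h" using 1 by simp
      then have "g h = g h'" using c by (simp add: m_assoc)
      ultimately have "f n = f n'" "g h = g h'" by blast+
      then show "n = n' \<and> h = h'"
        using nh bf bg by (auto simp: bij_betw_def inj_on_def)
    qed
    show "(\<lambda>(n, h). f n \<otimes> g h) ` (carrier A \<times> carrier B) = N <#> H"
      using bf bg unfolding bij_betw_def set_mult_def by fast
  qed
  moreover have "f (n \<otimes>\<^bsub>A\<^esub> act h n') \<otimes> g (h \<otimes>\<^bsub>B\<^esub> h') = f n \<otimes> g h \<otimes> (f n' \<otimes> g h')"
    if "n \<in> carrier A" "n' \<in> carrier A" "h \<in> carrier B" "h' \<in> carrier B" for n n' h h'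
  proof -
    have c: "f n \<in> carrier G" "f n' \<in> carrier G" "f (act h n') \<in> carrier G" "g h \<in> carrier G" "g h' \<in> carrier G"
      using that act fN gH sub by auto
    have "f n \<otimes> g h \<otimes> (f n' \<otimes> g h') = f n \<otimes> (g h \<otimes> f n') \<otimes> g h'" using c by (simp add: m_assoc)
    also have "\<dots> = f n \<otimes> f (act h n') \<otimes> (g h \<otimes> g h')" using act that c by (simp add: m_assoc)
    finally show ?thesis using f g act that unfolding iso_param_def by simp
  qed
  ultimately show ?thesis
    using act f g unfolding iso_param_def car by (auto simp: semidirect_prod_def)
qed

lemma iso_param_direct:
  assumes f: "iso_param f A N" and g: "iso_param g B H"
    and N: "subgroup N G" and H: "subgroup H G" and int: "N \<inter> H = {\<one>}"
    and comm: "\<And>h n. h \<in> H \<Longrightarrow> n \<in> N \<Longrightarrow> h \<otimes> n = n \<otimes> h"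
  shows "iso_param (\<lambda>(n, h). f n \<otimes> g h) (A \<times>\<times> B) (N <#> H)"
proof -
  have "iso_param (\<lambda>(n, h). f n \<otimes> g h) (semidirect_prod A B (\<lambda>h n. n)) (N <#> H)"
  proof (rule iso_param_semidirect[OF f g N H int])
    fix n h assume "n \<in> carrier A" "h \<in> carrier B"
    moreover from this have "g h \<in> H" "f n \<in> N"
      using f g unfolding iso_param_def by (auto dest: bij_betwE)
    ultimately show "n \<in> carrier A \<and> g h \<otimes> f n = f n \<otimes> g h" using comm by simp
  qed
  then show ?thesis by (simp add: iso_param_def semidirect_prod_def DirProd_def)
qed

lemma generate_involution:
  assumes "r \<in> carrier G" "r \<otimes> r = \<one>" shows "generate G {r} = {\<one>, r}"
proof -
  have pow: "r [^] (k::int) \<in> {\<one>, r}" for k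
  proof (induction k rule: int_induct[of _ 0])
    case (step1 i)
    then show ?case using assms int_pow_mult[of r i 1] by auto
  next
    case (step2 i)
    have "inv r = r" using assms by (metis inv_equality)
    then show ?case using step2 assms int_pow_diff[of r i 1] by auto
  qed simp
  show ?thesis
  proof
    show "generate G {r} \<subseteq> {\<one>, r}" unfolding generate_pow[OF assms(1)] using pow by blast
    show "{\<one>, r} \<subseteq> generate G {r}" by (auto intro: generate.intros)
  qed
qed

text \<open>One rule for all later uses: \<open>b = a\<close> is commutation,
  \<open>b = inv a\<close> is reflection, \<open>b = inv a \<otimes> s\<close> is the twisted
  relation, and different maps \<open>a\<close>, \<open>b\<close> arise from conjugacies.\<close>

lemma intertwine_int_pow:
  assumes "t \<in> carrier G" "a \<in> carrier G" "b \<in> carrier G" "t \<otimes> a = b \<otimes> t"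
  shows "t \<otimes> a [^] (m::int) = b [^] m \<otimes> t"
proof -
  have nat: "t \<otimes> a [^] (n::nat) = b [^] n \<otimes> t" for n
  proof (induction n)
    case (Suc n)
    have "t \<otimes> a [^] Suc n = (t \<otimes> a [^] n) \<otimes> a" using assms by (simp add: m_assoc)
    also have "\<dots> = b [^] n \<otimes> (t \<otimes> a)" using assms by (simp add: Suc m_assoc)
    finally show ?case using assms by (simp add: m_assoc)
  qed (use assms in simp)
  show ?thesis
  proof (cases m rule: int_cases2)
    case (nonneg n)
    then show ?thesis using nat by (simp add: int_pow_int)
  next
    case (nonpos n)
    have "b [^] n \<otimes> (t \<otimes> inv (a [^] n)) = t \<otimes> a [^] n \<otimes> inv (a [^] n)"
      using assms nat by (simp add: m_assoc)
    also have "\<dots> = t" using assms by (simp add: m_assoc)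
    finally have "t \<otimes> inv (a [^] n) = inv (b [^] n) \<otimes> t"
      using assms by (metis inv_solve_left m_closed nat_pow_closed inv_closed)
    then show ?thesis using nonpos assms by (simp add: int_pow_neg_int)
  qed
qed

lemma iso_param_involution:
  assumes "r \<in> carrier G" "r \<otimes> r = \<one>" "r \<noteq> \<one>"
  shows "iso_param (\<lambda>h. if h = 0 then \<one> else r) C2 (generate G {r})"
proof -
  have C2: "carrier C2 = {0, 1}" by (auto simp: carrier_integer_mod_group)
  show ?thesis
    unfolding iso_param_def generate_involution[OF assms(1,2)] C2 bij_betw_def inj_on_def
    using assms by auto
qed

lemma involution_int_pow:
  assumes "r \<in> carrier G" "r \<otimes> r = \<one>"
  shows "r [^] (k::int) = (if even k then \<one> else r)"
proof -
  have "r [^] (2::int) = \<one>" using int_pow_mult[of r 1 1] assms by simp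
  then have "r [^] (2 * (k div 2)) = \<one>" using int_pow_pow[OF assms(1), of 2 "k div 2"] by simp
  moreover have "r [^] k = r [^] (2 * (k div 2)) \<otimes> r [^] (k mod 2)"
    using assms by (simp flip: int_pow_mult)
  moreover have "r [^] (k mod 2) = (if even k then \<one> else r)" using assms by (cases "even k") (auto simp: even_iff_mod_2_eq_zero odd_iff_mod_2_eq_one)
  ultimately show ?thesis using assms by auto
qed

end

section \<open>Extensions of an infinite cyclic group by involutions\<close>

locale inf_order = group +
  fixes a
  assumes a [simp, intro]: "a \<in> carrier G"
    and inf: "a [^] (n::int) = \<one> \<Longrightarrow> n = 0"
begin

lemma pow_inj: "a [^] (m::int) = a [^] (n::int) \<longleftrightarrow> m = n"
proof
  assume "a [^] m = a [^] n"
  then have "a [^] (m - n) = \<one>" by (simp add: int_pow_diff)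
  then show "m = n" using inf by fastforce
qed simp

lemma pow_add: "a [^] (m::int) \<otimes> a [^] (n::int) = a [^] (m + n)"
  by (simp add: int_pow_mult)

lemma iso_param_cyclic: "iso_param (\<lambda>n::int. a [^] n) C_inf (generate G {a})"
  unfolding iso_param_def generate_pow[OF a] bij_betw_def inj_on_def by (auto simp: pow_inj pow_add)

lemmas cyclic_iso = iso_param_is_iso[OF iso_param_cyclic]

lemma cyclic_subgroup: "subgroup (generate G {a}) G"
  by (intro generate_is_subgroup) simp

end

locale inf_order_reflection = inf_order +
  fixes r
  assumes r [simp, intro]: "r \<in> carrier G" and r2: "r \<otimes> r = \<one>" and ra: "r \<otimes> a = inv a \<otimes> r"
begin

lemma r_pow: "r \<otimes> a [^] (n::int) = a [^] (- n) \<otimes> r"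
  using intertwine_int_pow[of r a "inv a" n] ra by (simp add: int_pow_inv int_pow_neg)

text \<open>Conjugation by such a product inverts \<open>a\<close>, and \<open>a\<close> differs
  from its inverse. The facts below that keep \<open>r\<close> and \<open>s\<close> out of the other
  factors rest on this.\<close>

lemma pow_r_a: "a [^] (n::int) \<otimes> r \<otimes> a \<noteq> a \<otimes> (a [^] n \<otimes> r)"
proof
  assume *: "a [^] n \<otimes> r \<otimes> a = a \<otimes> (a [^] n \<otimes> r)"
  have "a [^] n \<otimes> r \<otimes> a = a [^] n \<otimes> (r \<otimes> a [^] (1::int))" by (simp add: m_assoc)
  also have "\<dots> = a [^] (n - 1) \<otimes> r" unfolding r_pow using pow_add[of n "- 1"] by (simp flip: m_assoc)
  finally have "a [^] (n - 1) \<otimes> r = a [^] (1 + n) \<otimes> r"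
    unfolding * using pow_add[of 1 n] by (simp flip: m_assoc)
  then have "a [^] (n - 1) = a [^] (1 + n)" by simp
  then show False by (simp add: pow_inj)
qed

lemma r_notin: "a [^] (n::int) \<noteq> r"
proof
  assume "a [^] n = r"
  then have "a [^] (- n) \<otimes> r = \<one>" using pow_add[of "- n" n] by simp
  then show False using pow_r_a[of "- n"] by simp
qed

lemma r_neq_one: "r \<noteq> \<one>"
  using r_notin[of 0] by auto

lemma inv_r: "inv r = r"
  using r2 by (metis inv_equality r)

lemma refl_inter: "generate G {a} \<inter> generate G {r} = {\<one>}"
proof -
  have "\<one> \<in> {a [^] (k::int) |k. k \<in> UNIV}"
    by (rule CollectI, rule exI[of _ 0]) simp
  moreover have "r \<notin> {a [^] (k::int) |k. k \<in> UNIV}"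
    using r_notin by fastforce
  ultimately show ?thesis
    unfolding generate_pow[OF a] generate_involution[OF r r2] by blast
qed

lemma refl_subgroup: "subgroup (generate G {r}) G"
  by (intro generate_is_subgroup) simp

lemma dihedral_semidirect:
  "internal_semidirect G (generate G {a}) (generate G {r}) (generate G {a} <#> generate G {r})"
proof (rule internal_semidirect_set_mult[OF cyclic_subgroup refl_subgroup _ refl_inter])
  fix h n assume h: "h \<in> generate G {r}" and "n \<in> generate G {a}"
  then obtain k where k: "n = a [^] (k::int)" unfolding generate_pow[OF a] by blast
  have "h \<otimes> n \<otimes> inv h \<in> {a [^] k, a [^] (- k)}"
    using h k unfolding generate_involution[OF r r2] by (auto simp: r_pow inv_r m_assoc r2)
  then show "h \<otimes> n \<otimes> inv h \<in> generate G {a}" unfolding generate_pow[OF a] by blast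
qed

lemma dihedral_subgroup: "subgroup (generate G {a} <#> generate G {r}) G"
  using dihedral_semidirect unfolding internal_semidirect_def by blast

lemma iso_param_dihedral:
  "iso_param (\<lambda>(n, h). a [^] n \<otimes> (if h = 0 then \<one> else r)) D_inf (generate G {a} <#> generate G {r})"
  unfolding D_inf_def
  by (rule iso_param_semidirect[OF iso_param_cyclic iso_param_involution[OF r r2 r_neq_one]
        cyclic_subgroup refl_subgroup refl_inter]) (simp add: r_pow)

lemmas dihedral_iso = iso_param_is_iso[OF iso_param_dihedral]

end

locale inf_order_central = inf_order +
  fixes s
  assumes s [simp, intro]: "s \<in> carrier G" and s2: "s \<otimes> s = \<one>" and s1: "s \<noteq> \<one>"
    and sa: "s \<otimes> a = a \<otimes> s"
begin

lemma s_pow: "s \<otimes> a [^] (n::int) = a [^] n \<otimes> s"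
  using intertwine_int_pow[of s a a n] sa by simp

lemma s_notin: "a [^] (n::int) \<noteq> s"
proof
  assume *: "a [^] n = s"
  then have "a [^] (n + n) = \<one>" using s2 pow_add[of n n] by simp
  then have "n = 0" using inf by fastforce
  then show False using * s1 by simp
qed

lemma central_inter: "generate G {a} \<inter> generate G {s} = {\<one>}"
proof -
  have "\<one> \<in> {a [^] (k::int) |k. k \<in> UNIV}"
    by (rule CollectI, rule exI[of _ 0]) simp
  moreover have "s \<notin> {a [^] (k::int) |k. k \<in> UNIV}"
    using s_notin by fastforce
  ultimately show ?thesis
    unfolding generate_pow[OF a] generate_involution[OF s s2] by blast
qed

lemma central_subgroup: "subgroup (generate G {s}) G"
  by (intro generate_is_subgroup) simp

lemma central_comm: "h \<in> generate G {s} \<Longrightarrow> n \<in> generate G {a} \<Longrightarrow> h \<otimes> n = n \<otimes> h"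
  unfolding generate_pow[OF a] generate_involution[OF s s2] by (auto simp: s_pow)

lemma central_direct:
  "internal_direct G (generate G {a}) (generate G {s}) (generate G {a} <#> generate G {s})"
  by (rule internal_direct_set_mult[OF cyclic_subgroup central_subgroup _ central_inter]) (rule central_comm)

lemma iso_param_central:
  "iso_param (\<lambda>(n, h). a [^] n \<otimes> (if h = 0 then \<one> else s)) (C_inf \<times>\<times> C2) (generate G {a} <#> generate G {s})"
  by (rule iso_param_direct[OF iso_param_cyclic iso_param_involution[OF s s2 s1] cyclic_subgroup central_subgroup
    central_inter]) (rule central_comm)

lemmas central_iso = iso_param_is_iso[OF iso_param_central]

lemma abelian_subgroup: "subgroup (generate G {a} <#> generate G {s}) G"
  using central_direct unfolding internal_direct_def internal_semidirect_def by blast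

end

locale inf_order_reflection_central = inf_order_reflection + inf_order_central +
  assumes rs: "r \<otimes> s = s \<otimes> r"
begin

lemma dihedral_comm:
  assumes "h \<in> generate G {s}" "n \<in> generate G {a} <#> generate G {r}"
  shows "h \<otimes> n = n \<otimes> h"
proof -
  have "s \<otimes> (a [^] k \<otimes> u) = a [^] k \<otimes> u \<otimes> s" if "u \<in> {\<one>, r}" for k::int and u
  proof -
    have "s \<otimes> (a [^] k \<otimes> u) = a [^] k \<otimes> (s \<otimes> u)"
      using that by (auto simp: s_pow simp flip: m_assoc)
    then show ?thesis using that rs by (auto simp: m_assoc)
  qed
  then show ?thesis
    using assms unfolding generate_pow[OF a] generate_involution[OF s s2] generate_involution[OF r r2] set_mult_def
    by auto
qed

lemma dihedral_inter: "(generate G {a} <#> generate G {r}) \<inter> generate G {s} = {\<one>}"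
proof -
  have "s \<notin> generate G {a} <#> generate G {r}"
  proof
    assume "s \<in> generate G {a} <#> generate G {r}"
    then have "\<exists>k::int. s = a [^] k \<or> s = a [^] k \<otimes> r"
      unfolding generate_pow[OF a] generate_involution[OF r r2] set_mult_def by fastforce
    then obtain k :: int where "s = a [^] k \<or> s = a [^] k \<otimes> r" ..
    then show False using s_notin pow_r_a[of k] sa by auto
  qed
  then show ?thesis
    using subgroup.one_closed[OF dihedral_subgroup] unfolding generate_involution[OF s s2] by auto
qed

lemma dihedral_central_direct:
  "internal_direct G (generate G {a} <#> generate G {r}) (generate G {s})
     ((generate G {a} <#> generate G {r}) <#> generate G {s})"
  by (rule internal_direct_set_mult[OF dihedral_subgroup central_subgroup _ dihedral_inter]) (rule dihedral_comm)

lemma dihedral_central_iso: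
  "G\<lparr>carrier := (generate G {a} <#> generate G {r}) <#> generate G {s}\<rparr> \<cong> D_inf \<times>\<times> C2"
  by (rule iso_param_is_iso[OF iso_param_direct[OF iso_param_dihedral iso_param_involution[OF s s2 s1]
    dihedral_subgroup central_subgroup dihedral_inter]]) (rule dihedral_comm)

end

text \<open>Conjugation by \<open>r\<close> sends \<open>a\<close> to
  \<open>s \<otimes> inv a\<close>, which is not a power of \<open>a\<close>. So the cyclic group of
  \<open>a\<close> is not normalised by \<open>r\<close>, and the abelian group of \<open>a\<close>
  and \<open>s\<close> has to be the normal factor.\<close>

locale inf_order_twisted = inf_order_central +
  fixes r
  assumes r [simp, intro]: "r \<in> carrier G" and r2: "r \<otimes> r = \<one>" and ra: "r \<otimes> a = s \<otimes> inv a \<otimes> r"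
    and rs: "r \<otimes> s = s \<otimes> r"
begin

lemma r_pow_twisted: "r \<otimes> a [^] (n::int) = a [^] (- n) \<otimes> s [^] n \<otimes> r"
proof -
  have c: "s \<otimes> inv a = inv a \<otimes> s" using s_pow[of "- 1"] by (simp add: int_pow_neg)
  have "r \<otimes> a [^] n = (inv a \<otimes> s) [^] n \<otimes> r"
    using intertwine_int_pow[of r a "inv a \<otimes> s" n] ra c by simp
  also have "(inv a \<otimes> s) [^] n = inv a [^] n \<otimes> s [^] n"
    using c by (intro int_pow_mult_distrib) auto
  finally show ?thesis by (simp add: int_pow_inv int_pow_neg)
qed

lemma r_s_pow: "r \<otimes> (if k = 0 then \<one> else s) = (if k = 0 then \<one> else s) \<otimes> r"
  using rs by simp

text \<open>This has the exact shape of the action in \<open>twisted_prod\<close>: moving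
  \<open>r\<close> past \<open>a [^] m\<close> leaves \<open>s [^] m\<close> behind, which adds
  \<open>m\<close> to \<open>k\<close> modulo 2.\<close>

lemma r_conj:
  "r \<otimes> (a [^] (m::int) \<otimes> (if k = 0 then \<one> else s)) =
     a [^] (- m) \<otimes> (if (k + m) mod 2 = 0 then \<one> else s) \<otimes> r" if "k \<in> {0, 1::int}"
proof -
  let ?t = "if k = 0 then \<one> else s"
  have "r \<otimes> (a [^] m \<otimes> ?t) = r \<otimes> a [^] m \<otimes> ?t" by (simp add: m_assoc)
  also have "\<dots> = a [^] (- m) \<otimes> s [^] m \<otimes> (r \<otimes> ?t)" unfolding r_pow_twisted by (simp add: m_assoc)
  also have "\<dots> = a [^] (- m) \<otimes> (s [^] m \<otimes> ?t) \<otimes> r" unfolding r_s_pow by (simp add: m_assoc)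
  also have "s [^] m \<otimes> ?t = (if (k + m) mod 2 = 0 then \<one> else s)"
  proof -
    have "(k + m) mod 2 = 0 \<longleftrightarrow> (k = 0 \<longleftrightarrow> even m)" using that by (auto; presburger)
    then show ?thesis unfolding involution_int_pow[OF s s2] using that s2 by auto
  qed
  finally show ?thesis .
qed

text \<open>Otherwise \<open>r\<close> would commute with \<open>a\<close>; the relation would give
  \<open>a = s \<otimes> inv a\<close>, making the involution \<open>s\<close> the square of an
  element of infinite order.\<close>

lemma r_notin_abelian: "r \<notin> generate G {a} <#> generate G {s}"
proof
  assume "r \<in> generate G {a} <#> generate G {s}"
  then have "\<exists>k::int. r = a [^] k \<or> r = a [^] k \<otimes> s"
    unfolding generate_pow[OF a] generate_involution[OF s s2] set_mult_def by fastforce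
  then obtain k :: int where "r = a [^] k \<or> r = a [^] k \<otimes> s" ..
  moreover have "a [^] k \<otimes> a = a \<otimes> a [^] k"
    using pow_add[of k 1] pow_add[of 1 k] by (simp add: add.commute)
  moreover from this have "a [^] k \<otimes> s \<otimes> a = a \<otimes> (a [^] k \<otimes> s)"
    using sa by (simp add: m_assoc) (simp flip: m_assoc)
  ultimately have "a \<otimes> r = s \<otimes> inv a \<otimes> r" using ra by auto
  then have "a = s \<otimes> inv a" by simp
  then have "a \<otimes> a = s" by (metis a inv_closed inv_solve_right s)
  then show False using s_notin[of 2] pow_add[of 1 1] by simp
qed

lemma twisted_inter: "(generate G {a} <#> generate G {s}) \<inter> generate G {r} = {\<one>}"
  using subgroup.one_closed[OF abelian_subgroup] r_notin_abelian
  unfolding generate_involution[OF r r2] by auto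

lemma twist_neq_one: "r \<noteq> \<one>"
  using subgroup.one_closed[OF abelian_subgroup] r_notin_abelian by auto

lemma twist_subgroup: "subgroup (generate G {r}) G"
  by (intro generate_is_subgroup) simp

lemma C2_carrier: "carrier C2 = {0, 1}"
  by (auto simp: carrier_integer_mod_group)

lemma twisted_semidirect:
  "internal_semidirect G (generate G {a} <#> generate G {s}) (generate G {r})
     ((generate G {a} <#> generate G {s}) <#> generate G {r})"
proof (rule internal_semidirect_set_mult[OF abelian_subgroup twist_subgroup _ twisted_inter])
  fix h n assume h: "h \<in> generate G {r}" and n: "n \<in> generate G {a} <#> generate G {s}"
  have "(\<lambda>(n, h). a [^] n \<otimes> (if h = 0 then \<one> else s)) ` carrier (C_inf \<times>\<times> C2) = generate G {a} <#> generate G {s}"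
    using iso_param_central unfolding iso_param_def bij_betw_def by blast
  then have "n \<in> (\<lambda>(n, h). a [^] n \<otimes> (if h = 0 then \<one> else s)) ` ((UNIV :: int set) \<times> {0, 1::int})"
    using n by (simp only: C2_carrier carrier_DirProd carrier_integer_group)
  then obtain z where z: "z \<in> (UNIV :: int set) \<times> {0, 1::int}"
    "n = (case z of (n, h) \<Rightarrow> a [^] n \<otimes> (if h = 0 then \<one> else s))" by (rule imageE)
  obtain m k where "z = (m, k)" by (cases z)
  with z have mk: "k \<in> {0, 1::int}" "n = a [^] (m::int) \<otimes> (if k = 0 then \<one> else s)"
    by simp_all
  have n_in: "n \<in> carrier G" using mk by auto
  have inv_r: "inv r = r" using r2 by (metis inv_equality r)
  consider "h = \<one>" | "h = r" using h unfolding generate_involution[OF r r2] by blast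
  then show "h \<otimes> n \<otimes> inv h \<in> generate G {a} <#> generate G {s}"
  proof cases
    case 1
    then show ?thesis using n n_in by simp
  next
    case 2
    have "h \<otimes> n \<otimes> inv h = a [^] (- m) \<otimes> (if (k + m) mod 2 = 0 then \<one> else s) \<otimes> r \<otimes> r"
      unfolding 2 mk(2) inv_r using r_conj[OF mk(1), of m] by simp
    also have "\<dots> = a [^] (- m) \<otimes> (if (k + m) mod 2 = 0 then \<one> else s)"
      by (simp add: m_assoc r2)
    finally show ?thesis
      unfolding generate_pow[OF a] generate_involution[OF s s2] set_mult_def by auto
  qed
qed

lemma twisted_iso:
  "G\<lparr>carrier := (generate G {a} <#> generate G {s}) <#> generate G {r}\<rparr> \<cong> twisted_prod"
  unfolding twisted_prod_def
proof (rule iso_param_is_iso[OF iso_param_semidirect[OF iso_param_central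
      iso_param_involution[OF r r2 twist_neq_one] abelian_subgroup twist_subgroup twisted_inter]], goal_cases)
  case (1 n h)
  obtain m k where n: "n = (m, k)" and k: "k \<in> {0, 1}" using 1 by (auto simp: C2_carrier)
  have "(k + m) mod 2 \<in> {0, 1}" by auto
  then show ?case using k r_conj[OF k, of m] n by (simp add: C2_carrier)
qed

end

section \<open>Polynomial automorphisms\<close>

lemma rpf_cmult: "rpf f \<Longrightarrow> rpf (\<lambda>z. c * f z)"
  by (intro real_polynomial_function.intros(4)) (rule real_polynomial_function.intros(2))

lemma rpf_lin: "rpf f \<Longrightarrow> rpf g \<Longrightarrow> rpf (\<lambda>z. c * f z + g z)"
  by (intro real_polynomial_function.intros(3) rpf_cmult)

interpretation PA: group PolyAut by (rule group_PolyAut)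

lemma PolyAut_mult [simp]: "f \<otimes>\<^bsub>PolyAut\<^esub> g = f \<circ> g"
  and PolyAut_one [simp]: "\<one>\<^bsub>PolyAut\<^esub> = id"
  by (simp_all add: PolyAut_def)

text \<open>The definition of \<open>polynomial_function\<close> tests all bounded linear
  functionals, and on the plane these are combinations of the two projections.\<close>

lemma polynomial_function_pair_iff:
  fixes T :: plane_map
  shows "polynomial_function T \<longleftrightarrow> rpf (\<lambda>z. fst (T z)) \<and> rpf (\<lambda>z. snd (T z))"
proof (intro iffI conjI)
  assume "polynomial_function T"
  then show "rpf (\<lambda>z. fst (T z))" "rpf (\<lambda>z. snd (T z))"
    using bounded_linear_fst bounded_linear_snd unfolding polynomial_function_def o_def by blast+
next
  assume T: "rpf (\<lambda>z. fst (T z)) \<and> rpf (\<lambda>z. snd (T z))"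
  show "polynomial_function T"
    unfolding polynomial_function_def
  proof (intro allI impI)
    fix l :: "real \<times> real \<Rightarrow> real" assume "bounded_linear l"
    then interpret bounded_linear l .
    have "l (T z) = l (1, 0) * fst (T z) + l (0, 1) * snd (T z)" for z
    proof -
      have "T z = fst (T z) *\<^sub>R (1, 0) + snd (T z) *\<^sub>R (0, 1)" by (simp add: prod_eq_iff)
      then have "l (T z) = fst (T z) *\<^sub>R l (1, 0) + snd (T z) *\<^sub>R l (0, 1)" by (metis add scaleR)
      then show ?thesis by simp
    qed
    then have "l \<circ> T = (\<lambda>z. l (1, 0) * fst (T z) + l (0, 1) * snd (T z))" by auto
    then show "rpf (l \<circ> T)" using T by (auto intro!: rpf_lin rpf_cmult)
  qed
qed

lemma in_PolyAutI:
  assumes "f \<circ> g = id" "g \<circ> f = id"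
    and "rpf (\<lambda>z. fst (f z))" "rpf (\<lambda>z. snd (f z))" "rpf (\<lambda>z. fst (g z))" "rpf (\<lambda>z. snd (g z))"
  shows "f \<in> carrier PolyAut" and "inv_into UNIV f = g"
proof -
  show *: "inv_into UNIV f = g" using assms by (metis inv_unique_comp)
  have "bij f" using assms by (metis o_bij)
  then show "f \<in> carrier PolyAut" using assms *
    by (simp add: PolyAut_def polynomial_function_pair_iff)
qed

lemma PolyAut_inv: "f \<in> carrier PolyAut \<Longrightarrow> inv\<^bsub>PolyAut\<^esub> f = inv_into UNIV f"
  by (rule PA.inv_equality) (auto simp: PolyAut_def bij_imp_bij_inv inv_inv_eq bij_is_inj)

lemma PolyAut_rpf:
  "f \<in> carrier PolyAut \<Longrightarrow> rpf (\<lambda>z. fst (f z))" "f \<in> carrier PolyAut \<Longrightarrow> rpf (\<lambda>z. snd (f z))"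
  by (auto simp: PolyAut_def polynomial_function_pair_iff)

lemma PolyAut_bij: "f \<in> carrier PolyAut \<Longrightarrow> bij f"
  by (auto simp: PolyAut_def)

abbreviation dgx :: "plane_map \<Rightarrow> nat" where "dgx T \<equiv> dg (\<lambda>z. fst (T z))"

abbreviation dgy :: "plane_map \<Rightarrow> nat" where "dgy T \<equiv> dg (\<lambda>z. snd (T z))"

text \<open>A component of degree 0 would be constant, against surjectivity.\<close>

lemma PolyAut_dg_pos:
  assumes "f \<in> carrier PolyAut"
  shows "dgx f > 0" "dgy f > 0"
proof -
  have surj: "surj f" using PolyAut_bij[OF assms] bij_is_surj by blast
  show "dgx f > 0"
  proof (rule ccontr)
    assume "\<not> ?thesis"
    then obtain c where "(\<lambda>z. fst (f z)) = (\<lambda>z. c)"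
      using dg_eq_0_imp_const PolyAut_rpf(1)[OF assms] by blast
    moreover obtain z where "f z = (c + 1, 0)" using surj by (metis surjD)
    ultimately show False by (metis add_cancel_left_right fst_conv zero_neq_one)
  qed
  show "dgy f > 0"
  proof (rule ccontr)
    assume "\<not> ?thesis"
    then obtain c where "(\<lambda>z. snd (f z)) = (\<lambda>z. c)"
      using dg_eq_0_imp_const PolyAut_rpf(2)[OF assms] by blast
    moreover obtain z where "f z = (0, c + 1)" using surj by (metis surjD)
    ultimately show False by (metis add_cancel_left_right snd_conv zero_neq_one)
  qed
qed

lemma PolyAut_comp: "f \<in> carrier PolyAut \<Longrightarrow> g \<in> carrier PolyAut \<Longrightarrow> f \<circ> g \<in> carrier PolyAut"
  using PA.m_closed by simp

abbreviation ipow :: "plane_map \<Rightarrow> int \<Rightarrow> plane_map" where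
  "ipow f m \<equiv> f [^]\<^bsub>PolyAut\<^esub> m"

lemma ipow_0: "ipow f 0 = id" and ipow_1: "f \<in> carrier PolyAut \<Longrightarrow> ipow f 1 = f"
  by simp_all

lemma ipow_add: "f \<in> carrier PolyAut \<Longrightarrow> ipow f (m + n) = ipow f m \<circ> ipow f n"
  using PA.int_pow_mult by simp

lemma ipow_inv: "f \<in> carrier PolyAut \<Longrightarrow> ipow f (- 1) = inv_into UNIV f"
  using PA.int_pow_neg[of f 1] PolyAut_inv by simp

lemma intertwine_ipow:
  assumes "t \<in> carrier PolyAut" "a \<in> carrier PolyAut" "b \<in> carrier PolyAut" "t \<circ> a = b \<circ> t"
  shows "t \<circ> ipow a m = ipow b m \<circ> t"
  using PA.intertwine_int_pow[of t a b m] assms by simp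

section \<open>Conjugacies between compositions of two Henon maps\<close>

definition henon :: "real \<Rightarrow> real poly \<Rightarrow> plane_map" where
  "henon d p = (\<lambda>(x, y). (y, d * x + poly p y))"

text \<open>The factor \<open>d\<close> stands for its own reciprocal, so this inverts
  \<open>henon d p\<close> for \<open>d * d = 1\<close>.\<close>

definition henon_inv :: "real \<Rightarrow> real poly \<Rightarrow> plane_map" where
  "henon_inv d p = (\<lambda>(u, v). (d * (v - poly p u), u))"

definition henon2 :: "real \<Rightarrow> real poly \<Rightarrow> real poly \<Rightarrow> plane_map" where
  "henon2 d p1 p2 = henon d p2 \<circ> henon d p1"

lemma fst_henon [simp]: "fst (henon d p z) = snd z"
  and snd_henon [simp]: "snd (henon d p z) = d * fst z + poly p (snd z)"
  and fst_henon_inv [simp]: "fst (henon_inv d p z) = d * (snd z - poly p (fst z))"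
  and snd_henon_inv [simp]: "snd (henon_inv d p z) = fst z"
  by (simp_all add: henon_def henon_inv_def split_beta)

lemma less_mult_of_le: "n \<le> m \<Longrightarrow> 0 < m \<Longrightarrow> 2 \<le> k \<Longrightarrow> n < k * m" for n m k :: nat
proof -
  assume *: "n \<le> m" "0 < m" "2 \<le> k"
  then have "1 * m < k * m" by (intro mult_strict_right_mono) auto
  then show ?thesis using * by linarith
qed

text \<open>The value 1 belongs to maps in standard form, the value -1 to the Henon map that arises
  from one linear polynomial.\<close>

locale sign =
  fixes d :: real
  assumes sq: "d * d = 1"
begin

lemma nz: "d \<noteq> 0" using sq by auto

lemma cancel [simp]: "d * (d * x) = x"
  using sq by (metis mult.assoc mult_1)

lemma henon_henon_inv [simp]: "henon d p \<circ> henon_inv d p = id" "henon_inv d p \<circ> henon d p = id"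
  by (auto simp: fun_eq_iff prod_eq_iff)

lemma henon_PolyAut [simp, intro]: "henon d p \<in> carrier PolyAut"
  and inv_henon: "inv_into UNIV (henon d p) = henon_inv d p"
  by (rule in_PolyAutI[of _ "henon_inv d p"]; force)+

lemma henon_inv_PolyAut [simp, intro]: "henon_inv d p \<in> carrier PolyAut"
  by (rule in_PolyAutI[of _ "henon d p"]; force)

lemma henon2_PolyAut [simp, intro]: "henon2 d p1 p2 \<in> carrier PolyAut"
  unfolding henon2_def by (intro PolyAut_comp henon_PolyAut)

lemma inv_henon2: "inv_into UNIV (henon2 d p1 p2) = henon_inv d p1 \<circ> henon_inv d p2"
  unfolding henon2_def
  by (subst o_inv_distrib) (auto simp: inv_henon intro: PolyAut_bij)

section \<open>Degree growth under Henon steps\<close>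

lemma dg_henon_step:
  assumes "rpf f" "rpf g" "dg g > 0" "dg f < degree p * dg g"
  shows "dg (\<lambda>z. d * f z + poly p (g z)) = degree p * dg g"
proof -
  have "dg (\<lambda>z. poly p (g z) + d * f z) = dg (\<lambda>z. poly p (g z))"
    using assms nz by (intro dg_add_eq) (auto simp: dg_cmult dg_poly)
  then show ?thesis using assms by (simp add: dg_poly add.commute)
qed

lemma dg_henon_inv_step:
  assumes "rpf f" "rpf g" "dg f > 0" "dg g < degree p * dg f"
  shows "dg (\<lambda>z. d * (g z - poly p (f z))) = degree p * dg f"
proof -
  have "dg (\<lambda>z. d * g z + poly (smult (- d) p) (f z)) = degree (smult (- d) p) * dg f"
    using assms nz by (intro dg_henon_step) auto
  moreover have "(\<lambda>z. d * g z + poly (smult (- d) p) (f z)) = (\<lambda>z. d * (g z - poly p (f z)))"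
    by (auto simp: algebra_simps)
  ultimately show ?thesis using nz by simp
qed

text \<open>\<open>poly p (g z)\<close> is a combination of the outer two among three consecutive
  terms, so its degree cannot exceed both of theirs. This convexity is the source of the valley
  shape of the degrees.\<close>

lemma dg_henon_ge:
  assumes "rpf f" "rpf g" "dg g > 0"
  shows "degree p * dg g \<le> max (dg f) (dg (\<lambda>z. d * f z + poly p (g z)))"
proof (cases "dg f < degree p * dg g")
  case True
  then show ?thesis using dg_henon_step assms by simp
qed auto

text \<open>The ordering of the two degrees makes the polynomial term dominate in both Henon steps.
  The result is ordered in the same way, so the exact factors persist under iteration.\<close>

lemma dg_henon2_fwd1:
  fixes T :: plane_map
  assumes T: "T \<in> carrier PolyAut" and q: "degree q1 \<ge> 2" "degree q2 \<ge> 2"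
    and le: "dgx T \<le> dgy T"
  shows "dg (\<lambda>z. fst (henon2 d q1 q2 (T z))) = degree q1 * dgy T"
    and "dg (\<lambda>z. snd (henon2 d q1 q2 (T z))) = degree q1 * degree q2 * dgy T"
proof -
  have rpfs: "rpf (\<lambda>z. fst (T z))" "rpf (\<lambda>z. snd (T z))" using T PolyAut_rpf by auto
  have pos: "dgy T > 0" using T PolyAut_dg_pos by auto
  have lt: "dgx T < degree q1 * dgy T" by (rule less_mult_of_le[OF le pos]) fact
  have 1: "dg (\<lambda>z. d * fst (T z) + poly q1 (snd (T z))) = degree q1 * dgy T" (is "dg ?f = ?n")
    by (intro dg_henon_step rpfs pos lt)
  have "?n > 0" using pos q by simp
  moreover have "dgy T < degree q2 * ?n"
  proof -
    have "1 * dgy T < (degree q2 * degree q1) * dgy T"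
      using q pos mult_le_mono[OF q(2) q(1)] by (intro mult_strict_right_mono) auto
    then show ?thesis by (simp add: mult.assoc)
  qed
  ultimately have "dg (\<lambda>z. d * snd (T z) + poly q2 (?f z)) = degree q2 * ?n"
    using 1 by (subst dg_henon_step) (auto intro!: rpfs rpf_poly rpf_lin)
  then show "dg (\<lambda>z. fst (henon2 d q1 q2 (T z))) = degree q1 * dgy T"
    "dg (\<lambda>z. snd (henon2 d q1 q2 (T z))) = degree q1 * degree q2 * dgy T"
    using 1 by (simp_all add: henon2_def mult.assoc mult.left_commute)
qed

lemma dg_henon2_bwd1:
  fixes T :: plane_map
  assumes T: "T \<in> carrier PolyAut" and q: "degree q1 \<ge> 2" "degree q2 \<ge> 2"
    and le: "dgy T \<le> dgx T"
  shows "dg (\<lambda>z. snd (henon_inv d q1 (henon_inv d q2 (T z)))) = degree q2 * dgx T"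
    and "dg (\<lambda>z. fst (henon_inv d q1 (henon_inv d q2 (T z)))) = degree q1 * degree q2 * dgx T"
proof -
  have rpfs: "rpf (\<lambda>z. fst (T z))" "rpf (\<lambda>z. snd (T z))" using T PolyAut_rpf by auto
  have pos: "dgx T > 0" using T PolyAut_dg_pos by auto
  have lt: "dgy T < degree q2 * dgx T" by (rule less_mult_of_le[OF le pos]) fact
  have 1: "dg (\<lambda>z. d * (snd (T z) - poly q2 (fst (T z)))) = degree q2 * dgx T" (is "dg ?f = ?n")
    by (intro dg_henon_inv_step rpfs pos lt)
  have "?n > 0" using pos q by simp
  moreover have "dgx T < degree q1 * ?n"
  proof -
    have "1 * dgx T < (degree q1 * degree q2) * dgx T"
      using q pos mult_le_mono[OF q(1) q(2)] by (intro mult_strict_right_mono) auto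
    then show ?thesis by (simp add: mult.assoc)
  qed
  ultimately have "dg (\<lambda>z. d * (fst (T z) - poly q1 (?f z))) = degree q1 * ?n"
    using 1 by (subst dg_henon_inv_step) (auto intro!: rpfs rpf_poly rpf_cmult)
  then show "dg (\<lambda>z. snd (henon_inv d q1 (henon_inv d q2 (T z)))) = degree q2 * dgx T"
    "dg (\<lambda>z. fst (henon_inv d q1 (henon_inv d q2 (T z)))) = degree q1 * degree q2 * dgx T"
    using 1 by (simp_all add: mult.assoc)
qed

lemma ipow_Suc_henon2: "ipow (henon2 d q1 q2) (int (Suc m)) = henon2 d q1 q2 \<circ> ipow (henon2 d q1 q2) (int m)"
  by (metis henon2_PolyAut ipow_1 ipow_add of_nat_Suc)

lemma ipow_minus_Suc_henon2:
  "ipow (henon2 d q1 q2) (- int (Suc m)) = henon_inv d q1 \<circ> henon_inv d q2 \<circ> ipow (henon2 d q1 q2) (- int m)"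
proof -
  have "- int (Suc m) = - 1 + (- int m)" by simp
  then show ?thesis by (metis henon2_PolyAut ipow_inv inv_henon2 ipow_add)
qed

lemma ipow_henon2_comp_closed [simp, intro]:
  "T \<in> carrier PolyAut \<Longrightarrow> ipow (henon2 d q1 q2) m \<circ> T \<in> carrier PolyAut"
  by (intro PolyAut_comp PA.int_pow_closed henon2_PolyAut)

lemma dg_henon2_fwd:
  fixes T :: plane_map
  assumes T: "T \<in> carrier PolyAut" and q: "degree q1 \<ge> 2" "degree q2 \<ge> 2"
    and le: "dgx T \<le> dgy T"
  shows "dgy (ipow (henon2 d q1 q2) (int m) \<circ> T) = (degree q1 * degree q2) ^ m * dgy T
     \<and> dgx (ipow (henon2 d q1 q2) (int m) \<circ> T) \<le> dgy (ipow (henon2 d q1 q2) (int m) \<circ> T)"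
proof (induction m)
  case 0
  then show ?case using le by simp
next
  case (Suc m)
  have *: "ipow (henon2 d q1 q2) (int m) \<circ> T \<in> carrier PolyAut" using T by blast
  from dg_henon2_fwd1[OF this q] Suc
  show ?case
    unfolding ipow_Suc_henon2 using q by (simp add: mult.assoc)
qed

lemma dg_henon2_bwd:
  fixes T :: plane_map
  assumes T: "T \<in> carrier PolyAut" and q: "degree q1 \<ge> 2" "degree q2 \<ge> 2"
    and le: "dgy T \<le> dgx T"
  shows "dgx (ipow (henon2 d q1 q2) (- int m) \<circ> T) = (degree q1 * degree q2) ^ m * dgx T
     \<and> dgy (ipow (henon2 d q1 q2) (- int m) \<circ> T) \<le> dgx (ipow (henon2 d q1 q2) (- int m) \<circ> T)"
proof (induction m)
  case 0
  then show ?case using le by simp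
next
  case (Suc m)
  have *: "ipow (henon2 d q1 q2) (- int m) \<circ> T \<in> carrier PolyAut" using T by blast
  from dg_henon2_bwd1[OF this q] Suc
  show ?case
    unfolding ipow_minus_Suc_henon2 using q by (simp add: mult.assoc)
qed


section \<open>Windows of the two-sided sequence\<close>

lemma henon_henon_inv_apply [simp]:
  "henon d p (henon_inv d p z) = z" "henon_inv d p (henon d p z) = z"
  by (simp_all add: prod_eq_iff)

text \<open>\<open>T'\<close> is a window of two consecutive terms of the sequence through
  \<open>T\<close>, and \<open>a\<close>, \<open>b\<close> are the polynomials of the next two
  steps. They are recorded because a shift by one term exchanges \<open>q1\<close> and
  \<open>q2\<close>; the integer \<open>m\<close> covers both directions.\<close>

definition reach ::
    "real poly \<Rightarrow> real poly \<Rightarrow> plane_map \<Rightarrow> real poly \<Rightarrow> real poly \<Rightarrow> plane_map \<Rightarrow> bool" where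
  "reach q1 q2 T a b T' \<longleftrightarrow>
     (\<exists>m. (a = q1 \<and> b = q2 \<and> T' = ipow (henon2 d q1 q2) m \<circ> T) \<or>
          (a = q2 \<and> b = q1 \<and> T' = henon d q1 \<circ> (ipow (henon2 d q1 q2) m \<circ> T)))"

lemma reach_refl: "reach q1 q2 T q1 q2 T"
  unfolding reach_def by (metis ipow_0 id_comp)

lemma ipow_henon2_plus1: "henon d q2 \<circ> (henon d q1 \<circ> (ipow (henon2 d q1 q2) m \<circ> T)) = ipow (henon2 d q1 q2) (1 + m) \<circ> T"
  by (metis comp_assoc henon2_PolyAut henon2_def ipow_1 ipow_add)

lemma reach_fwd:
  assumes "reach q1 q2 T a b T'" shows "reach q1 q2 T b a (henon d a \<circ> T')"
proof -
  from assms obtain m where "(a = q1 \<and> b = q2 \<and> T' = ipow (henon2 d q1 q2) m \<circ> T) \<or>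
          (a = q2 \<and> b = q1 \<and> T' = henon d q1 \<circ> (ipow (henon2 d q1 q2) m \<circ> T))"
    unfolding reach_def by blast
  then show ?thesis
  proof (elim disjE conjE)
    assume "a = q2" "b = q1" "T' = henon d q1 \<circ> (ipow (henon2 d q1 q2) m \<circ> T)"
    then show ?thesis using ipow_henon2_plus1[of q2 q1 m T] unfolding reach_def by blast
  qed (auto simp: reach_def)
qed

lemma reach_bwd:
  assumes "reach q1 q2 T a b T'" shows "reach q1 q2 T b a (henon_inv d b \<circ> T')"
proof -
  from assms obtain m where "(a = q1 \<and> b = q2 \<and> T' = ipow (henon2 d q1 q2) m \<circ> T) \<or>
          (a = q2 \<and> b = q1 \<and> T' = henon d q1 \<circ> (ipow (henon2 d q1 q2) m \<circ> T))"
    unfolding reach_def by blast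
  then show ?thesis
  proof (elim disjE conjE)
    assume *: "a = q1" "b = q2" "T' = ipow (henon2 d q1 q2) m \<circ> T"
    \<comment> \<open>The odd window preceding the even window of index \<open>m\<close> carries the
      index \<open>m - 1\<close>.\<close>
    then have "T' = henon d q2 \<circ> (henon d q1 \<circ> (ipow (henon2 d q1 q2) (m - 1) \<circ> T))"
      using ipow_henon2_plus1[of q2 q1 "m - 1" T] by simp
    then have "henon_inv d b \<circ> T' = henon d q1 \<circ> (ipow (henon2 d q1 q2) (m - 1) \<circ> T)"
      using * by (metis comp_assoc henon_henon_inv(2) id_comp)
    then show ?thesis using * unfolding reach_def by blast
  next
    assume *: "a = q2" "b = q1" "T' = henon d q1 \<circ> (ipow (henon2 d q1 q2) m \<circ> T)"
    then have "henon_inv d b \<circ> T' = ipow (henon2 d q1 q2) m \<circ> T"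
      by (metis comp_assoc henon_henon_inv(2) id_comp)
    then show ?thesis using * unfolding reach_def by blast
  qed
qed

lemma reach_closed: "reach q1 q2 T a b T' \<Longrightarrow> T \<in> carrier PolyAut \<Longrightarrow> T' \<in> carrier PolyAut"
  unfolding reach_def by (auto intro!: PolyAut_comp)

lemma reach_polys: "reach q1 q2 T a b T' \<Longrightarrow> (a = q1 \<and> b = q2) \<or> (a = q2 \<and> b = q1)"
  unfolding reach_def by auto

text \<open>Even windows differ from \<open>T\<close> by a power of the two-step map; one further
  Henon factor carries the composition in one order to that in the other.\<close>

lemma reach_conj:
  assumes "reach q1 q2 T a b T'" "T \<in> carrier PolyAut" "T \<circ> L = henon2 d q1 q2 \<circ> T"
  shows "T' \<circ> L = henon2 d a b \<circ> T'"
proof -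
  have *: "(ipow (henon2 d q1 q2) m \<circ> T) \<circ> L = henon2 d q1 q2 \<circ> (ipow (henon2 d q1 q2) m \<circ> T)" for m
  proof -
    let ?F = "henon2 d q1 q2"
    have "ipow ?F m \<circ> ?F = ipow ?F (m + 1)" "?F \<circ> ipow ?F m = ipow ?F (1 + m)"
      using ipow_add[of ?F m 1] ipow_add[of ?F 1 m] ipow_1[of ?F] by simp_all
    then have "ipow ?F m \<circ> ?F = ?F \<circ> ipow ?F m" by (simp add: add.commute)
    then show ?thesis using assms(3) by (simp add: comp_assoc) (simp flip: comp_assoc)
  qed
  from assms(1) show ?thesis
    unfolding reach_def using * by (auto simp: henon2_def comp_assoc)
qed

text \<open>The first component is followed backwards and the second forwards, as these are the
  outer ends of the window. Exact factors rule out cancellation, which is what the comparison of two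
  windows requires.\<close>

definition balanced :: "real poly \<Rightarrow> real poly \<Rightarrow> plane_map \<Rightarrow> bool" where
  "balanced a b T \<longleftrightarrow> (\<forall>m.
     dgx (ipow (henon2 d a b) (- int m) \<circ> T) = (degree a * degree b) ^ m * dgx T \<and>
     dgy (ipow (henon2 d a b) (int m) \<circ> T) = (degree a * degree b) ^ m * dgy T)"

lemma balanced_id:
  assumes "degree a \<ge> 2" "degree b \<ge> 2" shows "balanced a b id"
proof -
  have id: "id \<in> carrier PolyAut" using PA.one_closed by simp
  have "dgx id = 1" "dgy id = 1"
    using dg_fst dg_snd by simp_all
  then show ?thesis
    unfolding balanced_def using dg_henon2_fwd[OF id assms] dg_henon2_bwd[OF id assms] by simp
qed

lemma henon2_id_degrees:
  assumes "degree a \<ge> 2" "degree b \<ge> 2"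
  shows "dgx (henon2 d a b) = degree a"
    and "dgy (henon2 d a b) = degree a * degree b"
    and "dg (\<lambda>z. fst (henon_inv d a (henon_inv d b z))) = degree a * degree b"
    and "dg (\<lambda>z. snd (henon_inv d a (henon_inv d b z))) = degree b"
proof -
  have id: "id \<in> carrier PolyAut" using PA.one_closed by simp
  have 1: "dgx id = 1" "dgy id = 1"
    using dg_fst dg_snd by simp_all
  show "dgx (henon2 d a b) = degree a" "dgy (henon2 d a b) = degree a * degree b"
    using dg_henon2_fwd1[OF id assms] 1 by simp_all
  show "dg (\<lambda>z. fst (henon_inv d a (henon_inv d b z))) = degree a * degree b"
    "dg (\<lambda>z. snd (henon_inv d a (henon_inv d b z))) = degree b"
    using dg_henon2_bwd1[OF id assms] 1 by simp_all
qed

text \<open>Let \<open>h\<close> be a term of least degree \<open>n0\<close>, with neighbours of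
  degree \<open>n'\<close> and \<open>n1\<close>. The conjugacy bounds both neighbours by
  \<open>degree b * n0\<close>, and the recurrence forces one of them to attain the bound. If it is
  the earlier one, the window starting at \<open>h\<close> is balanced; if it is the later one, the
  window ending at \<open>h\<close> is.\<close>

lemma balanced_exists:
  assumes T: "T \<in> carrier PolyAut" and conj: "T \<circ> henon2 d p1 p2 = henon2 d q1 q2 \<circ> T"
    and p: "degree p1 \<ge> 2" "degree p2 \<ge> 2" and q: "degree q1 \<ge> 2" "degree q2 \<ge> 2"
    and deg: "degree q1 * degree q2 = degree p1 * degree p2"
  obtains a b T' where "reach q1 q2 T a b T'" "balanced a b T'"
proof -
  define P where "P = (\<lambda>(a, b, T'). reach q1 q2 T a b T')"
  have "P (q1, q2, T)" using reach_refl by (simp add: P_def)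
  then obtain t where t: "P t" and min: "\<And>s. P s \<Longrightarrow> dg (\<lambda>z. fst (snd (snd t) z)) \<le> dg (\<lambda>z. fst (snd (snd s) z))"
    using ex_has_least_nat[of P _ "\<lambda>s. dg (\<lambda>z. fst (snd (snd s) z))"] by blast
  obtain a b S where "t = (a, b, S)" by (cases t)
  with t have S: "reach q1 q2 T a b S" by (simp add: P_def)
  have min: "dgx S \<le> dgx S'" if "reach q1 q2 T a' b' S'" for a' b' S'
    using min[of "(a', b', S')"] that \<open>t = _\<close> by (simp add: P_def)
  have ab: "degree a \<ge> 2" "degree b \<ge> 2" using reach_polys[OF S] q by auto
  have deg': "degree p1 * degree p2 = degree a * degree b" using reach_polys[OF S] deg by (auto simp: mult.commute)
  have assoc_S_PolyAut: "S \<in> carrier PolyAut" using reach_closed S T by blast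
  define R where "R = henon_inv d b \<circ> S"
  have R_in: "R \<in> carrier PolyAut" using assoc_S_PolyAut unfolding R_def by (intro PolyAut_comp) auto
  have S_conj: "S \<circ> henon2 d p1 p2 = henon2 d a b \<circ> S" using reach_conj S T conj by blast
  define n0 n1 n' where "n0 = dgx S" and "n1 = dgy S"
    and "n' = dgx R"
  have sndR: "(\<lambda>z. snd (R z)) = (\<lambda>z. fst (S z))" by (simp add: R_def)
  have le1: "n0 \<le> n1" using min[OF reach_fwd[OF S]] by (simp add: n0_def n1_def)
  have le': "n0 \<le> n'" using min[OF reach_bwd[OF S]] by (simp add: n0_def n'_def R_def)
  have rpfS: "rpf (\<lambda>z. fst (S z))" "rpf (\<lambda>z. snd (S z))" and rpfR: "rpf (\<lambda>z. fst (R z))"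
    using assoc_S_PolyAut R_in PolyAut_rpf by auto
  have pos: "n0 > 0" using PolyAut_dg_pos assoc_S_PolyAut unfolding n0_def by blast
  note h = henon2_id_degrees[OF p]
  have L: "henon2 d p1 p2 \<in> carrier PolyAut" "henon_inv d p1 \<circ> henon_inv d p2 \<in> carrier PolyAut"
    using PolyAut_comp by auto
  \<comment> \<open>The term two places after \<open>h\<close> is \<open>h\<close> composed with the
    conjugated map, so its degree is at most \<open>n0\<close> times the common product of degrees;
    by the recurrence it is also \<open>degree a * n1\<close>.\<close>
  have ub1: "n1 \<le> degree b * n0"
  proof -
    have "degree a * n1 = dg (\<lambda>z. fst (henon2 d a b (S z)))"
      using dg_henon2_fwd1(1)[OF assoc_S_PolyAut ab] le1 by (simp add: n0_def n1_def)
    also have "(\<lambda>z. fst (henon2 d a b (S z))) = (\<lambda>z. fst (S (fst (henon2 d p1 p2 z), snd (henon2 d p1 p2 z))))"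
      using S_conj by (auto simp: fun_eq_iff)
    also have "dg \<dots> \<le> n0 * (degree p1 * degree p2)"
      unfolding n0_def using L PolyAut_rpf h p by (intro dg_comp_le rpfS) auto
    finally have "degree a * n1 \<le> degree a * (degree b * n0)" using deg' by (simp add: ac_simps)
    then show ?thesis using ab by auto
  qed
  have Sinv: "S (henon_inv d p1 (henon_inv d p2 z)) = henon_inv d a (henon_inv d b (S z))" for z
  proof -
    have "S z = henon2 d a b (S (henon_inv d p1 (henon_inv d p2 z)))"
    proof -
      have "henon2 d p1 p2 (henon_inv d p1 (henon_inv d p2 z)) = z"
        by (simp add: henon2_def)
      then show ?thesis using S_conj by (metis comp_eq_dest_lhs)
    qed
    then show ?thesis by (simp add: henon2_def)
  qed
  \<comment> \<open>The same two places earlier, with the inverse of the conjugated map.\<close>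
  have ub': "n' \<le> degree b * n0"
  proof -
    have "dg (\<lambda>z. d * (snd (R z) - poly a (fst (R z)))) = degree a * n'"
    proof -
      have "n0 < degree a * n'" using le' pos ab by (intro less_mult_of_le) auto
      then show ?thesis unfolding n'_def sndR n0_def using PolyAut_dg_pos[OF R_in] rpfS rpfR
        by (intro dg_henon_inv_step) (auto simp: sndR)
    qed
    also have "(\<lambda>z. d * (snd (R z) - poly a (fst (R z)))) = 
        (\<lambda>z. fst (S (fst ((henon_inv d p1 \<circ> henon_inv d p2) z), snd ((henon_inv d p1 \<circ> henon_inv d p2) z))))"
      (is "?l = ?r")
      by (intro ext) (simp only: prod.collapse o_apply Sinv, simp add: R_def)
    finally have "degree a * n' = dg ?r" by (rule sym)
    also have "\<dots> \<le> n0 * (degree p1 * degree p2)"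
      unfolding n0_def using PolyAut_rpf[OF L(2)] h p by (intro dg_comp_le rpfS) auto
    finally have "degree a * n' \<le> degree a * (degree b * n0)" using deg' by (simp add: ac_simps)
    then show ?thesis using ab by auto
  qed
  \<comment> \<open>\<open>poly b\<close> of the minimal term is a combination of its two
    neighbours.\<close>
  have "degree b * n0 \<le> max n' n1"
  proof -
    have "(\<lambda>z. d * fst (R z) + poly b (fst (S z))) = (\<lambda>z. snd (S z))"
      by (simp add: R_def)
    then show ?thesis
      using dg_henon_ge[OF rpfR rpfS(1), of b] pos by (simp add: n0_def n1_def n'_def)
  qed
  with ub1 ub' consider "n' = degree b * n0" | "n1 = degree b * n0" by linarith
  then show ?thesis
  proof cases
    case 1
    \<comment> \<open>The window at \<open>h\<close> has the ordering needed for backward growth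
      only after one two-step; the equality of this case supplies the exact factor of that
      step.\<close>
    define V where "V = henon_inv d a \<circ> R"
    have V_in: "V \<in> carrier PolyAut" using R_in unfolding V_def by (intro PolyAut_comp) auto
    have V_eq: "V = henon_inv d a \<circ> henon_inv d b \<circ> S" by (simp add: V_def R_def comp_assoc)
    have "n0 < degree a * n'" using le' pos ab by (intro less_mult_of_le) auto
    then have V1: "dgx V = degree a * n'"
      unfolding V_def n'_def using PolyAut_dg_pos[OF R_in] rpfS rpfR
      by (simp, intro dg_henon_inv_step) (auto simp: sndR n0_def)
    have V2: "dgy V = n'" by (simp add: V_def n'_def)
    have "dgx (ipow (henon2 d a b) (- int m) \<circ> S) = (degree a * degree b) ^ m * n0" for m
    proof (cases m)
      case 0
      then show ?thesis by (simp add: n0_def)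
    next
      case (Suc k)
      have "- int m = - int k + (- 1)" using Suc by simp
      then have "ipow (henon2 d a b) (- int m) \<circ> S = ipow (henon2 d a b) (- int k) \<circ> V"
        using ipow_add[of "henon2 d a b" "- int k" "- 1"] ipow_inv[of "henon2 d a b"]
        by (simp add: V_eq inv_henon2 comp_assoc)
      moreover have "dgx (ipow (henon2 d a b) (- int k) \<circ> V) = (degree a * degree b) ^ k * (degree a * n')"
        using dg_henon2_bwd[OF V_in ab, of k] V1 V2 ab by simp
      ultimately show ?thesis using 1 Suc by (simp add: ac_simps)
    qed
    then have "balanced a b S"
      unfolding balanced_def using dg_henon2_fwd[OF assoc_S_PolyAut ab] le1 by (simp add: n0_def n1_def)
    then show ?thesis using that S by blast
  next
    case 2
    \<comment> \<open>The mirror image, for the preceding window \<open>R\<close> with the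
      polynomials in the order \<open>b\<close>, \<open>a\<close>.\<close>
    define V where "V = henon d a \<circ> S"
    have V_in: "V \<in> carrier PolyAut" using assoc_S_PolyAut unfolding V_def by (intro PolyAut_comp) auto
    have V_eq: "V = henon2 d b a \<circ> R"
      by (simp add: V_def R_def henon2_def fun_eq_iff)
    have "n0 < degree a * n1" using le1 pos ab by (intro less_mult_of_le) auto
    then have V1: "dgy V = degree a * n1"
      unfolding V_def n1_def using PolyAut_dg_pos[OF assoc_S_PolyAut] rpfS
      by (simp, intro dg_henon_step) (auto simp: n0_def)
    have V2: "dgx V = n1" by (simp add: V_def n1_def)
    have "dgy (ipow (henon2 d b a) (int m) \<circ> R) = (degree b * degree a) ^ m * n0" for m
    proof (cases m)
      case 0
      then show ?thesis by (simp add: n0_def sndR)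
    next
      case (Suc k)
      have "int m = int k + 1" using Suc by simp
      then have "ipow (henon2 d b a) (int m) \<circ> R = ipow (henon2 d b a) (int k) \<circ> V"
        using ipow_add[of "henon2 d b a" "int k" 1] ipow_1[of "henon2 d b a"]
        by (simp add: V_eq comp_assoc)
      moreover have "dgy (ipow (henon2 d b a) (int k) \<circ> V) = (degree b * degree a) ^ k * (degree a * n1)"
        using dg_henon2_fwd[OF V_in ab(2,1), of k] V1 V2 ab by simp
      ultimately show ?thesis using 2 Suc by (simp add: ac_simps)
    qed
    then have "balanced b a R"
      unfolding balanced_def using dg_henon2_bwd[OF R_in ab(2,1)] le' by (simp add: n0_def n'_def sndR)
    then show ?thesis using that reach_bwd[OF S] unfolding R_def by blast
  qed
qed

text \<open>Growth of the outer end controls the inner component through the recurrence. Forwards,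
  \<open>poly b\<close> of the first component has degree at most that of the second, and
  \<open>degree b\<close> is at least 2. Backwards, two terms of degree larger than that of their
  sum must cancel, which equates their degrees.\<close>

lemma balanced_strict_fwd:
  assumes T: "T \<in> carrier PolyAut" and bal: "balanced a b T"
    and ab: "degree a \<ge> 2" "degree b \<ge> 2"
  shows "dgx (ipow (henon2 d a b) (int (Suc m)) \<circ> T)
       < dgy (ipow (henon2 d a b) (int (Suc m)) \<circ> T)"
    and "degree a * dgy (ipow (henon2 d a b) (- int (Suc m)) \<circ> T)
       = dgx (ipow (henon2 d a b) (- int (Suc m)) \<circ> T)"
proof -
  have D: "1 < degree a * degree b"
    using mult_le_mono[OF ab] by simp
  define S where "S = ipow (henon2 d a b) (int m) \<circ> T"
  define S' where "S' = ipow (henon2 d a b) (int (Suc m)) \<circ> T"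
  have in_S: "S \<in> carrier PolyAut" "S' \<in> carrier PolyAut" using T unfolding S_def S'_def by blast+
  have S'_eq: "S' = henon2 d a b \<circ> S" unfolding S'_def S_def ipow_Suc_henon2 by (simp add: comp_assoc)
  have eq: "(\<lambda>z. d * snd (S z) + poly b (fst (S' z))) = (\<lambda>z. snd (S' z))"
    unfolding S'_eq by (simp add: henon2_def)
  have "dgy S = (degree a * degree b) ^ m * dgy T"
    "dgy S' = (degree a * degree b) ^ Suc m * dgy T"
    using bal unfolding balanced_def S_def S'_def by blast+
  then have "dgy S' = (degree a * degree b) * dgy S" by simp
  then have "dgy S \<le> dgy S'"
    using ab mult_le_mono1[of 1 "degree a * degree b" "dgy S"] by simp
  moreover have "degree b * dgx S' \<le> max (dgy S) (dgy S')"
    using dg_henon_ge[OF PolyAut_rpf(2)[OF in_S(1)] PolyAut_rpf(1)[OF in_S(2)] PolyAut_dg_pos(1)[OF in_S(2)], of b]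
    by (simp only: eq)
  moreover have "1 * dgx S' < degree b * dgx S'"
    using ab PolyAut_dg_pos in_S by (intro mult_strict_right_mono) auto
  ultimately show "dgx (ipow (henon2 d a b) (int (Suc m)) \<circ> T)
       < dgy (ipow (henon2 d a b) (int (Suc m)) \<circ> T)"
    unfolding S'_def[symmetric] by linarith
next
  have D: "1 < degree a * degree b"
    using mult_le_mono[OF ab] by simp
  define S where "S = ipow (henon2 d a b) (- int m) \<circ> T"
  define S' where "S' = ipow (henon2 d a b) (- int (Suc m)) \<circ> T"
  have in_S: "S \<in> carrier PolyAut" "S' \<in> carrier PolyAut" using T unfolding S_def S'_def by blast+
  have S'_eq: "S' = henon_inv d a \<circ> (henon_inv d b \<circ> S)"
    unfolding S'_def S_def ipow_minus_Suc_henon2 by (simp add: comp_assoc)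
  have eq: "(\<lambda>z. d * fst (S' z) + poly a (snd (S' z))) = (\<lambda>z. fst (S z))"
    unfolding S'_eq by (simp add: algebra_simps)
  have 1: "dgx S = (degree a * degree b) ^ m * dgx T"
    "dgx S' = (degree a * degree b) ^ Suc m * dgx T"
    using bal unfolding balanced_def S_def S'_def by blast+
  then have "dgx S' = (degree a * degree b) * dgx S" by simp
  then have lt: "dgx S < dgx S'"
    using mult_strict_right_mono[OF D, of "dgx S"] PolyAut_dg_pos[OF in_S(1)] by simp
  note rp = PolyAut_rpf[OF in_S(2)]
  have "degree a * dgy S' \<le> max (dgx S') (dgx S)"
    using dg_henon_ge[OF rp PolyAut_dg_pos(2)[OF in_S(2)], of a] by (simp only: eq)
  moreover have "\<not> degree a * dgy S' < dgx S'"
  proof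
    assume "degree a * dgy S' < dgx S'"
    then have "dg (\<lambda>z. d * fst (S' z) + poly a (snd (S' z))) = dgx S'"
      using rp nz PolyAut_dg_pos[OF in_S(2)]
      by (subst dg_add_eq) (auto intro: rpf_cmult rpf_poly simp: dg_cmult dg_poly)
    then show False unfolding eq using lt by simp
  qed
  ultimately show "degree a * dgy (ipow (henon2 d a b) (- int (Suc m)) \<circ> T)
       = dgx (ipow (henon2 d a b) (- int (Suc m)) \<circ> T)"
    unfolding S'_def[symmetric] using lt by linarith
qed


lemma balanced_strict_bwd:
  assumes "T \<in> carrier PolyAut" "balanced a b T" "degree a \<ge> 2" "degree b \<ge> 2"
  shows "dgy (ipow (henon2 d a b) (- int (Suc m)) \<circ> T)
       < dgx (ipow (henon2 d a b) (- int (Suc m)) \<circ> T)"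
proof -
  have "dgy (ipow (henon2 d a b) (- int (Suc m)) \<circ> T) > 0"
    using assms PolyAut_dg_pos by blast
  from mult_strict_right_mono[OF _ this, of 1 "degree a"] show ?thesis
    using balanced_strict_fwd(2)[OF assms, of m] assms(3) by linarith
qed

text \<open>A balanced window of the inverse composed with one of the conjugacy lies on the sequence
  of the identity, whose degrees are known at both ends. Multiplying the forward and the backward
  degree eliminates the unknown shift \<open>m\<close>.\<close>

theorem reach_affine:
  assumes T: "T \<in> carrier PolyAut" and conj: "T \<circ> henon2 d p1 p2 = henon2 d q1 q2 \<circ> T"
    and p: "degree p1 \<ge> 2" "degree p2 \<ge> 2" and q: "degree q1 \<ge> 2" "degree q2 \<ge> 2"
    and deg: "degree q1 * degree q2 = degree p1 * degree p2"
  obtains a b T' where "reach q1 q2 T a b T'"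
    "dgx T' = 1" "dgy T' = 1"
proof -
  define L where "L = henon2 d p1 p2"
  define D where "D = degree p1 * degree p2"
  have D: "D > 1" using mult_le_mono[OF p] by (simp add: D_def)
  obtain a b T' where T': "reach q1 q2 T a b T'" "balanced a b T'"
    using balanced_exists[OF assms] .
  define L' where "L' = henon2 d a b"
  have L_in: "L \<in> carrier PolyAut" "L' \<in> carrier PolyAut" by (auto simp: L_def L'_def)
  have ab: "degree a \<ge> 2" "degree b \<ge> 2" using reach_polys[OF T'(1)] q by auto
  have D_ab: "degree a * degree b = D" using reach_polys[OF T'(1)] deg by (auto simp: D_def mult.commute)
  have T'_in: "T' \<in> carrier PolyAut" using reach_closed T'(1) T by blast
  have T'_conj: "T' \<circ> L = L' \<circ> T'" unfolding L_def L'_def using reach_conj T'(1) T conj by blast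
  define V where "V = inv_into UNIV T'"
  have V_in: "V \<in> carrier PolyAut" unfolding V_def using PA.inv_closed[OF T'_in] PolyAut_inv[OF T'_in] by simp
  have VT: "V \<circ> T' = id" "T' \<circ> V = id"
    using PolyAut_bij[OF T'_in] unfolding V_def
    by (auto simp: fun_eq_iff bij_is_inj bij_is_surj surj_f_inv_f)
  have V_conj: "V \<circ> L' = L \<circ> V"
  proof -
    have "V \<circ> L' = V \<circ> L' \<circ> (T' \<circ> V)" using VT by simp
    also have "\<dots> = V \<circ> (T' \<circ> L) \<circ> V" using T'_conj by (simp add: comp_assoc)
    also have "\<dots> = L \<circ> V" using VT by (simp flip: comp_assoc)
    finally show ?thesis .
  qed
  obtain a' b' U where U: "reach p1 p2 V a' b' U" "balanced a' b' U"
    by (rule balanced_exists[OF V_in V_conj[unfolded L_def L'_def] ab p]) (simp add: D_ab D_def)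
  have U_in: "U \<in> carrier PolyAut" using reach_closed U(1) V_in by blast
  have U_conj: "U \<circ> L' = henon2 d a' b' \<circ> U"
    using reach_conj[OF U(1) V_in] V_conj L_def by blast
  have ab_lt: "degree a < degree a * degree b" "degree b < degree a * degree b" using ab by auto
  have D_ab': "degree a' * degree b' = D" using reach_polys[OF U(1)] by (auto simp: D_def mult.commute)
  define aT bT aU bU where defs: "aT = dgx T'" "bT = dgy T'"
    "aU = dgx U" "bU = dgy U"
  have pos: "aT > 0" "bT > 0" "aU > 0" "bU > 0"
    unfolding defs using PolyAut_dg_pos T'_in U_in by auto

  \<comment> \<open>Substituting \<open>L'\<close> into \<open>U\<close> loses no degree because
    \<open>U\<close> is balanced; the transfer lemma carries this over to the substitution of
    \<open>X\<close>, whose degree is known because \<open>T'\<close> is balanced.\<close>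
  have top: "dgy (U \<circ> T' \<circ> ipow L (int (Suc k))) = bU * (D ^ Suc k * bT)" for k
  proof -
    define X where "X = ipow L' (int (Suc k)) \<circ> T'"
    have X: "T' \<circ> ipow L (int (Suc k)) = X"
      unfolding X_def by (rule intertwine_ipow[OF T'_in L_in T'_conj])
    have X_in: "X \<in> carrier PolyAut" unfolding X_def L'_def using T'_in by blast
    have X_lt: "dgx X < dgy X"
      unfolding X_def L'_def by (rule balanced_strict_fwd(1)[OF T'_in T'(2) ab])
    have X_dg: "dgy X = D ^ Suc k * bT"
      unfolding X_def L'_def using T'(2) D_ab defs unfolding balanced_def by blast
    have L'_lt: "dgx L' < dgy L'" and L'_dg: "dgy L' = D"
      unfolding L'_def using henon2_id_degrees[OF ab] ab_lt D_ab by simp_all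
    have "dgy (ipow (henon2 d a' b') (int 1) \<circ> U) = D ^ 1 * bU"
      using U(2) D_ab' defs unfolding balanced_def by blast
    then have "dgy (U \<circ> L') = bU * D"
      unfolding U_conj using ipow_1[of "henon2 d a' b'"] by (simp add: mult.commute)
    then have "dg (\<lambda>z. snd (U (fst (L' z), snd (L' z)))) = bU * dgy L'"
      using L'_dg by simp
    then have "dg (\<lambda>z. snd (U (fst (X z), snd (X z)))) = bU * dgy X"
      unfolding defs
      by (intro dg_comp_transfer_snd[OF PolyAut_rpf(2)[OF U_in] PolyAut_rpf[OF L_in(2)] PolyAut_rpf[OF X_in] L'_lt X_lt])
         (use pos defs in auto)
    then show ?thesis using X X_dg by (simp add: comp_assoc)
  qed
  have bot: "dgx (U \<circ> T' \<circ> ipow L (- int (Suc k))) = aU * (D ^ Suc k * aT)" for k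
  proof -
    define X where "X = ipow L' (- int (Suc k)) \<circ> T'"
    have X: "T' \<circ> ipow L (- int (Suc k)) = X"
      unfolding X_def by (rule intertwine_ipow[OF T'_in L_in T'_conj])
    have X_in: "X \<in> carrier PolyAut" unfolding X_def L'_def using T'_in by blast
    have X_lt: "dgy X < dgx X"
      unfolding X_def L'_def by (rule balanced_strict_bwd[OF T'_in T'(2) ab])
    have X_dg: "dgx X = D ^ Suc k * aT"
      unfolding X_def L'_def using T'(2) D_ab defs unfolding balanced_def by blast
    define I where "I = henon_inv d a \<circ> henon_inv d b"
    have I_in: "I \<in> carrier PolyAut" unfolding I_def by (intro PolyAut_comp) auto
    have I_ipow: "I = ipow L' (- 1)" unfolding I_def L'_def using inv_henon2 ipow_inv by simp
    have I_lt: "dgy I < dgx I" and I_dg: "dgx I = D"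
      unfolding I_def o_apply using henon2_id_degrees[OF ab] ab_lt D_ab by (simp_all del: fst_henon_inv snd_henon_inv)
    have "dgx (ipow (henon2 d a' b') (- int 1) \<circ> U) = D ^ 1 * aU"
      using U(2) D_ab' defs unfolding balanced_def by blast
    moreover have "U \<circ> I = ipow (henon2 d a' b') (- int 1) \<circ> U"
      unfolding I_ipow using intertwine_ipow[OF U_in L_in(2) _ U_conj, of "- 1"] by simp
    ultimately have "dgx (U \<circ> I) = aU * D"
      by (simp add: mult.commute)
    then have "dg (\<lambda>z. fst (U (fst (I z), snd (I z)))) = aU * dgx I"
      using I_dg by simp
    then have "dg (\<lambda>z. fst (U (fst (X z), snd (X z)))) = aU * dgx X"
      unfolding defs
      by (intro dg_comp_transfer_fst[OF PolyAut_rpf(1)[OF U_in] PolyAut_rpf[OF I_in] PolyAut_rpf[OF X_in] I_lt X_lt])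
         (use pos defs in auto)
    then show ?thesis using X X_dg by (simp add: comp_assoc)
  qed

  have id_in: "id \<in> carrier PolyAut" using PA.one_closed by simp
  have bid: "balanced p1 p2 id" by (rule balanced_id[OF p])
  have L_top: "dg (\<lambda>z. snd (ipow L (int n) z)) = D ^ n"
    and L_bot: "dg (\<lambda>z. fst (ipow L (- int n) z)) = D ^ n" for n
    using bid dg_fst dg_snd unfolding balanced_def L_def D_def by simp_all
  \<comment> \<open>If the composite ends in a half step, it gains the factor
    \<open>degree p1\<close> at the forward end and loses it at the backward end, so the product of
    both degrees stays the same.\<close>
  have L_top': "dg (\<lambda>z. snd (henon d p1 (ipow L (int (Suc n)) z))) = degree p1 * D ^ Suc n" for n
  proof -
    have "ipow L (int (Suc n)) \<in> carrier PolyAut" using L_in by blast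
    note rp = PolyAut_rpf[OF this] PolyAut_dg_pos[OF this]
    have "dg (\<lambda>z. fst (ipow L (int (Suc n)) z)) < dg (\<lambda>z. snd (ipow L (int (Suc n)) z))"
      using balanced_strict_fwd(1)[OF id_in bid p] unfolding L_def by simp
    also have "\<dots> \<le> degree p1 * \<dots>" using p by simp
    finally show ?thesis using dg_henon_step[OF rp(1,2,4)] L_top[of "Suc n"] by simp
  qed
  have L_bot': "degree p1 * dg (\<lambda>z. fst (henon d p1 (ipow L (- int (Suc n)) z))) = D ^ Suc n" for n
    using balanced_strict_fwd(2)[OF id_in bid p, of n] L_bot[of "Suc n"] unfolding L_def by simp

  obtain m where "U = ipow L m \<circ> V \<or> U = henon d p1 \<circ> (ipow L m \<circ> V)"
    using U(1) unfolding reach_def L_def by blast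
  then have UT: "U \<circ> T' = ipow L m \<or> U \<circ> T' = henon d p1 \<circ> ipow L m"
    using VT by (auto simp: comp_assoc)
  \<comment> \<open>This \<open>k\<close> is large enough for both shifted exponents to have a
    definite sign. The additional \<open>Suc\<close> keeps them away from 0, where the components of
    a balanced window need not be strictly ordered.\<close>
  define k where "k = nat \<bar>m\<bar>"
  define n n' where "n = nat (m + int k)" and "n' = nat (int k - m)"
  have e: "m + int (Suc k) = int (Suc n)" "m + (- int (Suc k)) = - int (Suc n')" "n + n' = 2 * k"
    by (auto simp: n_def n'_def k_def)
  have mp: "ipow L m \<circ> ipow L (int (Suc k)) = ipow L (int (Suc n))"
    "ipow L m \<circ> ipow L (- int (Suc k)) = ipow L (- int (Suc n'))"
    using ipow_add[OF L_in(1)] e by metis+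
  have pw: "D ^ Suc n * D ^ Suc n' = D ^ Suc k * D ^ Suc k"
    using e(3) by (simp flip: power_add add: mult_2)
  have "(aU * aT * (bU * bT)) * (D ^ Suc k * D ^ Suc k) = 1 * (D ^ Suc k * D ^ Suc k)"
    using UT
  proof
    assume UT: "U \<circ> T' = ipow L m"
    have "bU * (D ^ Suc k * bT) = D ^ Suc n" "aU * (D ^ Suc k * aT) = D ^ Suc n'"
      using top[of k, unfolded UT mp] bot[of k, unfolded UT mp] L_top[of "Suc n"] L_bot[of "Suc n'"] by simp_all
    then have "(bU * (D ^ Suc k * bT)) * (aU * (D ^ Suc k * aT)) = D ^ Suc n * D ^ Suc n'" by (simp only:)
    then show ?thesis unfolding pw by (simp only: ac_simps mult_1)
  next
    assume UT: "U \<circ> T' = henon d p1 \<circ> ipow L m"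
    have "bU * (D ^ Suc k * bT) = degree p1 * D ^ Suc n"
      using top[of k, unfolded UT comp_assoc mp] L_top'[of n] by simp
    moreover have "degree p1 * (aU * (D ^ Suc k * aT)) = D ^ Suc n'"
      using bot[of k, unfolded UT comp_assoc mp] L_bot'[of n'] by simp
    ultimately have "(bU * (D ^ Suc k * bT)) * (degree p1 * (aU * (D ^ Suc k * aT))) = degree p1 * (D ^ Suc n * D ^ Suc n')"
      by (simp only: mult.assoc)
    then have "degree p1 * ((aU * aT * (bU * bT)) * (D ^ Suc k * D ^ Suc k)) = degree p1 * (1 * (D ^ Suc k * D ^ Suc k))"
      unfolding pw by (simp only: ac_simps mult_1)
    then show ?thesis using p by simp
  qed
  then have "aU * aT * (bU * bT) = 1" using D by simp
  then have "aT = 1" "bT = 1" by simp_all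
  then show ?thesis using that T'(1) defs by auto
qed

end

section \<open>Symmetries of maps in generalised standard form\<close>

interpretation pos: sign 1 by unfold_locales simp
interpretation neg: sign "- 1" by unfold_locales simp

lemma std_map_eq_henon2: "std_map p1 p2 = henon2 1 p1 p2"
  by (auto simp: std_map_def henon2_def henon_def fun_eq_iff Let_def)

lemma std_map_PolyAut [simp, intro]: "std_map p1 p2 \<in> carrier PolyAut"
  unfolding std_map_eq_henon2 by blast

section \<open>Diagonal affine conjugacies between standard maps\<close>

definition diag_map :: "real \<Rightarrow> real \<Rightarrow> real \<Rightarrow> real \<Rightarrow> plane_map" where
  "diag_map \<alpha> \<gamma> \<epsilon> \<zeta> = (\<lambda>(x, y). (\<alpha> * x + \<gamma>, \<epsilon> * y + \<zeta>))"

lemma rpf_intros: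
  "rpf (\<lambda>z. c)" "rpf f \<Longrightarrow> rpf g \<Longrightarrow> rpf (\<lambda>z. f z + g z)"
  "rpf f \<Longrightarrow> rpf g \<Longrightarrow> rpf (\<lambda>z. f z - g z)" "rpf f \<Longrightarrow> rpf (\<lambda>z. - f z)"
  "rpf f \<Longrightarrow> rpf (\<lambda>z. c * f z)" "rpf f \<Longrightarrow> rpf (\<lambda>z. f z * c)" "rpf f \<Longrightarrow> rpf (\<lambda>z. f z / c)"
  "rpf f \<Longrightarrow> rpf (\<lambda>z. poly p (f z))" "rpf (\<lambda>z. fst z)" "rpf (\<lambda>z. snd z)"
  by (auto intro: rpf_cmult)

lemma diag_map_PolyAut [simp, intro]:
  assumes "\<alpha> \<noteq> 0" "\<epsilon> \<noteq> 0" shows "diag_map \<alpha> \<gamma> \<epsilon> \<zeta> \<in> carrier PolyAut"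
proof (rule in_PolyAutI)
  let ?g = "diag_map (1 / \<alpha>) (- \<gamma> / \<alpha>) (1 / \<epsilon>) (- \<zeta> / \<epsilon>)"
  show "diag_map \<alpha> \<gamma> \<epsilon> \<zeta> \<circ> ?g = id" "?g \<circ> diag_map \<alpha> \<gamma> \<epsilon> \<zeta> = id"
    using assms by (auto simp: diag_map_def fun_eq_iff field_simps)
qed (auto simp: diag_map_def split_beta intro!: rpf_intros)

lemma swap_PolyAut [simp, intro]: "(prod.swap :: plane_map) \<in> carrier PolyAut"
proof (rule in_PolyAutI)
  show "(prod.swap :: plane_map) \<circ> prod.swap = id" "(prod.swap :: plane_map) \<circ> prod.swap = id" by auto
qed auto

lemma diag_map_conj:
  assumes "\<forall>y. \<alpha> * poly p1 y = poly a (\<epsilon> * y + \<zeta>)" "\<forall>x. \<epsilon> * poly p2 x = poly b (\<alpha> * x + \<gamma>)"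
  shows "diag_map \<alpha> \<gamma> \<epsilon> \<zeta> \<circ> std_map p1 p2 = std_map a b \<circ> diag_map \<alpha> \<gamma> \<epsilon> \<zeta>"
proof (rule ext, clarify)
  fix x y
  have 1: "poly a (\<epsilon> * y + \<zeta>) = \<alpha> * poly p1 y" using assms(1) by simp
  have "poly b (\<alpha> * x + \<gamma> + \<alpha> * poly p1 y) = \<epsilon> * poly p2 (x + poly p1 y)"
    using assms(2)[rule_format, of "x + poly p1 y"] by (simp add: algebra_simps)
  then show "(diag_map \<alpha> \<gamma> \<epsilon> \<zeta> \<circ> std_map p1 p2) (x, y) = (std_map a b \<circ> diag_map \<alpha> \<gamma> \<epsilon> \<zeta>) (x, y)"
    using 1 by (simp add: std_map_def diag_map_def Let_def algebra_simps)
qed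

text \<open>A nonzero \<open>\<beta>\<close> would bring in \<open>poly p2 (x + poly p1 y)\<close>,
  whose degree exceeds that of all other terms. Once \<open>\<beta> = 0\<close>, a nonzero
  \<open>\<delta>\<close> would make \<open>poly a\<close> constant, since the other side no longer
  depends on \<open>x\<close>.\<close>

lemma affine_conj_diag:
  assumes p: "degree p1 \<ge> 2" "degree p2 \<ge> 2" and a: "degree a \<ge> 2" "degree b \<ge> 2"
    and deg: "degree a * degree b = degree p1 * degree p2"
    and T: "T \<in> carrier PolyAut" and d1: "dgx T = 1" "dgy T = 1"
    and conj: "T \<circ> std_map p1 p2 = std_map a b \<circ> T"
  obtains \<alpha> \<gamma> \<epsilon> \<zeta> where "T = diag_map \<alpha> \<gamma> \<epsilon> \<zeta>" "\<alpha> \<noteq> 0" "\<epsilon> \<noteq> 0"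
    "\<forall>y. \<alpha> * poly p1 y = poly a (\<epsilon> * y + \<zeta>)" "\<forall>x. \<epsilon> * poly p2 x = poly b (\<alpha> * x + \<gamma>)"
proof -
  obtain \<alpha> \<beta> \<gamma> where f: "\<And>x y. fst (T (x, y)) = \<alpha> * x + \<beta> * y + \<gamma>"
    using dg_le_1_imp_affine[OF PolyAut_rpf(1)[OF T]] d1 by (metis order_refl)
  obtain \<delta> \<epsilon> \<zeta> where g: "\<And>x y. snd (T (x, y)) = \<delta> * x + \<epsilon> * y + \<zeta>"
    using dg_le_1_imp_affine[OF PolyAut_rpf(2)[OF T]] d1 by (metis order_refl)
  have T_eq: "T (x, y) = (\<alpha> * x + \<beta> * y + \<gamma>, \<delta> * x + \<epsilon> * y + \<zeta>)" for x y
    using f g by (simp add: prod_eq_iff)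
  have eq: "T (std_map p1 p2 z) = std_map a b (T z)" for z using conj by (metis comp_apply)
  have 1: "\<alpha> * poly p1 y + \<beta> * poly p2 (x + poly p1 y) = poly a (\<delta> * x + \<epsilon> * y + \<zeta>)" for x y
    using eq[of "(x, y)"] by (simp add: std_map_def T_eq Let_def algebra_simps)
  have big: "degree p1 < degree p1 * degree p2" "degree a < degree a * degree b" using p a by auto
  have inj: "inj T" using PolyAut_bij[OF T] bij_is_inj by blast
  have surj: "surj T" using PolyAut_bij[OF T] bij_is_surj by blast
  have \<beta>: "\<beta> = 0"
  proof (rule ccontr)
    assume nz: "\<beta> \<noteq> 0"
    have e: "(\<lambda>z. \<beta> * poly p2 (fst z + poly p1 (snd z))) =
        (\<lambda>z. poly a (snd (T z)) + (- \<alpha>) * poly p1 (snd z))"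
    proof (rule ext, clarify)
      fix x y
      show "\<beta> * poly p2 (fst (x, y) + poly p1 (snd (x, y))) = poly a (snd (T (x, y))) + (- \<alpha>) * poly p1 (snd (x, y))"
        using 1[of y x] by (simp add: T_eq algebra_simps)
    qed
    have "dg (\<lambda>z. 1 * fst z + poly p1 (snd z)) = degree p1 * dg (\<lambda>z. snd z)"
      by (rule pos.dg_henon_step) (use p in auto)
    then have "dg (\<lambda>z. fst z + poly p1 (snd z)) = degree p1" by simp
    then have "dg (\<lambda>z. poly p2 (fst z + poly p1 (snd z))) = degree p2 * degree p1"
      using p by (subst dg_poly) (auto intro!: rpf_intros)
    then have "dg (\<lambda>z. \<beta> * poly p2 (fst z + poly p1 (snd z))) = degree p2 * degree p1"
      using nz by (subst dg_cmult) (auto intro!: rpf_intros)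
    moreover have "dg (\<lambda>z. poly a (snd (T z)) + (- \<alpha>) * poly p1 (snd z)) \<le> max (degree a) (degree p1)"
    proof (rule dg_add_le)
      show "dg (\<lambda>z. poly a (snd (T z))) \<le> max (degree a) (degree p1)"
        using d1 PolyAut_rpf(2)[OF T] by (subst dg_poly) auto
      have "dg (\<lambda>z. poly p1 (snd z)) = degree p1" using dg_poly[OF rpf_snd] by simp
      then show "dg (\<lambda>z. (- \<alpha>) * poly p1 (snd z)) \<le> max (degree a) (degree p1)"
        using dg_cmult[OF rpf_poly[OF rpf_snd], of "- \<alpha>" p1] by (cases "\<alpha> = 0") auto
    qed (auto intro!: rpf_intros PolyAut_rpf[OF T])
    ultimately have "degree p1 * degree p2 \<le> max (degree a) (degree p1)"
      by (simp only: e mult.commute[of "degree p2"])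
    moreover have "max (degree a) (degree p1) < degree p1 * degree p2"
      using big unfolding deg max_less_iff_conj by blast
    ultimately show False by linarith
  qed
  have \<alpha>: "\<alpha> \<noteq> 0"
  proof
    assume "\<alpha> = 0"
    then have "fst (T z) = \<gamma>" for z using f \<beta> by (cases z) simp
    moreover obtain z where "T z = (\<gamma> + 1, 0)" using surj by (metis surjD)
    ultimately show False by (metis add_cancel_left_right fst_conv zero_neq_one)
  qed
  have \<delta>: "\<delta> = 0"
  proof (rule ccontr)
    assume "\<delta> \<noteq> 0"
    then have "poly a s = \<alpha> * poly p1 0" for s
      using 1[of 0 "(s - \<zeta>) / \<delta>"] \<beta> by simp
    then have "poly a = poly [:\<alpha> * poly p1 0:]" by auto
    then have "a = [:\<alpha> * poly p1 0:]" by (simp only: poly_eq_poly_eq_iff)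
    then show False using a by simp
  qed
  have \<epsilon>: "\<epsilon> \<noteq> 0"
  proof
    assume "\<epsilon> = 0"
    then have "T (0, 0) = T (0, 1)" using \<beta> \<delta> by (simp add: T_eq)
    from injD[OF inj this] show False by simp
  qed
  have 2: "\<epsilon> * poly p2 x = poly b (\<alpha> * x + \<gamma>)" for x
    using eq[of "(x - poly p1 0, 0)"] \<beta> \<delta> 1[of 0 "x - poly p1 0"]
    by (simp add: std_map_def T_eq Let_def algebra_simps)
  show ?thesis
    by (rule that[of \<alpha> \<gamma> \<epsilon> \<zeta>]) (use T_eq \<beta> \<delta> \<alpha> \<epsilon> 1 2 in \<open>auto simp: diag_map_def fun_eq_iff\<close>)
qed

text \<open>There are two shapes because the affine window may lie a half step away from
  \<open>S\<close>; in the second one the target polynomials are exchanged.\<close>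

theorem std_map_conj_form:
  assumes p: "degree p1 \<ge> 2" "degree p2 \<ge> 2" and q: "degree q1 \<ge> 2" "degree q2 \<ge> 2"
    and deg: "degree q1 * degree q2 = degree p1 * degree p2"
    and S: "S \<in> carrier PolyAut" and conj: "S \<circ> std_map p1 p2 = std_map q1 q2 \<circ> S"
  obtains m \<alpha> \<gamma> \<epsilon> \<zeta> where "S = diag_map \<alpha> \<gamma> \<epsilon> \<zeta> \<circ> ipow (std_map p1 p2) m" "\<alpha> \<noteq> 0" "\<epsilon> \<noteq> 0"
    "\<forall>y. \<alpha> * poly p1 y = poly q1 (\<epsilon> * y + \<zeta>)" "\<forall>x. \<epsilon> * poly p2 x = poly q2 (\<alpha> * x + \<gamma>)"
  | m \<alpha> \<gamma> \<epsilon> \<zeta> where "S = henon 1 q2 \<circ> diag_map \<alpha> \<gamma> \<epsilon> \<zeta> \<circ> ipow (std_map p1 p2) m" "\<alpha> \<noteq> 0" "\<epsilon> \<noteq> 0"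
    "\<forall>y. \<alpha> * poly p1 y = poly q2 (\<epsilon> * y + \<zeta>)" "\<forall>x. \<epsilon> * poly p2 x = poly q1 (\<alpha> * x + \<gamma>)"
proof -
  let ?L = "std_map p1 p2"
  obtain a b T where reach: "pos.reach q1 q2 S a b T"
    and d1: "dgx T = 1" "dgy T = 1"
    using pos.reach_affine[OF S conj[unfolded std_map_eq_henon2] p q deg] .
  have T: "T \<in> carrier PolyAut" using pos.reach_closed[OF reach S] .
  have T_conj: "T \<circ> ?L = std_map a b \<circ> T"
    unfolding std_map_eq_henon2 using pos.reach_conj[OF reach S] conj unfolding std_map_eq_henon2 by blast
  have ab: "degree a \<ge> 2" "degree b \<ge> 2" "degree a * degree b = degree p1 * degree p2"
    using pos.reach_polys[OF reach] q deg by (auto simp: mult.commute)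
  obtain \<alpha> \<gamma> \<epsilon> \<zeta> where T_eq: "T = diag_map \<alpha> \<gamma> \<epsilon> \<zeta>" "\<alpha> \<noteq> 0" "\<epsilon> \<noteq> 0"
    and ab_eq: "\<forall>y. \<alpha> * poly p1 y = poly a (\<epsilon> * y + \<zeta>)" "\<forall>x. \<epsilon> * poly p2 x = poly b (\<alpha> * x + \<gamma>)"
    by (rule affine_conj_diag[OF p ab T d1 T_conj])
  have S_ipow: "ipow (std_map q1 q2) m \<circ> S = S \<circ> ipow ?L m" for m
    using intertwine_ipow[OF S _ _ conj, of m] by simp
  have L_inv: "ipow ?L m \<circ> ipow ?L n = ipow ?L (m + n)" for m n
    using ipow_add[of ?L m n] by simp
  from reach obtain m where
    "(a = q1 \<and> b = q2 \<and> T = S \<circ> ipow ?L m) \<or> (a = q2 \<and> b = q1 \<and> T = henon 1 q1 \<circ> (S \<circ> ipow ?L m))"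
    unfolding pos.reach_def S_ipow[unfolded std_map_eq_henon2] std_map_eq_henon2 by blast
  then show ?thesis
  proof (elim disjE conjE)
    assume *: "a = q1" "b = q2" "T = S \<circ> ipow ?L m"
    then have "S = T \<circ> ipow ?L (- m)" by (simp add: comp_assoc L_inv)
    then show ?thesis using that(1) T_eq ab_eq * by blast
  next
    assume *: "a = q2" "b = q1" "T = henon 1 q1 \<circ> (S \<circ> ipow ?L m)"
    \<comment> \<open>One more \<open>L\<close> lets the conjugacy rewrite
      \<open>T \<circ> ?L\<close> as \<open>henon 1 q1\<close> after \<open>henon 1 q2\<close> after
      \<open>T\<close>. The common left factor then cancels, and the Henon map ends up in front of
      the affine map.\<close>
    have "henon 1 q1 \<circ> (S \<circ> ipow ?L (m + 1)) = T \<circ> ?L"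
      unfolding * using L_inv[of m 1] by (simp add: comp_assoc)
    also have "\<dots> = henon 1 q1 \<circ> (henon 1 q2 \<circ> T)"
      unfolding T_conj by (simp add: * std_map_eq_henon2 henon2_def comp_assoc)
    finally have "henon_inv 1 q1 \<circ> (henon 1 q1 \<circ> (S \<circ> ipow ?L (m + 1)))
        = henon_inv 1 q1 \<circ> (henon 1 q1 \<circ> (henon 1 q2 \<circ> T))" by simp
    then have "S \<circ> ipow ?L (m + 1) = henon 1 q2 \<circ> T"
      unfolding comp_assoc[symmetric] pos.henon_henon_inv by (simp add: comp_assoc)
    then have "S \<circ> (ipow ?L (m + 1) \<circ> ipow ?L (- m - 1)) = henon 1 q2 \<circ> T \<circ> ipow ?L (- m - 1)"
      by (simp add: comp_assoc[symmetric])
    then have "S = henon 1 q2 \<circ> T \<circ> ipow ?L (- m - 1)" by (simp add: L_inv)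
    then show ?thesis using that(2) T_eq ab_eq * by blast
  qed
qed

subsection \<open>Polynomials with an affine symmetry\<close>

lemma poly_affine_conj:
  fixes p q :: "real poly"
  assumes "\<And>y. k * poly p y = poly q (r * y + s)" "r \<noteq> 0"
  shows "smult k p = pcompose q [:s, r:]" "k * lead_coeff p = lead_coeff q * r ^ degree q"
    "k \<noteq> 0 \<Longrightarrow> degree q = degree p"
proof -
  have "poly (smult k p) = poly (pcompose q [:s, r:])"
    using assms by (auto simp: poly_pcompose algebra_simps)
  then show *: "smult k p = pcompose q [:s, r:]" by (simp only: poly_eq_poly_eq_iff)
  moreover have "lead_coeff (pcompose q [:s, r:]) = lead_coeff q * r ^ degree q"
    using assms by (subst lead_coeff_comp) auto
  ultimately have "lead_coeff (smult k p) = lead_coeff q * r ^ degree q" by simp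
  moreover have "lead_coeff (smult k p) = k * lead_coeff p" by (cases "k = 0") simp_all
  ultimately show "k * lead_coeff p = lead_coeff q * r ^ degree q" by (simp only: *)
  show "degree q = degree p" if "k \<noteq> 0"
    using arg_cong[OF *, of degree] that assms by (simp add: degree_pcompose)
qed

text \<open>Comparison of leading coefficients.\<close>

lemma poly_self_scale:
  fixes p :: "real poly"
  assumes "\<And>y. k * poly p y = poly p (r * y + s)" "r \<noteq> 0" "p \<noteq> 0"
  shows "k = r ^ degree p"
proof -
  have "k * lead_coeff p = r ^ degree p * lead_coeff p"
    using poly_affine_conj(2)[OF assms(1,2)] by (simp only: mult.commute)
  then show ?thesis using assms(3) by simp
qed

text \<open>A nonzero period would make a nonconstant polynomial take one value at infinitely many
  points.\<close>

lemma poly_translate_eq: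
  fixes p :: "real poly"
  assumes per: "\<And>y. poly p (y + s) = poly p y" and deg: "degree p \<ge> 1"
  shows "s = 0"
proof (rule ccontr)
  assume s: "s \<noteq> 0"
  have "poly p (real n * s) = poly p 0" for n
  proof (induction n)
    case (Suc n)
    then show ?case using per[of "real n * s"] by (simp add: algebra_simps)
  qed simp
  then have "range (\<lambda>n. real n * s) \<subseteq> {x. poly (p - [:poly p 0:]) x = 0}" by auto
  moreover have "p - [:poly p 0:] \<noteq> 0" using deg by (metis degree_pCons_0 eq_iff_diff_eq_0 not_one_le_zero)
  then have "finite {x. poly (p - [:poly p 0:]) x = 0}" by (rule poly_roots_finite)
  ultimately have "finite (range (\<lambda>n. real n * s))" by (rule finite_subset)
  moreover have "inj (\<lambda>n. real n * s)" using s by (simp add: inj_on_def)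
  ultimately show False using finite_imageD infinite_UNIV_nat by blast
qed

lemma real_power_eq_self:
  fixes x :: real assumes "x = x ^ n" "x \<noteq> 0" "n \<ge> 2" shows "x = 1 \<or> x = - 1"
proof -
  obtain k where "n = 2 + k" using assms(3) le_Suc_ex by blast
  then have n: "n = Suc (Suc k)" by simp
  have "x ^ Suc k = 1" using assms(1,2) unfolding n by simp
  then have k: "\<bar>x\<bar> ^ Suc k = 1" by (metis abs_one power_abs)
  have "\<bar>x\<bar> = 1"
  proof (cases "\<bar>x\<bar>" "1::real" rule: linorder_cases)
    case less
    then have "\<bar>x\<bar> ^ Suc k < 1" by (intro power_Suc_less_one) (use assms(2) in auto)
    then show ?thesis using k by simp
  next
    case greater
    then have "1 < \<bar>x\<bar> ^ Suc k" by (intro one_less_power) auto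
    then show ?thesis using k by simp
  qed
  then show ?thesis by linarith
qed

text \<open>The reflection about \<open>e / 2\<close> becomes the affine substitution
  \<open>- y + e\<close>, the shape in which the equations of diagonal conjugacies appear.\<close>

lemma odd_around_iff: "odd_around p (e / 2) \<longleftrightarrow> (\<forall>y. poly p (- y + e) = - poly p y)"
proof
  assume odd: "odd_around p (e / 2)"
  show "\<forall>y. poly p (- y + e) = - poly p y"
  proof
    fix y
    have "poly p (e / 2 + (e / 2 - y)) = - poly p (e / 2 - (e / 2 - y))"
      using odd unfolding odd_around_def by blast
    moreover have "e / 2 + (e / 2 - y) = - y + e" "e / 2 - (e / 2 - y) = y" by (simp_all add: field_simps)
    ultimately show "poly p (- y + e) = - poly p y" by simp
  qed
next
  assume *: "\<forall>y. poly p (- y + e) = - poly p y"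
  show "odd_around p (e / 2)"
    unfolding odd_around_def
  proof
    fix x
    have "- (e / 2 - x) + e = e / 2 + x" by (simp add: field_simps)
    then show "poly p (e / 2 + x) = - poly p (e / 2 - x)" using *[rule_format, of "e / 2 - x"] by simp
  qed
qed

lemma even_around_iff: "even_around p (e / 2) \<longleftrightarrow> (\<forall>y. poly p (- y + e) = poly p y)"
proof
  assume ev: "even_around p (e / 2)"
  show "\<forall>y. poly p (- y + e) = poly p y"
  proof
    fix y
    have "poly p (e / 2 + (e / 2 - y)) = poly p (e / 2 - (e / 2 - y))"
      using ev unfolding even_around_def by blast
    moreover have "e / 2 + (e / 2 - y) = - y + e" "e / 2 - (e / 2 - y) = y" by (simp_all add: field_simps)
    ultimately show "poly p (- y + e) = poly p y" by simp
  qed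
next
  assume *: "\<forall>y. poly p (- y + e) = poly p y"
  show "even_around p (e / 2)"
    unfolding even_around_def
  proof
    fix x
    have "- (e / 2 - x) + e = e / 2 + x" by (simp add: field_simps)
    then show "poly p (e / 2 + x) = poly p (e / 2 - x)" using *[rule_format, of "e / 2 - x"] by simp
  qed
qed

text \<open>Two reflections compose to a translation, and a nonconstant polynomial admits none but
  the trivial one.\<close>

lemma odd_center_unique:
  fixes p :: "real poly"
  assumes "\<forall>y. poly p (- y + e) = - poly p y" "\<forall>y. poly p (- y + e') = - poly p y" "degree p \<ge> 1"
  shows "e = e'"
proof -
  have "poly p (y + (e' - e)) = poly p y" for y
    using assms(1)[rule_format, of y] assms(2)[rule_format, of "- y + e"] by (simp add: algebra_simps)
  from poly_translate_eq[OF this assms(3)] show ?thesis by simp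
qed

lemma even_center_unique:
  fixes p :: "real poly"
  assumes "\<forall>y. poly p (- y + e) = poly p y" "\<forall>y. poly p (- y + e') = poly p y" "degree p \<ge> 1"
  shows "e = e'"
proof -
  have "poly p (y + (e' - e)) = poly p y" for y
    using assms(1)[rule_format, of y] assms(2)[rule_format, of "- y + e"] by (simp add: algebra_simps)
  from poly_translate_eq[OF this assms(3)] show ?thesis by simp
qed

section \<open>Symmetries, reversors and their cosets\<close>

lemma PolyAut_inv_comp:
  assumes "f \<in> carrier PolyAut"
  shows "inv_into UNIV f \<circ> f = id" "f \<circ> inv_into UNIV f = id"
  using PA.l_inv[OF assms] PA.r_inv[OF assms] by (simp_all add: PolyAut_inv[OF assms])

lemma symmetries_iff: "S \<in> symmetries L \<longleftrightarrow> S \<in> carrier PolyAut \<and> S \<circ> L = L \<circ> S"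
proof -
  have "S \<circ> L \<circ> inv_into UNIV S = L \<longleftrightarrow> S \<circ> L = L \<circ> S" if S: "S \<in> carrier PolyAut"
  proof
    assume "S \<circ> L \<circ> inv_into UNIV S = L"
    then have "L \<circ> S = S \<circ> L \<circ> (inv_into UNIV S \<circ> S)" by (simp add: comp_assoc[symmetric])
    then show "S \<circ> L = L \<circ> S" using PolyAut_bij[OF S] by (simp add: bij_is_inj)
  next
    assume "S \<circ> L = L \<circ> S"
    then have "S \<circ> L \<circ> inv_into UNIV S = L \<circ> (S \<circ> inv_into UNIV S)" by (simp add: comp_assoc)
    then show "S \<circ> L \<circ> inv_into UNIV S = L" by (simp only: PolyAut_inv_comp(2)[OF S] comp_id)
  qed
  then show ?thesis unfolding symmetries_def by blast
qed

text \<open>The reversal equation in a form without inverses, suited to pointwise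
  calculation.\<close>

definition reversors :: "plane_map \<Rightarrow> plane_map set" where
  "reversors L = {R \<in> carrier PolyAut. L \<circ> R \<circ> L = R}"

lemma reversing_symmetries_eq:
  assumes L: "L \<in> carrier PolyAut"
  shows "reversing_symmetries L = symmetries L \<union> reversors L"
proof -
  have iL: "inv_into UNIV L \<circ> L = id" "L \<circ> inv_into UNIV L = id"
    by (rule PolyAut_inv_comp[OF L])+
  have "R \<circ> L \<circ> inv_into UNIV R = inv_into UNIV L \<longleftrightarrow> L \<circ> R \<circ> L = R" if R: "R \<in> carrier PolyAut" for R
  proof -
    have iR: "inv_into UNIV R \<circ> R = id" "R \<circ> inv_into UNIV R = id"
      by (rule PolyAut_inv_comp[OF R])+
    show ?thesis
    proof
      assume *: "R \<circ> L \<circ> inv_into UNIV R = inv_into UNIV L"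
      have "L \<circ> R \<circ> L = L \<circ> (R \<circ> L \<circ> inv_into UNIV R) \<circ> R" using iR by (simp add: comp_assoc)
      then show "L \<circ> R \<circ> L = R" unfolding * using iL by simp
    next
      assume *: "L \<circ> R \<circ> L = R"
      have "R \<circ> L \<circ> inv_into UNIV R = inv_into UNIV L \<circ> (L \<circ> R \<circ> L) \<circ> inv_into UNIV R"
        using iL by (simp add: comp_assoc[symmetric])
      then show "R \<circ> L \<circ> inv_into UNIV R = inv_into UNIV L" unfolding * using iR by (simp add: comp_assoc)
    qed
  qed
  then show ?thesis unfolding reversing_symmetries_def reversors_def by blast
qed

lemma symmetries_subgroup: "L \<in> carrier PolyAut \<Longrightarrow> subgroup (symmetries L) PolyAut"
proof (rule PA.subgroupI)
  assume L: "L \<in> carrier PolyAut"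
  show "symmetries L \<subseteq> carrier PolyAut" by (auto simp: symmetries_iff)
  have "id \<in> symmetries L" using PA.one_closed by (simp add: symmetries_iff)
  then show "symmetries L \<noteq> {}" by blast
  fix S assume S: "S \<in> symmetries L"
  then have assoc_S_PolyAut: "S \<in> carrier PolyAut" and c: "S \<circ> L = L \<circ> S" by (auto simp: symmetries_iff)
  have "inv\<^bsub>PolyAut\<^esub> S \<otimes>\<^bsub>PolyAut\<^esub> L = L \<otimes>\<^bsub>PolyAut\<^esub> inv\<^bsub>PolyAut\<^esub> S"
    using PA.intertwine_int_pow[of L S S "- 1"] L assoc_S_PolyAut c by (simp add: PA.int_pow_neg)
  then show "inv\<^bsub>PolyAut\<^esub> S \<in> symmetries L" using assoc_S_PolyAut by (auto simp: symmetries_iff)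
  fix T assume T: "T \<in> symmetries L"
  then have "S \<circ> T \<circ> L = L \<circ> (S \<circ> T)" using c by (simp add: symmetries_iff comp_assoc) (simp flip: comp_assoc)
  then show "S \<otimes>\<^bsub>PolyAut\<^esub> T \<in> symmetries L" using assoc_S_PolyAut T by (auto simp: symmetries_iff intro: PolyAut_comp)
qed

lemma self_in_symmetries: "L \<in> carrier PolyAut \<Longrightarrow> L \<in> symmetries L"
  by (simp add: symmetries_iff)

lemma reversor_comp:
  assumes "L \<in> carrier PolyAut" "R \<in> reversors L"
  shows "R \<circ> L = inv_into UNIV L \<circ> R"
proof -
  have "inv_into UNIV L \<circ> R = inv_into UNIV L \<circ> (L \<circ> R \<circ> L)" using assms by (simp add: reversors_def)
  also have "\<dots> = R \<circ> L" using PolyAut_bij[OF assms(1)]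
    by (simp add: comp_assoc[symmetric] bij_is_inj)
  finally show ?thesis by simp
qed

text \<open>The product of two reversors is a symmetry, so an involutory reversor represents the
  whole second coset.\<close>

lemma reversing_symmetries_coset:
  assumes L: "L \<in> carrier PolyAut" and R: "R \<in> reversors L" and R2: "R \<circ> R = id"
  shows "reversing_symmetries L = symmetries L <#>\<^bsub>PolyAut\<^esub> cyc R"
proof -
  have R_in: "R \<in> carrier PolyAut" using R by (simp add: reversors_def)
  have cycR: "cyc R = {id, R}" using PA.generate_involution[of R] R_in R2 by simp
  have 1: "S \<circ> R \<in> reversors L" if "S \<in> symmetries L" for S
  proof -
    have S: "S \<in> carrier PolyAut" "L \<circ> S = S \<circ> L" using that by (auto simp: symmetries_iff)
    have "L \<circ> (S \<circ> R) \<circ> L = (L \<circ> S) \<circ> R \<circ> L" by (simp add: comp_assoc)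
    also have "\<dots> = S \<circ> (L \<circ> R \<circ> L)" unfolding S(2) by (simp add: comp_assoc)
    also have "\<dots> = S \<circ> R" using R by (simp add: reversors_def)
    finally show ?thesis using S R_in by (auto simp: reversors_def intro: PolyAut_comp)
  qed
  have 2: "R' \<circ> R \<in> symmetries L" if R': "R' \<in> reversors L" for R'
  proof -
    have "L \<circ> (R' \<circ> R) = L \<circ> R' \<circ> (L \<circ> R \<circ> L)" using R by (simp add: reversors_def comp_assoc)
    also have "\<dots> = (L \<circ> R' \<circ> L) \<circ> R \<circ> L" by (simp add: comp_assoc)
    also have "\<dots> = R' \<circ> R \<circ> L" using R' by (simp add: reversors_def)
    finally show ?thesis using R' R_in by (auto simp: reversors_def symmetries_iff intro: PolyAut_comp)
  qed
  have 3: "R' \<in> {S \<circ> R |S. S \<in> symmetries L}" if "R' \<in> reversors L" for R'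
  proof -
    have "R' = (R' \<circ> R) \<circ> R" using R2 by (simp add: comp_assoc)
    then show ?thesis using 2[OF that] by blast
  qed
  have "symmetries L <#>\<^bsub>PolyAut\<^esub> cyc R = symmetries L \<union> {S \<circ> R |S. S \<in> symmetries L}"
    unfolding cycR set_mult_def by auto
  then show ?thesis unfolding reversing_symmetries_eq[OF L] using 1 3 by blast
qed

text \<open>Leading coefficients give \<open>\<alpha> = \<epsilon> ^ degree p1\<close> and
  \<open>\<epsilon> = \<alpha> ^ degree p2\<close>. So \<open>\<alpha>\<close> equals a power of
  itself with exponent at least 2 and must be a sign; substituting back excludes mixed
  signs.\<close>

lemma diag_map_self_conj:
  fixes p1 p2 :: "real poly"
  assumes deg: "degree p1 \<ge> 2" "degree p2 \<ge> 2" and nz: "\<alpha> \<noteq> 0" "\<epsilon> \<noteq> 0"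
    and 1: "\<forall>y. \<alpha> * poly p1 y = poly p1 (\<epsilon> * y + \<zeta>)" and 2: "\<forall>x. \<epsilon> * poly p2 x = poly p2 (\<alpha> * x + \<gamma>)"
  obtains "\<alpha> = 1" "\<epsilon> = 1" "\<gamma> = 0" "\<zeta> = 0"
  | "\<alpha> = - 1" "\<epsilon> = - 1" "\<forall>y. poly p1 (- y + \<zeta>) = - poly p1 y" "\<forall>x. poly p2 (- x + \<gamma>) = - poly p2 x"
proof -
  have "p1 \<noteq> 0" "p2 \<noteq> 0" using deg by auto
  then have pows: "\<alpha> = \<epsilon> ^ degree p1" "\<epsilon> = \<alpha> ^ degree p2"
    using poly_self_scale[of \<alpha> p1 \<epsilon> \<zeta>] poly_self_scale[of \<epsilon> p2 \<alpha> \<gamma>] 1 2 nz by auto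
  then have "\<alpha> = \<alpha> ^ (degree p2 * degree p1)" by (metis power_mult)
  moreover have "degree p2 * degree p1 \<ge> 2" using mult_le_mono[OF deg(2,1)] by simp
  ultimately consider "\<alpha> = 1" | "\<alpha> = - 1" using real_power_eq_self nz by blast
  then show ?thesis
  proof cases
    case one: 1
    have "\<epsilon> = 1" using pows(2) unfolding one by simp
    then have "\<zeta> = 0" "\<gamma> = 0"
      using poly_translate_eq[of p1 \<zeta>] poly_translate_eq[of p2 \<gamma>] 1 2 one deg by simp_all
    then show ?thesis using that(1) one \<open>\<epsilon> = 1\<close> by blast
  next
    case minus: 2
    have "\<epsilon> = 1 \<or> \<epsilon> = - 1"
      using pows(2) unfolding minus by (metis neg_one_even_power neg_one_odd_power)
    moreover have "\<epsilon> \<noteq> 1"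
    proof
      assume "\<epsilon> = 1"
      with pows(1) have "\<alpha> = 1" by simp
      then show False using minus by simp
    qed
    ultimately have "\<epsilon> = - 1" by blast
    then have "\<forall>y. poly p1 (- y + \<zeta>) = - poly p1 y" "\<forall>x. poly p2 (- x + \<gamma>) = - poly p2 x"
      using 1 2 minus by simp_all
    then show ?thesis using that(2) minus \<open>\<epsilon> = - 1\<close> by blast
  qed
qed

context
  fixes p1 p2 :: "real poly"
  assumes deg: "degree p1 \<ge> 2" "degree p2 \<ge> 2"
begin

lemma polys_nonzero: "p1 \<noteq> 0" "p2 \<noteq> 0"
  using deg by auto

lemma std_symmetry_form:
  assumes "S \<in> symmetries (std_map p1 p2)"
  obtains m where "S = ipow (std_map p1 p2) m"
  | m i V where "i \<in> {1, 2, 3}" "assoc_S p1 p2 i V" "S = V \<circ> ipow (std_map p1 p2) m"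
proof -
  let ?L = "std_map p1 p2"
  have S: "S \<in> carrier PolyAut" and c: "S \<circ> ?L = ?L \<circ> S" using assms by (auto simp: symmetries_iff)
  show ?thesis
  proof (rule std_map_conj_form[OF deg deg refl S c])
    fix m \<alpha> \<gamma> \<epsilon> \<zeta> assume S_eq: "S = diag_map \<alpha> \<gamma> \<epsilon> \<zeta> \<circ> ipow ?L m" and nz: "\<alpha> \<noteq> 0" "\<epsilon> \<noteq> 0"
      and 1: "\<forall>y. \<alpha> * poly p1 y = poly p1 (\<epsilon> * y + \<zeta>)" and 2: "\<forall>x. \<epsilon> * poly p2 x = poly p2 (\<alpha> * x + \<gamma>)"
    show thesis
    proof (cases rule: diag_map_self_conj[OF deg nz 1 2])
      case 1
      then have "diag_map \<alpha> \<gamma> \<epsilon> \<zeta> = id" by (auto simp: diag_map_def)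
      then show thesis using that(1) S_eq by simp
    next
      case 2
      then have "assoc_S p1 p2 1 (\<lambda>(x, y). (- x + \<gamma>, - y + \<zeta>))"
        by (intro assoc_S.S1) (simp_all add: odd_around_iff)
      moreover have "diag_map \<alpha> \<gamma> \<epsilon> \<zeta> = (\<lambda>(x, y). (- x + \<gamma>, - y + \<zeta>))"
        using 2 by (simp add: diag_map_def)
      ultimately show thesis using that(2)[of 1] S_eq by auto
    qed
  next
    fix m \<alpha> \<gamma> \<epsilon> \<zeta> assume S_eq: "S = henon 1 p2 \<circ> diag_map \<alpha> \<gamma> \<epsilon> \<zeta> \<circ> ipow ?L m" and nz: "\<alpha> \<noteq> 0" "\<epsilon> \<noteq> 0"
      and 1: "\<forall>y. \<alpha> * poly p1 y = poly p2 (\<epsilon> * y + \<zeta>)" and 2: "\<forall>x. \<epsilon> * poly p2 x = poly p1 (\<alpha> * x + \<gamma>)"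
    \<comment> \<open>Eliminating \<open>p2\<close> between the two equations leaves a
      self-similarity of \<open>p1\<close> with factor \<open>\<kappa>\<close>, whose sign separates
      S2 from S3.\<close>
    define \<kappa> where "\<kappa> = \<alpha> * \<epsilon>"
    have self: "\<kappa> * poly p1 y = poly p1 (\<kappa> * y + (\<alpha> * \<zeta> + \<gamma>))" for y
    proof -
      have "\<kappa> * poly p1 y = \<epsilon> * poly p2 (\<epsilon> * y + \<zeta>)" 
        using arg_cong[OF 1[rule_format, of y], of "\<lambda>t. \<epsilon> * t"] by (simp add: \<kappa>_def mult_ac)
      then show ?thesis unfolding 2[rule_format] by (simp add: \<kappa>_def algebra_simps)
    qed
    have "\<kappa> = \<kappa> ^ degree p1" using poly_self_scale[OF self] nz polys_nonzero by (simp add: \<kappa>_def)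
    then consider "\<kappa> = 1" | "\<kappa> = - 1" using real_power_eq_self[of \<kappa>] deg nz by (auto simp: \<kappa>_def)
    then show thesis
    proof cases
      case one: 1
      then have z: "\<alpha> * \<zeta> + \<gamma> = 0"
        using poly_translate_eq[of p1 "\<alpha> * \<zeta> + \<gamma>"] self deg by simp
      have \<alpha>: "\<alpha> = 1 / \<epsilon>" using one nz by (simp add: \<kappa>_def field_simps)
      have "\<zeta> / \<epsilon> + \<gamma> = 0" using z unfolding \<alpha> by simp
      then have \<zeta>: "\<zeta> = - \<gamma> * \<epsilon>" using nz by (simp add: field_simps eq_neg_iff_add_eq_0)
      have "assoc_S p1 p2 2 (\<lambda>(x, y). (\<epsilon> * y - \<gamma> * \<epsilon>, (x + poly p1 y) / \<epsilon> + \<gamma>))"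
        using nz 2 \<alpha> by (intro assoc_S.S2) (auto simp: field_simps)
      moreover have "henon 1 p2 \<circ> diag_map \<alpha> \<gamma> \<epsilon> \<zeta> = (\<lambda>(x, y). (\<epsilon> * y - \<gamma> * \<epsilon>, (x + poly p1 y) / \<epsilon> + \<gamma>))"
        using 1 \<alpha> \<zeta> by (auto simp: henon_def diag_map_def fun_eq_iff add_divide_distrib)
      ultimately show thesis using that(2)[of 2] S_eq by auto
    next
      case minus: 2
      have \<alpha>: "\<alpha> = - (1 / \<epsilon>)" using minus nz by (simp add: \<kappa>_def field_simps)
      have odd: "poly p1 (- y + (\<alpha> * \<zeta> + \<gamma>)) = - poly p1 y" for y
        using self[of y] minus by simp
      have s: "1 / 2 * (\<gamma> - \<zeta> / \<epsilon>) = (\<alpha> * \<zeta> + \<gamma>) / 2" using \<alpha> by simp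
      have "poly p2 y = - (1 / \<epsilon>) * poly p1 ((y - \<zeta>) / \<epsilon>)" for y
      proof -
        have "- ((y - \<zeta>) / \<epsilon>) + (\<alpha> * \<zeta> + \<gamma>) = \<alpha> * y + \<gamma>"
          using \<alpha> by (simp add: diff_divide_distrib)
        then have "poly p1 (\<alpha> * y + \<gamma>) = - poly p1 ((y - \<zeta>) / \<epsilon>)"
          using odd[of "(y - \<zeta>) / \<epsilon>"] by (simp only:)
        then have "\<epsilon> * poly p2 y = - poly p1 ((y - \<zeta>) / \<epsilon>)"
          using 2[rule_format, of y] by simp
        then show ?thesis using nz by (simp add: field_simps)
      qed
      then have "assoc_S p1 p2 3 (\<lambda>(x, y). (\<epsilon> * y + \<zeta>, - ((x + poly p1 y) / \<epsilon>) + \<gamma>))"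
        using nz odd by (intro assoc_S.S3) (simp_all only: s odd_around_iff, simp_all)
      moreover have "henon 1 p2 \<circ> diag_map \<alpha> \<gamma> \<epsilon> \<zeta> = (\<lambda>(x, y). (\<epsilon> * y + \<zeta>, - ((x + poly p1 y) / \<epsilon>) + \<gamma>))"
        using 1 \<alpha> by (auto simp: henon_def diag_map_def fun_eq_iff add_divide_distrib)
      ultimately show thesis using that(2)[of 3] S_eq by auto
    qed
  qed
qed

text \<open>The inverse of \<open>L\<close> first subtracts \<open>poly p2 x\<close> from
  \<open>y\<close> and then \<open>poly p1 y\<close> from \<open>x\<close>. Exchanging coordinates
  puts this into standard form, and the reversor becomes a conjugacy.\<close>

lemma swap_reversor:
  assumes "L = std_map p1 p2" "R \<in> reversors L"
  shows "prod.swap \<circ> R \<in> carrier PolyAut"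
    "(prod.swap \<circ> R) \<circ> L = std_map (- p2) (- p1) \<circ> (prod.swap \<circ> R)"
proof -
  have R: "R \<in> carrier PolyAut" "L \<circ> R \<circ> L = R" using assms by (auto simp: reversors_def)
  show "prod.swap \<circ> R \<in> carrier PolyAut" using R by (intro PolyAut_comp) auto
  have "std_map (- p2) (- p1) (prod.swap (L z)) = prod.swap z" for z
    by (cases z) (simp add: assms(1) std_map_def Let_def)
  moreover have "R z = L (R (L z))" for z using R(2) by (metis comp_apply)
  ultimately show "(prod.swap \<circ> R) \<circ> L = std_map (- p2) (- p1) \<circ> (prod.swap \<circ> R)"
    by (metis (no_types, lifting) comp_apply ext)
qed

text \<open>Only the presence of some R condition is extracted. The form of the reversor itself can
  be left open, because one involutory reversor gives all others through the coset of
  symmetries.\<close>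

lemma std_reversor_form:
  assumes "R \<in> reversors (std_map p1 p2)"
  obtains i V where "i \<in> {1, 2, 3, 4, 5}" "assoc_R p1 p2 i V"
proof -
  let ?L = "std_map p1 p2"
  note S = swap_reversor[OF refl assms]
  have degs: "degree (- p2) \<ge> 2" "degree (- p1) \<ge> 2" "degree (- p2) * degree (- p1) = degree p1 * degree p2"
    using deg by simp_all
  show ?thesis
  proof (rule std_map_conj_form[OF deg degs S])
    fix m \<alpha> \<gamma> \<epsilon> \<zeta> assume nz: "\<alpha> \<noteq> 0" "\<epsilon> \<noteq> 0"
      and 1: "\<forall>y. \<alpha> * poly p1 y = poly (- p2) (\<epsilon> * y + \<zeta>)" and 2: "\<forall>x. \<epsilon> * poly p2 x = poly (- p1) (\<alpha> * x + \<gamma>)"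
    define \<kappa> where "\<kappa> = \<alpha> * \<epsilon>"
    have self: "\<kappa> * poly p1 y = poly p1 (\<kappa> * y + (\<alpha> * \<zeta> + \<gamma>))" for y
    proof -
      have "\<kappa> * poly p1 y = - (\<epsilon> * poly p2 (\<epsilon> * y + \<zeta>))" 
        using arg_cong[OF 1[rule_format, of y], of "\<lambda>t. \<epsilon> * t"] by (simp add: \<kappa>_def mult_ac)
      then show ?thesis unfolding 2[rule_format] by (simp add: \<kappa>_def algebra_simps)
    qed
    have "\<kappa> = \<kappa> ^ degree p1" using poly_self_scale[OF self] nz polys_nonzero by (simp add: \<kappa>_def)
    then consider "\<kappa> = 1" | "\<kappa> = - 1" using real_power_eq_self[of \<kappa>] deg nz by (auto simp: \<kappa>_def)
    then show thesis
    proof cases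
      case one: 1
      have \<alpha>: "\<alpha> = 1 / \<epsilon>" using one nz by (simp add: \<kappa>_def field_simps)
      have "assoc_R p1 p2 4 (\<lambda>(x, y). (\<epsilon> * y - \<gamma> * \<epsilon>, x / \<epsilon> + \<gamma>))"
        using nz 2 \<alpha> by (intro assoc_R.R4) (auto simp: field_simps)
      then show thesis using that[of 4] by auto
    next
      case minus: 2
      have \<alpha>: "\<alpha> = - (1 / \<epsilon>)" using minus nz by (simp add: \<kappa>_def field_simps)
      have odd: "poly p1 (- y + (\<alpha> * \<zeta> + \<gamma>)) = - poly p1 y" for y
        using self[of y] minus by simp
      have s: "1 / 2 * (\<gamma> - \<zeta> / \<epsilon>) = (\<alpha> * \<zeta> + \<gamma>) / 2" using \<alpha> by simp
      have "poly p2 y = 1 / \<epsilon> * poly p1 ((y - \<zeta>) / \<epsilon>)" for y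
      proof -
        have "- ((y - \<zeta>) / \<epsilon>) + (\<alpha> * \<zeta> + \<gamma>) = \<alpha> * y + \<gamma>"
          using \<alpha> by (simp add: diff_divide_distrib)
        then have "poly p1 (\<alpha> * y + \<gamma>) = - poly p1 ((y - \<zeta>) / \<epsilon>)"
          using odd[of "(y - \<zeta>) / \<epsilon>"] by (simp only:)
        then have "\<epsilon> * poly p2 y = poly p1 ((y - \<zeta>) / \<epsilon>)"
          using 2[rule_format, of y] by simp
        then show ?thesis using nz by (simp add: field_simps)
      qed
      then have "assoc_R p1 p2 5 (\<lambda>(x, y). (\<epsilon> * y + \<zeta>, - (x / \<epsilon>) + \<gamma>))"
        using nz odd by (intro assoc_R.R5) (simp_all only: s odd_around_iff, simp_all)
      then show thesis using that[of 5] by auto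
    qed
  next
    fix m \<alpha> \<gamma> \<epsilon> \<zeta> assume nz: "\<alpha> \<noteq> 0" "\<epsilon> \<noteq> 0"
      and 1: "\<forall>y. \<alpha> * poly p1 y = poly (- p1) (\<epsilon> * y + \<zeta>)" and 2: "\<forall>x. \<epsilon> * poly p2 x = poly (- p2) (\<alpha> * x + \<gamma>)"
    \<comment> \<open>The signs in front of \<open>\<alpha>\<close> and \<open>\<epsilon>\<close>
      spoil a direct comparison of powers, so absolute values are treated first and the combination
      with both factors 1 is excluded afterwards.\<close>
    have pows: "- \<alpha> = \<epsilon> ^ degree p1" "- \<epsilon> = \<alpha> ^ degree p2"
      using poly_self_scale[of "- \<alpha>" p1 \<epsilon> \<zeta>] poly_self_scale[of "- \<epsilon>" p2 \<alpha> \<gamma>] 1 2 nz polys_nonzero by auto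
    have "\<bar>\<alpha>\<bar> = \<bar>\<epsilon>\<bar> ^ degree p1" "\<bar>\<epsilon>\<bar> = \<bar>\<alpha>\<bar> ^ degree p2"
      using pows by (metis abs_minus_cancel power_abs)+
    then have "\<bar>\<alpha>\<bar> = \<bar>\<alpha>\<bar> ^ (degree p2 * degree p1)" by (metis power_mult)
    moreover have "degree p2 * degree p1 \<ge> 2" using mult_le_mono[OF deg(2,1)] by simp
    ultimately have "\<bar>\<alpha>\<bar> = 1 \<or> \<bar>\<alpha>\<bar> = - 1"
      using nz by (intro real_power_eq_self[of _ "degree p2 * degree p1"]) auto
    then have "\<bar>\<alpha>\<bar> = 1" by linarith
    moreover from this have "\<bar>\<epsilon>\<bar> = 1" using \<open>\<bar>\<epsilon>\<bar> = \<bar>\<alpha>\<bar> ^ degree p2\<close> by simp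
    ultimately have pm: "\<alpha> = 1 \<or> \<alpha> = - 1" "\<epsilon> = 1 \<or> \<epsilon> = - 1" by linarith+
    have "\<not> (\<alpha> = 1 \<and> \<epsilon> = 1)"
    proof
      assume "\<alpha> = 1 \<and> \<epsilon> = 1"
      with pows(1) have "- 1 = (1::real)" by simp
      then show False by simp
    qed
    then consider "\<alpha> = 1" "\<epsilon> = - 1" | "\<alpha> = - 1" "\<epsilon> = 1" | "\<alpha> = - 1" "\<epsilon> = - 1"
      using pm by blast
    then show thesis
    proof cases
      case c: 1
      have "poly p1 (- y + \<zeta>) = - poly p1 y" for y using 1[rule_format, of y] c by simp
      then have "odd_around p1 (\<zeta> / 2)" unfolding odd_around_iff by blast
      then show thesis using that[of 2] assoc_R.R2[of p1 \<zeta> p2] by blast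
    next
      case c: 2
      have "poly p2 (- x + \<gamma>) = - poly p2 x" for x using 2[rule_format, of x] c by simp
      then have "odd_around p2 (\<gamma> / 2)" unfolding odd_around_iff by blast
      then show thesis using that[of 1] assoc_R.R1[of p2 \<gamma> p1] by blast
    next
      case c: 3
      have "poly p1 (- y + \<zeta>) = poly p1 y" "poly p2 (- x + \<gamma>) = poly p2 x" for x y
        using 1[rule_format, of y] 2[rule_format, of x] c by simp_all
      then have "even_around p1 (\<zeta> / 2)" "even_around p2 (\<gamma> / 2)" unfolding even_around_iff by blast+
      then show thesis using that[of 3] assoc_R.R3[of p1 \<zeta> p2 \<gamma>] by blast
    qed
  qed
qed

end

section \<open>Elements of infinite order\<close>

lemma (in sign) henon2_infinite_order:
  assumes "degree a \<ge> 2" "degree b \<ge> 2" "ipow (henon2 d a b) n = id"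
  shows "n = 0"
proof (rule ccontr)
  assume n: "n \<noteq> 0"
  let ?D = "degree a * degree b"
  have D: "?D > 1" using mult_le_mono[OF assms(1,2)] by simp
  note bal = balanced_id[OF assms(1,2)]
  have "?D ^ nat \<bar>n\<bar> = 1"
  proof (cases "n > 0")
    case True
    then have "n = int (nat \<bar>n\<bar>)" by simp
    then have "dgy (ipow (henon2 d a b) n \<circ> id) = ?D ^ nat \<bar>n\<bar> * dgy id"
      using bal unfolding balanced_def by metis
    then show ?thesis using assms(3) dg_snd by simp
  next
    case False
    then have "n = - int (nat \<bar>n\<bar>)" by simp
    then have "dgx (ipow (henon2 d a b) n \<circ> id) = ?D ^ nat \<bar>n\<bar> * dgx id"
      using bal unfolding balanced_def by metis
    then show ?thesis using assms(3) dg_fst by simp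
  qed
  moreover have "nat \<bar>n\<bar> > 0" using n by simp
  then have "?D ^ nat \<bar>n\<bar> > 1" by (rule one_less_power[OF D])
  ultimately show False by linarith
qed

lemma involution_PolyAut:
  assumes "V \<circ> V = id" "rpf (\<lambda>z. fst (V z))" "rpf (\<lambda>z. snd (V z))"
  shows "V \<in> carrier PolyAut"
  using in_PolyAutI[of V V] assms by blast

text \<open>Meant for S2, a square root of \<open>L\<close>, and for S3, whose fourth power is the
  square of \<open>L\<close>.\<close>

lemma ipow_root_infinite_order:
  assumes "inf_order PolyAut L" "x \<in> carrier PolyAut" "ipow x j = ipow L k" "k \<noteq> 0"
  shows "inf_order PolyAut x"
proof -
  interpret L: inf_order PolyAut L by fact
  show ?thesis
  proof unfold_locales
    fix n :: int assume "x [^]\<^bsub>PolyAut\<^esub> n = \<one>\<^bsub>PolyAut\<^esub>"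
    then have "(x [^]\<^bsub>PolyAut\<^esub> n) [^]\<^bsub>PolyAut\<^esub> j = \<one>\<^bsub>PolyAut\<^esub>" by (simp only: PA.int_pow_one)
    then have "(x [^]\<^bsub>PolyAut\<^esub> j) [^]\<^bsub>PolyAut\<^esub> n = \<one>\<^bsub>PolyAut\<^esub>"
      using assms(2) by (simp only: PA.int_pow_pow mult.commute)
    then have "L [^]\<^bsub>PolyAut\<^esub> (k * n) = \<one>\<^bsub>PolyAut\<^esub>" unfolding assms(3) by (simp only: PA.int_pow_pow L.a)
    then show "n = 0" using L.inf assms(4) by fastforce
  qed fact
qed

section \<open>The conditions on the polynomials\<close>

abbreviation odd_at :: "real poly \<Rightarrow> real \<Rightarrow> bool" where
  "odd_at p e \<equiv> (\<forall>y. poly p (- y + e) = - poly p y)"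

abbreviation even_at :: "real poly \<Rightarrow> real \<Rightarrow> bool" where
  "even_at p e \<equiv> (\<forall>y. poly p (- y + e) = poly p y)"

lemma odd_at_diff: "odd_at p e \<Longrightarrow> poly p (e - y) = - poly p y"
  and even_at_diff: "even_at p e \<Longrightarrow> poly p (e - y) = poly p y"
  by (simp_all add: algebra_simps)

inductive_cases assoc_S1E: "assoc_S p1 p2 1 V"
inductive_cases assoc_S2E: "assoc_S p1 p2 2 V"
inductive_cases assoc_S3E: "assoc_S p1 p2 3 V"
inductive_cases assoc_R1E: "assoc_R p1 p2 1 V"
inductive_cases assoc_R2E: "assoc_R p1 p2 2 V"
inductive_cases assoc_R3E: "assoc_R p1 p2 3 V"
inductive_cases assoc_R4E: "assoc_R p1 p2 4 V"
inductive_cases assoc_R5E: "assoc_R p1 p2 5 V"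

text \<open>The diagonal map exchanges the order of the two Henon factors, and
  \<open>henon 1 p2\<close> exchanges it back.\<close>

lemma symmetry_half:
  assumes nz: "\<alpha> \<noteq> 0" "\<epsilon> \<noteq> 0"
    and "\<forall>y. \<alpha> * poly p1 y = poly p2 (\<epsilon> * y + \<zeta>)" "\<forall>x. \<epsilon> * poly p2 x = poly p1 (\<alpha> * x + \<gamma>)"
  shows "henon 1 p2 \<circ> diag_map \<alpha> \<gamma> \<epsilon> \<zeta> \<in> symmetries (std_map p1 p2)"
proof -
  let ?T = "diag_map \<alpha> \<gamma> \<epsilon> \<zeta>"
  have T: "?T \<circ> std_map p1 p2 = std_map p2 p1 \<circ> ?T" by (rule diag_map_conj) fact+
  have "henon 1 p2 \<circ> ?T \<circ> std_map p1 p2 = henon 1 p2 \<circ> (std_map p2 p1 \<circ> ?T)"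
    by (simp only: comp_assoc T)
  also have "\<dots> = std_map p1 p2 \<circ> (henon 1 p2 \<circ> ?T)"
    by (simp add: std_map_eq_henon2 henon2_def comp_assoc)
  finally show ?thesis using nz unfolding symmetries_iff by (auto intro!: PolyAut_comp)
qed

text \<open>A common form for S2 and S3. The values of \<open>\<alpha>\<close>,
  \<open>\<gamma>\<close>, \<open>\<epsilon>\<close>, \<open>\<zeta>\<close> are
  \<open>1 / a\<close>, \<open>e\<close>, \<open>a\<close>, \<open>- e * a\<close> for S2 and
  \<open>- (1 / a)\<close>, \<open>e\<close>, \<open>a\<close>, \<open>c\<close> for S3, so the sign
  of \<open>\<alpha> * \<epsilon>\<close> tells them apart.\<close>

lemma assoc_S_half:
  assumes "assoc_S p1 p2 i V" "i \<in> {2, 3}"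
  obtains \<alpha> \<gamma> \<epsilon> \<zeta> where "V = henon 1 p2 \<circ> diag_map \<alpha> \<gamma> \<epsilon> \<zeta>" "\<alpha> \<noteq> 0" "\<epsilon> \<noteq> 0"
    "\<forall>y. \<alpha> * poly p1 y = poly p2 (\<epsilon> * y + \<zeta>)" "\<forall>x. \<epsilon> * poly p2 x = poly p1 (\<alpha> * x + \<gamma>)"
  using assms
proof cases
  case (S2 a e)
  have 1: "1 / a * poly p1 y = poly p2 (a * y + (- e * a))" for y
  proof -
    have "(a * y + (- e * a)) / a + e = y" using S2 by (simp add: field_simps)
    then show ?thesis using S2 by (simp only:)
  qed
  show ?thesis
  proof (rule that[of "1 / a" e a "- e * a"])
    show "V = henon 1 p2 \<circ> diag_map (1 / a) e a (- e * a)"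
      unfolding S2(2) fun_eq_iff
      by (clarsimp simp: henon_def diag_map_def 1[symmetric, simplified] add_divide_distrib)
  qed (use S2 1 in \<open>simp_all add: field_simps\<close>)
next
  case (S3 a e c)
  have "odd_around p1 ((e - c / a) / 2)" using S3 by simp
  then have odd: "odd_at p1 (e - c / a)" unfolding odd_around_iff by blast
  have 1: "- (1 / a) * poly p1 y = poly p2 (a * y + c)" for y
    using S3 by simp
  have 2: "a * poly p2 x = poly p1 (- (1 / a) * x + e)" for x
  proof -
    have "- (1 / a) * x + e = - ((x - c) / a) + (e - c / a)" by (simp add: diff_divide_distrib)
    then have "poly p1 (- (1 / a) * x + e) = - poly p1 ((x - c) / a)" using odd by (simp only:)
    then show ?thesis using S3 by simp
  qed
  show ?thesis
  proof (rule that[of "- (1 / a)" e a c])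
    show "V = henon 1 p2 \<circ> diag_map (- (1 / a)) e a c"
      unfolding S3(2) fun_eq_iff
      by (clarsimp simp: henon_def diag_map_def 1[symmetric, simplified] add_divide_distrib)
  qed (use S3 1 2 in \<open>simp_all\<close>)
qed auto

lemma assoc_S_symmetry:
  assumes "assoc_S p1 p2 i V" shows "V \<in> symmetries (std_map p1 p2)"
  using assms
proof cases
  case (S1 e c)
  have odd: "odd_at p1 e" "odd_at p2 c" using S1 unfolding odd_around_iff by blast+
  have "diag_map (- 1) c (- 1) e \<circ> std_map p1 p2 = std_map p1 p2 \<circ> diag_map (- 1) c (- 1) e"
    by (rule diag_map_conj) (use odd in simp_all)
  moreover have "V = diag_map (- 1) c (- 1) e" using S1 by (simp add: diag_map_def)
  ultimately show ?thesis unfolding symmetries_iff by auto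
next
  case S2
  then have "i \<in> {2, 3}" by simp
  from assoc_S_half[OF assms this] show ?thesis using symmetry_half by metis
next
  case S3
  then have "i \<in> {2, 3}" by simp
  from assoc_S_half[OF assms this] show ?thesis using symmetry_half by metis
qed

text \<open>R5 is exempt: its square is the point reflection sending \<open>(x, y)\<close> to
  \<open>(- x + e * a + c, - y + e - c / a)\<close>.\<close>

lemma assoc_R_involution:
  assumes "assoc_R p1 p2 i V" "i \<noteq> 5"
  shows "V \<circ> V = id" "V \<in> carrier PolyAut"
proof -
  show VV: "V \<circ> V = id"
    using assms
  proof cases
    case (R2 e)
    then have "odd_at p1 e" unfolding odd_around_iff by blast
    then show ?thesis using R2 by (auto simp: fun_eq_iff)
  next
    case (R3 e c)
    then have "even_at p1 e" unfolding even_around_iff by blast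
    then show ?thesis using R3 by (auto simp: fun_eq_iff)
  next
    case (R4 a e)
    then show ?thesis by (auto simp: fun_eq_iff field_simps)
  qed (auto simp: fun_eq_iff)
  show "V \<in> carrier PolyAut"
    using assms
    by (intro involution_PolyAut VV; cases) (auto simp: split_beta intro!: rpf_intros)
qed

text \<open>R4 and R5 are the coordinate exchange after a diagonal map, so for them the claim
  reduces to a diagonal conjugacy; R1, R2 and R3 are checked by calculation.\<close>

lemma assoc_R_reversor:
  assumes "assoc_R p1 p2 i V" shows "V \<in> reversors (std_map p1 p2)"
proof -
  let ?L = "std_map p1 p2"
  have swap: "?L \<circ> (prod.swap \<circ> T) \<circ> ?L = prod.swap \<circ> T"
    if "T \<circ> ?L = std_map (- p2) (- p1) \<circ> T" for T
  proof -
    have "?L \<circ> prod.swap \<circ> std_map (- p2) (- p1) = prod.swap"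
      by (auto simp: fun_eq_iff std_map_def Let_def)
    then have "prod.swap \<circ> T = ?L \<circ> prod.swap \<circ> std_map (- p2) (- p1) \<circ> T" by simp
    also have "\<dots> = ?L \<circ> prod.swap \<circ> (T \<circ> ?L)" unfolding that by (simp add: comp_assoc)
    also have "\<dots> = ?L \<circ> (prod.swap \<circ> T) \<circ> ?L" by (simp add: comp_assoc)
    finally show ?thesis ..
  qed
  from assms have "?L \<circ> V \<circ> ?L = V \<and> V \<in> carrier PolyAut"
  proof cases
    case (R1 c)
    then have "odd_at p2 c" unfolding odd_around_iff by blast
    note h = odd_at_diff[OF this]
    have "?L \<circ> V \<circ> ?L = V"
    proof (rule ext, clarify)
      fix x y
      show "(?L \<circ> V \<circ> ?L) (x, y) = V (x, y)"
        using h[of "x + poly p1 y"] R1 by (simp add: std_map_def Let_def algebra_simps)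
    qed
    then show ?thesis using assoc_R_involution[OF assms] R1 by simp
  next
    case (R2 e)
    then have "odd_at p1 e" unfolding odd_around_iff by blast
    note h = odd_at_diff[OF this]
    have "?L \<circ> V \<circ> ?L = V"
    proof (rule ext, clarify)
      fix x y
      show "(?L \<circ> V \<circ> ?L) (x, y) = V (x, y)"
        using h[of "y + poly p2 (x + poly p1 y)"] R2 by (simp add: std_map_def Let_def algebra_simps)
    qed
    then show ?thesis using assoc_R_involution[OF assms] R2 by simp
  next
    case (R3 e c)
    then have "even_at p1 e" "even_at p2 c" unfolding even_around_iff by blast+
    note h = this[THEN even_at_diff]
    have "?L \<circ> V \<circ> ?L = V"
    proof (rule ext, clarify)
      fix x y
      show "(?L \<circ> V \<circ> ?L) (x, y) = V (x, y)"
        using h(1)[of "y + poly p2 (x + poly p1 y)"] h(2)[of "x + poly p1 y"] R3 by (simp add: std_map_def Let_def algebra_simps)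
    qed
    then show ?thesis using assoc_R_involution[OF assms] R3 by simp
  next
    case (R4 a e)
    let ?T = "diag_map (1 / a) e a (- e * a)"
    have 1: "1 / a * poly p1 y = poly (- p2) (a * y + (- e * a))" for y
    proof -
      have "(a * y + (- e * a)) / a + e = y" using R4 by (simp add: field_simps)
      then have "poly p2 (a * y + (- e * a)) = - (1 / a) * poly p1 y" using R4 by (simp only:)
      then show ?thesis by simp
    qed
    have 2: "a * poly p2 x = poly (- p1) (1 / a * x + e)" for x using R4 by simp
    have "?T \<circ> ?L = std_map (- p2) (- p1) \<circ> ?T"
      by (rule diag_map_conj) (use 1 2 in blast)+
    moreover have "V = prod.swap \<circ> ?T" using R4 by (auto simp: fun_eq_iff diag_map_def)
    ultimately show ?thesis using swap R4 by (auto intro!: PolyAut_comp)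
  next
    case (R5 a e c)
    let ?T = "diag_map (- (1 / a)) e a c"
    have "odd_around p1 ((e - c / a) / 2)" using R5 by simp
    then have odd: "odd_at p1 (e - c / a)" unfolding odd_around_iff by blast
    have 1: "- (1 / a) * poly p1 y = poly (- p2) (a * y + c)" for y
      using R5 by simp
    have 2: "a * poly p2 x = poly (- p1) (- (1 / a) * x + e)" for x
    proof -
      have "- (1 / a) * x + e = - ((x - c) / a) + (e - c / a)" by (simp add: diff_divide_distrib)
      then have "poly p1 (- (1 / a) * x + e) = - poly p1 ((x - c) / a)" using odd by (simp only:)
      then show ?thesis using R5 by simp
    qed
    have "?T \<circ> ?L = std_map (- p2) (- p1) \<circ> ?T"
      by (rule diag_map_conj) (use 1 2 in blast)+
    moreover have "V = prod.swap \<circ> ?T" using R5 by (auto simp: fun_eq_iff diag_map_def)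
    ultimately show ?thesis using swap R5 by (auto intro!: PolyAut_comp)
  qed
  then show ?thesis by (simp add: reversors_def)
qed

text \<open>The relation common to S2 and R5 for \<open>s = 1\<close>, and to S3 and R4 for
  \<open>s = - 1\<close>.\<close>

definition half_conj :: "real \<Rightarrow> real poly \<Rightarrow> real poly \<Rightarrow> bool" where
  "half_conj s p1 p2 \<longleftrightarrow> (\<exists>a e. a \<noteq> 0 \<and> (\<forall>y. poly p2 y = s / a * poly p1 (y / a + e)))"

section \<open>Logical relations between the conditions\<close>

lemma odd_around_ex: "(\<exists>b. odd_around p b) \<longleftrightarrow> (\<exists>e. odd_at p e)"
proof
  assume "\<exists>b. odd_around p b"
  then obtain b where "odd_around p (2 * b / 2)" by auto
  then show "\<exists>e. odd_at p e" unfolding odd_around_iff by blast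
qed (metis odd_around_iff)

lemma holds_iffs:
  shows "holds_S p1 p2 1 \<longleftrightarrow> (\<exists>e. odd_at p1 e) \<and> (\<exists>c. odd_at p2 c)"
    and "holds_S p1 p2 2 \<longleftrightarrow> half_conj 1 p1 p2"
    and "holds_S p1 p2 3 \<longleftrightarrow> (\<exists>e. odd_at p1 e) \<and> half_conj (- 1) p1 p2"
    and "holds_R p1 p2 1 \<longleftrightarrow> (\<exists>c. odd_at p2 c)"
    and "holds_R p1 p2 2 \<longleftrightarrow> (\<exists>e. odd_at p1 e)"
    and "holds_R p1 p2 3 \<longleftrightarrow> (\<exists>e. even_at p1 e) \<and> (\<exists>c. even_at p2 c)"
    and "holds_R p1 p2 4 \<longleftrightarrow> half_conj (- 1) p1 p2"
    and "holds_R p1 p2 5 \<longleftrightarrow> (\<exists>e. odd_at p1 e) \<and> half_conj 1 p1 p2"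
proof -
  have shift: "(\<exists>a e c. a \<noteq> 0 \<and> odd_at p1 (e - c / a) \<and> (\<forall>y. poly p2 y = s / a * poly p1 ((y - c) / a)))
      \<longleftrightarrow> (\<exists>e. odd_at p1 e) \<and> half_conj s p1 p2" (is "?l \<longleftrightarrow> ?r") for s
  proof
    assume ?l
    then obtain a e c where *: "a \<noteq> 0" "odd_at p1 (e - c / a)" "\<forall>y. poly p2 y = s / a * poly p1 ((y - c) / a)" by blast
    then have "\<forall>y. poly p2 y = s / a * poly p1 (y / a + (- c / a))" by (simp add: diff_divide_distrib)
    then show ?r using * unfolding half_conj_def by blast
  next
    assume ?r
    then obtain e0 a e where *: "odd_at p1 e0" "a \<noteq> 0" "\<forall>y. poly p2 y = s / a * poly p1 (y / a + e)"
      unfolding half_conj_def by blast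
    \<comment> \<open>In the conditions S3 and R5 the parameter \<open>e\<close> occurs only in
      \<open>e - c / a\<close>, so every centre can be matched: \<open>c = - e * a\<close> produces
      the required shift, and \<open>e0 - e\<close> then restores the centre.\<close>
    have eq: "(e0 - e) - (- e * a) / a = e0" "\<And>y. (y - (- e * a)) / a = y / a + e"
      using * by (simp_all add: field_simps)
    have "odd_at p1 ((e0 - e) - (- e * a) / a)" unfolding eq using *(1) .
    moreover have "\<forall>y. poly p2 y = s / a * poly p1 ((y - (- e * a)) / a)" unfolding eq using *(3) .
    ultimately show ?l using *(2) by blast
  qed
  have neg: "- 1 / a = - (1 / a)" for a :: real by simp
  have t: "1 / a * x = x / a" "- (1 / a) * x = - (x / a)" for a x :: real by simp_all
  have half: "1 / 2 * x = x / (2::real)" for x by simp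
  show "holds_S p1 p2 1 \<longleftrightarrow> (\<exists>e. odd_at p1 e) \<and> (\<exists>c. odd_at p2 c)"
    unfolding holds_S_def using assoc_S.S1 assoc_S1E odd_around_iff by metis
  show "holds_S p1 p2 2 \<longleftrightarrow> half_conj 1 p1 p2"
  proof
    assume "holds_S p1 p2 2"
    then obtain T where "assoc_S p1 p2 2 T" unfolding holds_S_def by blast
    then show "half_conj 1 p1 p2"
      by (rule assoc_S2E) (unfold half_conj_def neg t, intro exI conjI, assumption+)
  next
    assume "half_conj 1 p1 p2"
    then obtain a e where "a \<noteq> 0" "\<forall>y. poly p2 y = 1 / a * poly p1 (y / a + e)"
      unfolding half_conj_def by (elim exE conjE) (rule that; assumption)
    then show "holds_S p1 p2 2"
      unfolding holds_S_def neg by (intro exI) (rule assoc_S.S2)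
  qed
  show "holds_S p1 p2 3 \<longleftrightarrow> (\<exists>e. odd_at p1 e) \<and> half_conj (- 1) p1 p2"
    unfolding shift[symmetric]
  proof
    assume "holds_S p1 p2 3"
    then obtain T where "assoc_S p1 p2 3 T" unfolding holds_S_def by blast
    then show "\<exists>a e c. a \<noteq> 0 \<and> odd_at p1 (e - c / a) \<and> (\<forall>y. poly p2 y = - 1 / a * poly p1 ((y - c) / a))"
      by (rule assoc_S3E) (unfold half odd_around_iff neg t, intro exI conjI, assumption+)
  next
    assume "\<exists>a e c. a \<noteq> 0 \<and> odd_at p1 (e - c / a) \<and> (\<forall>y. poly p2 y = - 1 / a * poly p1 ((y - c) / a))"
    then obtain a e c where "a \<noteq> 0" "odd_around p1 (1 / 2 * (e - c / a))"
      "\<forall>y. poly p2 y = - 1 / a * poly p1 ((y - c) / a)"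
      unfolding half odd_around_iff
      by (elim exE conjE) (rule that[unfolded half odd_around_iff]; assumption)
    then show "holds_S p1 p2 3"
      unfolding holds_S_def neg by (intro exI) (rule assoc_S.S3)
  qed
  show "holds_R p1 p2 1 \<longleftrightarrow> (\<exists>c. odd_at p2 c)"
    unfolding holds_R_def
    by (intro iffI; elim exE) (erule assoc_R1E, unfold odd_around_iff, rule exI, assumption,
      rule exI, rule assoc_R.R1, unfold odd_around_iff, assumption)
  show "holds_R p1 p2 2 \<longleftrightarrow> (\<exists>e. odd_at p1 e)"
    unfolding holds_R_def
    by (intro iffI; elim exE) (erule assoc_R2E, unfold odd_around_iff, rule exI, assumption,
      rule exI, rule assoc_R.R2, unfold odd_around_iff, assumption)
  show "holds_R p1 p2 3 \<longleftrightarrow> (\<exists>e. even_at p1 e) \<and> (\<exists>c. even_at p2 c)"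
    unfolding holds_R_def
    by (intro iffI; elim exE conjE) (erule assoc_R3E, unfold even_around_iff, intro conjI exI, assumption, assumption,
      rule exI, rule assoc_R.R3, unfold even_around_iff, assumption, assumption)
  show "holds_R p1 p2 4 \<longleftrightarrow> half_conj (- 1) p1 p2"
  proof
    assume "holds_R p1 p2 4"
    then obtain T where "assoc_R p1 p2 4 T" unfolding holds_R_def by blast
    then show "half_conj (- 1) p1 p2"
      by (rule assoc_R4E) (unfold half_conj_def neg t, intro exI conjI, assumption+)
  next
    assume "half_conj (- 1) p1 p2"
    then obtain a e where "a \<noteq> 0" "\<forall>y. poly p2 y = - 1 / a * poly p1 (y / a + e)"
      unfolding half_conj_def by (elim exE conjE) (rule that; assumption)
    then show "holds_R p1 p2 4"
      unfolding holds_R_def neg by (intro exI) (rule assoc_R.R4)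
  qed
  show "holds_R p1 p2 5 \<longleftrightarrow> (\<exists>e. odd_at p1 e) \<and> half_conj 1 p1 p2"
    unfolding shift[symmetric]
  proof
    assume "holds_R p1 p2 5"
    then obtain T where "assoc_R p1 p2 5 T" unfolding holds_R_def by blast
    then show "\<exists>a e c. a \<noteq> 0 \<and> odd_at p1 (e - c / a) \<and> (\<forall>y. poly p2 y = 1 / a * poly p1 ((y - c) / a))"
      by (rule assoc_R5E) (unfold half odd_around_iff neg t, intro exI conjI, assumption+)
  next
    assume "\<exists>a e c. a \<noteq> 0 \<and> odd_at p1 (e - c / a) \<and> (\<forall>y. poly p2 y = 1 / a * poly p1 ((y - c) / a))"
    then obtain a e c where "a \<noteq> 0" "odd_around p1 (1 / 2 * (e - c / a))"
      "\<forall>y. poly p2 y = 1 / a * poly p1 ((y - c) / a)"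
      unfolding half odd_around_iff
      by (elim exE conjE) (rule that[unfolded half odd_around_iff]; assumption)
    then show "holds_R p1 p2 5"
      unfolding holds_R_def neg by (intro exI) (rule assoc_R.R5)
  qed
qed

text \<open>The affine map \<open>y / a + e\<close> carries the reflection belonging to
  \<open>p2\<close> to that belonging to \<open>p1\<close>. Both \<open>e1\<close> and the resulting
  number are twice the centre.\<close>

lemma half_conj_odd_center:
  assumes "a \<noteq> 0" "\<forall>y. poly p2 y = s / a * poly p1 (y / a + e)" "odd_at p1 e1"
  shows "odd_at p2 (a * (e1 - 2 * e))"
proof
  fix y
  have "(- y + a * (e1 - 2 * e)) / a + e = - (y / a + e) + e1" using assms(1) by (simp add: field_simps)
  then have "poly p1 ((- y + a * (e1 - 2 * e)) / a + e) = - poly p1 (y / a + e)" using assms(3) by (simp only:)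
  then show "poly p2 (- y + a * (e1 - 2 * e)) = - poly p2 y" unfolding assms(2)[rule_format] by simp
qed

lemma half_conj_even_center:
  assumes "a \<noteq> 0" "\<forall>y. poly p2 y = s / a * poly p1 (y / a + e)" "even_at p1 e1"
  shows "even_at p2 (a * (e1 - 2 * e))"
proof
  fix y
  have "(- y + a * (e1 - 2 * e)) / a + e = - (y / a + e) + e1" using assms(1) by (simp add: field_simps)
  then have "poly p1 ((- y + a * (e1 - 2 * e)) / a + e) = poly p1 (y / a + e)" using assms(3) by (simp only:)
  then show "poly p2 (- y + a * (e1 - 2 * e)) = poly p2 y" unfolding assms(2)[rule_format] by simp
qed

text \<open>Inverting \<open>y / a + e\<close> replaces \<open>a\<close> by \<open>1 / a\<close>,
  and \<open>s\<close> reappears because \<open>s * s = 1\<close>.\<close>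

lemma half_conj_sym:
  assumes "half_conj s p1 p2" "s = 1 \<or> s = - 1" shows "half_conj s p2 p1"
proof -
  obtain a e where a: "a \<noteq> 0" and eq: "\<forall>y. poly p2 y = s / a * poly p1 (y / a + e)"
    using assms unfolding half_conj_def by (elim exE conjE) (rule that)
  have "poly p1 u = s / (1 / a) * poly p2 (u / (1 / a) + (- a * e))" for u
  proof -
    have "(u / (1 / a) + (- a * e)) / a + e = u" using a by (simp add: field_simps)
    then have "poly p2 (u / (1 / a) + (- a * e)) = s / a * poly p1 u" using eq by (simp only:)
    then show ?thesis using a assms(2) by auto
  qed
  then show ?thesis unfolding half_conj_def using a by (intro exI[of _ "1 / a"] exI[of _ "- a * e"]) simp
qed

lemma half_conj_odd_iff:
  assumes "half_conj s p1 p2" "s = 1 \<or> s = - 1"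
  shows "(\<exists>e. odd_at p1 e) \<longleftrightarrow> (\<exists>c. odd_at p2 c)" "(\<exists>e. even_at p1 e) \<longleftrightarrow> (\<exists>c. even_at p2 c)"
proof -
  have *: "((\<exists>e. odd_at p e) \<longrightarrow> (\<exists>c. odd_at q c)) \<and> ((\<exists>e. even_at p e) \<longrightarrow> (\<exists>c. even_at q c))"
    if hc: "half_conj s p q" for p q
  proof -
    obtain a e where "a \<noteq> 0" "\<forall>y. poly q y = s / a * poly p (y / a + e)"
      using hc unfolding half_conj_def by (elim exE conjE) (rule that)
    from half_conj_odd_center[OF this] half_conj_even_center[OF this] show ?thesis by blast
  qed
  show "(\<exists>e. odd_at p1 e) \<longleftrightarrow> (\<exists>c. odd_at p2 c)" "(\<exists>e. even_at p1 e) \<longleftrightarrow> (\<exists>c. even_at p2 c)"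
    using *[OF assms(1)] *[OF half_conj_sym[OF assms]] by blast+
qed

text \<open>Equating the two expressions for \<open>p2\<close> gives a self-similarity of
  \<open>p1\<close> with argument factor \<open>r = a / b\<close> and value factor
  \<open>- (1 / r)\<close>. Leading coefficients force \<open>r = - 1\<close>, and this is
  evenness.\<close>

lemma half_conj_both_even:
  assumes "half_conj 1 p1 p2" "half_conj (- 1) p1 p2" "p1 \<noteq> 0"
  shows "\<exists>e. even_at p1 e"
proof -
  obtain a e where a: "a \<noteq> 0" and 1: "\<forall>y. poly p2 y = 1 / a * poly p1 (y / a + e)"
    using assms(1) unfolding half_conj_def by (elim exE conjE) (rule that)
  obtain b f where b: "b \<noteq> 0" and 2: "\<forall>y. poly p2 y = - 1 / b * poly p1 (y / b + f)"
    using assms(2) unfolding half_conj_def by (elim exE conjE) (rule that)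
  define r where "r = a / b"
  have r: "r \<noteq> 0" using a b by (simp add: r_def)
  have self: "- (1 / r) * poly p1 u = poly p1 (r * u + (f - r * e))" for u
  proof -
    have "poly p2 (a * (u - e)) = 1 / a * poly p1 u" using 1 a by simp
    moreover have "a * (u - e) / b + f = r * u + (f - r * e)" using b by (simp add: r_def field_simps)
    then have "poly p2 (a * (u - e)) = - 1 / b * poly p1 (r * u + (f - r * e))" using 2 by (simp only:)
    ultimately have "1 / a * poly p1 u = - 1 / b * poly p1 (r * u + (f - r * e))" by simp
    then show ?thesis using a b by (simp add: r_def field_simps)
  qed
  have pw: "- (1 / r) = r ^ degree p1" using poly_self_scale[OF self r assms(3)] .
  then have "\<bar>- (1 / r)\<bar> = \<bar>r ^ degree p1\<bar>" by simp
  then have "1 = \<bar>r\<bar> * \<bar>r\<bar> ^ degree p1" using r by (simp add: power_abs divide_simps mult.commute)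
  then have "\<bar>r\<bar> = \<bar>r\<bar> ^ Suc (Suc (degree p1))" by simp
  from real_power_eq_self[OF this] have "\<bar>r\<bar> = 1" using r by auto
  moreover have "r \<noteq> 1"
  proof
    assume "r = 1"
    with pw have "- 1 = (1::real)" by simp
    then show False by simp
  qed
  ultimately have "r = - 1" by linarith
  then have "poly p1 (- u + (f + e)) = poly p1 u" for u using self[of u] by simp
  then show ?thesis by blast
qed

text \<open>Evenness absorbs a change of sign of \<open>a\<close> in the argument, so only the
  prefactor changes its sign.\<close>

lemma half_conj_even_flip:
  assumes "\<exists>e. even_at p1 e" "half_conj s p1 p2" shows "half_conj (- s) p1 p2"
proof -
  obtain e1 where e1: "even_at p1 e1" using assms by blast
  obtain a e where a: "a \<noteq> 0" and 1: "\<forall>y. poly p2 y = s / a * poly p1 (y / a + e)"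
    using assms(2) unfolding half_conj_def by (elim exE conjE) (rule that)
  have "poly p2 y = - s / (- a) * poly p1 (y / (- a) + (e1 - e))" for y
  proof -
    have "y / (- a) + (e1 - e) = - (y / a + e) + e1" by simp
    then have "poly p1 (y / (- a) + (e1 - e)) = poly p1 (y / a + e)" using e1 by (simp only:)
    then show ?thesis using 1 by simp
  qed
  then show ?thesis unfolding half_conj_def using a by (intro exI[of _ "- a"] exI[of _ "e1 - e"]) simp
qed

lemma odd_even_exclusive:
  fixes p :: "real poly"
  assumes "odd_at p e" "even_at p e'" shows "p = 0"
proof (rule ccontr)
  assume "p \<noteq> 0"
  then have "- 1 = (- 1 :: real) ^ degree p" "1 = (- 1 :: real) ^ degree p"
    using poly_self_scale[of "- 1" p "- 1" e] poly_self_scale[of 1 p "- 1" e'] assms by auto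
  then show False by linarith
qed

text \<open>The propositional core of the classification. \<open>O1\<close>, \<open>O2\<close> stand
  for oddness and \<open>E1\<close>, \<open>E2\<close> for evenness of the two polynomials,
  \<open>P\<close> and \<open>M\<close> for \<open>half_conj\<close> with the signs plus and
  minus.\<close>

lemma exactly_one_alternative:
  fixes O1 O2 E1 E2 P M :: bool
  assumes "P \<Longrightarrow> O1 \<longleftrightarrow> O2" "M \<Longrightarrow> O1 \<longleftrightarrow> O2" "P \<Longrightarrow> E1 \<longleftrightarrow> E2" "M \<Longrightarrow> E1 \<longleftrightarrow> E2"
    "P \<Longrightarrow> M \<Longrightarrow> E1" "E1 \<Longrightarrow> P \<Longrightarrow> M" "E1 \<Longrightarrow> M \<Longrightarrow> P" "\<not> (O1 \<and> E1)" "\<not> (O2 \<and> E2)"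
  shows "\<exists>!k::nat.
     (k = 1 \<and> \<not> O1 \<and> \<not> O2 \<and> \<not> (E1 \<and> E2) \<and> \<not> P \<and> \<not> M) \<or>
     (k = 2 \<and> \<not> O1 \<and> \<not> O2 \<and> \<not> (E1 \<and> E2) \<and> P \<and> \<not> M) \<or>
     (k = 3 \<and> \<not> P \<and> (O2 \<and> \<not> O1 \<and> \<not> M \<or> O1 \<and> \<not> O2 \<and> \<not> M \<or> E1 \<and> E2 \<and> \<not> O1 \<and> \<not> O2 \<and> \<not> M \<or>
        M \<and> \<not> O1 \<and> \<not> O2 \<and> \<not> (E1 \<and> E2))) \<or>
     (k = 4 \<and> P \<and> E1 \<and> E2) \<or>
     (k = 5 \<and> O1 \<and> O2 \<and> \<not> P \<and> \<not> M) \<or>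
     (k = 6 \<and> O1 \<and> M) \<or>
     (k = 7 \<and> O1 \<and> O2 \<and> P)"
proof -
  consider (c6) "O1" "M" | (c7) "O1" "O2" "P" "\<not> M" | (c5) "O1" "O2" "\<not> P" "\<not> M" | (c4) "\<not> O1" "P" "M"
    | (c2) "\<not> O1" "P" "\<not> M" | (c3) "\<not> O1" "\<not> P" "M" | (c1) "O1" "\<not> O2" "\<not> M" | (c0) "\<not> O1" "\<not> P" "\<not> M"
    by blast
  then show ?thesis
  proof cases
    case c6
    then have "O2" "\<not> E1" "\<not> E2" "\<not> P" using assms by blast+
    with c6 show ?thesis by simp
  next
    case c7
    then have "\<not> E1" "\<not> E2" using assms by blast+
    with c7 show ?thesis by simp
  next
    case c5
    then have "\<not> E1" "\<not> E2" using assms by blast+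
    with c5 show ?thesis by simp
  next
    case c4
    then have "\<not> O2" "E1" "E2" using assms by blast+
    with c4 show ?thesis by simp
  next
    case c2
    then have "\<not> O2" "\<not> E1" "\<not> E2" using assms by blast+
    with c2 show ?thesis by simp
  next
    case c3
    then have "\<not> O2" "\<not> E1" "\<not> E2" using assms by blast+
    with c3 show ?thesis by simp
  next
    case c1
    then have "\<not> E1" "\<not> P" using assms by blast+
    with c1 show ?thesis by simp
  next
    case c0
    show ?thesis
    proof (cases O2)
      case True
      then have "\<not> E2" using assms by blast
      with c0 True show ?thesis by simp
    next
      case False
      with c0 show ?thesis by (cases E1; cases E2; simp)
    qed
  qed
qed

lemma ex1_4: "(\<exists>!i. i \<in> {1, 2, 3, 4::nat} \<and> Q i) \<longleftrightarrow>
    (Q 1 \<and> \<not> Q 2 \<and> \<not> Q 3 \<and> \<not> Q 4) \<or> (\<not> Q 1 \<and> Q 2 \<and> \<not> Q 3 \<and> \<not> Q 4) \<or>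
    (\<not> Q 1 \<and> \<not> Q 2 \<and> Q 3 \<and> \<not> Q 4) \<or> (\<not> Q 1 \<and> \<not> Q 2 \<and> \<not> Q 3 \<and> Q 4)" (is "?l \<longleftrightarrow> ?r")
proof
  assume ?l
  then obtain i where i: "i \<in> {1, 2, 3, 4}" "Q i" and u: "\<And>j. j \<in> {1, 2, 3, 4} \<Longrightarrow> Q j \<Longrightarrow> j = i" by blast
  show ?r using i u[of 1] u[of 2] u[of 3] u[of 4] by auto
next
  assume ?r
  then show ?l
  proof (elim disjE conjE)
    assume "Q 1" "\<not> Q 2" "\<not> Q 3" "\<not> Q 4" then show ?l by (intro ex1I[of _ 1]) auto
  next
    assume "\<not> Q 1" "Q 2" "\<not> Q 3" "\<not> Q 4" then show ?l by (intro ex1I[of _ 2]) auto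
  next
    assume "\<not> Q 1" "\<not> Q 2" "Q 3" "\<not> Q 4" then show ?l by (intro ex1I[of _ 3]) auto
  next
    assume "\<not> Q 1" "\<not> Q 2" "\<not> Q 3" "Q 4" then show ?l by (intro ex1I[of _ 4]) auto
  qed
qed

locale nonlinear =
  fixes p1 p2 :: "real poly"
  assumes deg: "degree p1 \<ge> 2" "degree p2 \<ge> 2"
begin

abbreviation "O1 \<equiv> \<exists>e. odd_at p1 e"
abbreviation "O2 \<equiv> \<exists>c. odd_at p2 c"
abbreviation "E1 \<equiv> \<exists>e. even_at p1 e"
abbreviation "E2 \<equiv> \<exists>c. even_at p2 c"
abbreviation "P \<equiv> half_conj 1 p1 p2"
abbreviation "M \<equiv> half_conj (- 1) p1 p2"

lemma condition_rules:
  "P \<Longrightarrow> O1 \<longleftrightarrow> O2" "M \<Longrightarrow> O1 \<longleftrightarrow> O2" "P \<Longrightarrow> E1 \<longleftrightarrow> E2" "M \<Longrightarrow> E1 \<longleftrightarrow> E2"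
  "P \<Longrightarrow> M \<Longrightarrow> E1" "E1 \<Longrightarrow> P \<Longrightarrow> M" "E1 \<Longrightarrow> M \<Longrightarrow> P" "\<not> (O1 \<and> E1)" "\<not> (O2 \<and> E2)"
proof -
  show "P \<Longrightarrow> O1 \<longleftrightarrow> O2" "P \<Longrightarrow> E1 \<longleftrightarrow> E2" using half_conj_odd_iff[of 1 p1 p2] by blast+
  show "M \<Longrightarrow> O1 \<longleftrightarrow> O2" "M \<Longrightarrow> E1 \<longleftrightarrow> E2" using half_conj_odd_iff[of "- 1" p1 p2] by blast+
  have nz: "p1 \<noteq> 0" "p2 \<noteq> 0" using deg by auto
  show "P \<Longrightarrow> M \<Longrightarrow> E1" using half_conj_both_even nz by blast
  show "E1 \<Longrightarrow> P \<Longrightarrow> M" using half_conj_even_flip[of p1 1 p2] by blast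
  show "E1 \<Longrightarrow> M \<Longrightarrow> P" using half_conj_even_flip[of p1 "- 1" p2] by simp
  show "\<not> (O1 \<and> E1)" "\<not> (O2 \<and> E2)" using odd_even_exclusive nz by blast+
qed

lemma possibility_iff:
  "possibility p1 p2 k \<longleftrightarrow>
     (k = 1 \<and> \<not> O1 \<and> \<not> O2 \<and> \<not> (E1 \<and> E2) \<and> \<not> P \<and> \<not> M) \<or>
     (k = 2 \<and> \<not> O1 \<and> \<not> O2 \<and> \<not> (E1 \<and> E2) \<and> P \<and> \<not> M) \<or>
     (k = 3 \<and> \<not> P \<and> (O2 \<and> \<not> O1 \<and> \<not> M \<or> O1 \<and> \<not> O2 \<and> \<not> M \<or> E1 \<and> E2 \<and> \<not> O1 \<and> \<not> O2 \<and> \<not> M \<or>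
        M \<and> \<not> O1 \<and> \<not> O2 \<and> \<not> (E1 \<and> E2))) \<or>
     (k = 4 \<and> P \<and> E1 \<and> E2) \<or>
     (k = 5 \<and> O1 \<and> O2 \<and> \<not> P \<and> \<not> M) \<or>
     (k = 6 \<and> O1 \<and> M) \<or>
     (k = 7 \<and> O1 \<and> O2 \<and> P)"
proof -
  have S: "(\<forall>i\<in>{1, 2, 3}. \<not> holds_S p1 p2 i) \<longleftrightarrow> \<not> (O1 \<and> O2) \<and> \<not> P \<and> \<not> (O1 \<and> M)"
    unfolding ball_simps holds_iffs by blast
  have R: "(\<forall>i\<in>{1, 2, 3, 4, 5}. \<not> holds_R p1 p2 i) \<longleftrightarrow> \<not> O1 \<and> \<not> O2 \<and> \<not> (E1 \<and> E2) \<and> \<not> M"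
    unfolding ball_simps holds_iffs by blast
  show ?thesis
    unfolding possibility.simps S R ex1_4 holds_iffs using condition_rules by argo
qed

lemma unique_possibility: "\<exists>!k. possibility p1 p2 k"
  unfolding possibility_iff
  by (rule exactly_one_alternative[OF condition_rules])

end

text \<open>The parameters of S2 and S3 need not be unique. The quotient of two diagonal factors is
  a diagonal self-conjugacy for the exchanged polynomials, hence trivial or a point reflection;
  moved across \<open>henon 1 p2\<close>, the latter becomes S1.\<close>

lemma assoc_S_half_unique:
  assumes deg: "degree p1 \<ge> 2" "degree p2 \<ge> 2"
    and "assoc_S p1 p2 i V" "assoc_S p1 p2 i V'" "i \<in> {2, 3}"
  obtains "V' = V" | Z where "assoc_S p1 p2 1 Z" "V' = Z \<circ> V"
proof -
  obtain \<alpha> \<gamma> \<epsilon> \<zeta> where V: "V = henon 1 p2 \<circ> diag_map \<alpha> \<gamma> \<epsilon> \<zeta>" and nz: "\<alpha> \<noteq> 0" "\<epsilon> \<noteq> 0"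
    and 1: "\<forall>y. \<alpha> * poly p1 y = poly p2 (\<epsilon> * y + \<zeta>)" and 2: "\<forall>x. \<epsilon> * poly p2 x = poly p1 (\<alpha> * x + \<gamma>)"
    by (rule assoc_S_half[OF assms(3,5)])
  obtain \<alpha>' \<gamma>' \<epsilon>' \<zeta>' where V': "V' = henon 1 p2 \<circ> diag_map \<alpha>' \<gamma>' \<epsilon>' \<zeta>'" and nz': "\<alpha>' \<noteq> 0" "\<epsilon>' \<noteq> 0"
    and c1: "\<forall>y. \<alpha>' * poly p1 y = poly p2 (\<epsilon>' * y + \<zeta>')" and c2: "\<forall>x. \<epsilon>' * poly p2 x = poly p1 (\<alpha>' * x + \<gamma>')"
    by (rule assoc_S_half[OF assms(4,5)])
  have A: "\<alpha>' / \<alpha> * poly p2 u = poly p2 (\<epsilon>' / \<epsilon> * u + (\<zeta>' - \<epsilon>' / \<epsilon> * \<zeta>))" for u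
  proof -
    have "\<epsilon> * ((u - \<zeta>) / \<epsilon>) + \<zeta> = u" "\<epsilon>' * ((u - \<zeta>) / \<epsilon>) + \<zeta>' = \<epsilon>' / \<epsilon> * u + (\<zeta>' - \<epsilon>' / \<epsilon> * \<zeta>)"
      using nz by (simp_all add: field_simps)
    then have "poly p2 u = \<alpha> * poly p1 ((u - \<zeta>) / \<epsilon>)"
      "poly p2 (\<epsilon>' / \<epsilon> * u + (\<zeta>' - \<epsilon>' / \<epsilon> * \<zeta>)) = \<alpha>' * poly p1 ((u - \<zeta>) / \<epsilon>)"
      using 1[rule_format, of "(u - \<zeta>) / \<epsilon>"] c1[rule_format, of "(u - \<zeta>) / \<epsilon>"] by (simp_all only:)
    then show ?thesis using nz by simp
  qed
  have B: "\<epsilon>' / \<epsilon> * poly p1 u = poly p1 (\<alpha>' / \<alpha> * u + (\<gamma>' - \<alpha>' / \<alpha> * \<gamma>))" for u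
  proof -
    have "\<alpha> * ((u - \<gamma>) / \<alpha>) + \<gamma> = u" "\<alpha>' * ((u - \<gamma>) / \<alpha>) + \<gamma>' = \<alpha>' / \<alpha> * u + (\<gamma>' - \<alpha>' / \<alpha> * \<gamma>)"
      using nz by (simp_all add: field_simps)
    then have "poly p1 u = \<epsilon> * poly p2 ((u - \<gamma>) / \<alpha>)"
      "poly p1 (\<alpha>' / \<alpha> * u + (\<gamma>' - \<alpha>' / \<alpha> * \<gamma>)) = \<epsilon>' * poly p2 ((u - \<gamma>) / \<alpha>)"
      using 2[rule_format, of "(u - \<gamma>) / \<alpha>"] c2[rule_format, of "(u - \<gamma>) / \<alpha>"] by (simp_all only:)
    then show ?thesis using nz by simp
  qed
  have q: "\<alpha>' / \<alpha> \<noteq> 0" "\<epsilon>' / \<epsilon> \<noteq> 0" using nz nz' by simp_all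
  have AA: "\<forall>u. \<alpha>' / \<alpha> * poly p2 u = poly p2 (\<epsilon>' / \<epsilon> * u + (\<zeta>' - \<epsilon>' / \<epsilon> * \<zeta>))"
    and BB: "\<forall>u. \<epsilon>' / \<epsilon> * poly p1 u = poly p1 (\<alpha>' / \<alpha> * u + (\<gamma>' - \<alpha>' / \<alpha> * \<gamma>))"
    using A B by blast+
  show ?thesis
  proof (cases rule: diag_map_self_conj[OF deg(2,1) q AA BB])
    case 1
    then have "\<alpha>' = \<alpha>" "\<epsilon>' = \<epsilon>" "\<gamma>' = \<gamma>" "\<zeta>' = \<zeta>" using nz by simp_all
    then show ?thesis using that(1) V V' by simp
  next
    case 2
    then have e: "\<alpha>' = - \<alpha>" "\<epsilon>' = - \<epsilon>" using nz by (simp_all add: field_simps)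
    have odd2: "odd_at p2 (\<zeta>' + \<zeta>)" and odd1: "odd_at p1 (\<gamma>' + \<gamma>)" using 2 by simp_all
    let ?Z = "\<lambda>(x, y). (- x + (\<zeta>' + \<zeta>), - y + (\<gamma>' + \<gamma>))"
    have "assoc_S p1 p2 1 ?Z"
      using odd1 odd2 by (intro assoc_S.S1) (unfold odd_around_iff)
    moreover have "V' = ?Z \<circ> V"
    proof (rule ext, clarify)
      fix x y
      have "- \<epsilon> * y + \<zeta>' = - (\<epsilon> * y + \<zeta>) + (\<zeta>' + \<zeta>)" by simp
      then have "poly p2 (- \<epsilon> * y + \<zeta>') = - poly p2 (\<epsilon> * y + \<zeta>)" using odd2 by (simp only:)
      then show "V' (x, y) = (?Z \<circ> V) (x, y)"
        unfolding V V' e by (simp add: henon_def diag_map_def)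
    qed
    ultimately show ?thesis using that(2) by blast
  qed
qed

section \<open>Membership in products of cyclic subgroups\<close>

lemma subgroup_cyc: "f \<in> carrier PolyAut \<Longrightarrow> subgroup (cyc f) PolyAut"
  by (intro PA.generate_is_subgroup) simp

lemma in_cyc: "f \<in> cyc f"
  by (rule generate.incl) simp

lemma in_set_mult_left:
  assumes "subgroup H PolyAut" "f \<in> K" "f \<in> carrier PolyAut" shows "f \<in> K <#>\<^bsub>PolyAut\<^esub> H"
proof -
  have "f \<otimes>\<^bsub>PolyAut\<^esub> \<one>\<^bsub>PolyAut\<^esub> \<in> K <#>\<^bsub>PolyAut\<^esub> H"
    using assms subgroup.one_closed unfolding set_mult_def by blast
  then show ?thesis by simp
qed

lemma in_set_mult_right:
  assumes "subgroup K PolyAut" "f \<in> H" "f \<in> carrier PolyAut" shows "f \<in> K <#>\<^bsub>PolyAut\<^esub> H"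
proof -
  have "\<one>\<^bsub>PolyAut\<^esub> \<otimes>\<^bsub>PolyAut\<^esub> f \<in> K <#>\<^bsub>PolyAut\<^esub> H"
    using assms subgroup.one_closed unfolding set_mult_def by blast
  then show ?thesis by simp
qed

lemma cyc_subset:
  assumes "subgroup K PolyAut" "f \<in> K" shows "cyc f \<subseteq> K"
  by (rule PA.generate_subgroup_incl[OF _ assms(1)]) (use assms(2) in simp)

lemma set_mult_subset:
  assumes "subgroup K PolyAut" "A \<subseteq> K" "B \<subseteq> K" shows "A <#>\<^bsub>PolyAut\<^esub> B \<subseteq> K"
  using assms subgroup.m_closed[OF assms(1)] unfolding set_mult_def by blast

lemma comp_in_subgroup: "subgroup K PolyAut \<Longrightarrow> f \<in> K \<Longrightarrow> g \<in> K \<Longrightarrow> f \<circ> g \<in> K"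
  using subgroup.m_closed by fastforce

lemma ipow_2: "f \<in> carrier PolyAut \<Longrightarrow> ipow f 2 = f \<circ> f"
  using ipow_add[of f 1 1] by simp

section \<open>Relations among the associated maps\<close>

lemma assoc_S1_obtain:
  assumes "assoc_S p1 p2 1 Z"
  obtains c e where "Z = (\<lambda>(x, y). (- x + c, - y + e))" "odd_at p1 e" "odd_at p2 c"
  using assms
proof cases
  case (S1 e c)
  show thesis
    by (rule that[OF S1(1) odd_around_iff[THEN iffD1, OF S1(2)] odd_around_iff[THEN iffD1, OF S1(3)]])
qed simp_all

lemma assoc_S2_obtain:
  assumes "assoc_S p1 p2 2 V"
  obtains a e where "V = (\<lambda>(x, y). (a * y - e * a, (x + poly p1 y) / a + e))" "a \<noteq> 0"
    "\<forall>y. poly p2 y = 1 / a * poly p1 (y / a + e)"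
  using assms
proof cases
  case (S2 a e)
  show thesis by (rule that[OF S2])
qed simp_all

lemma assoc_S3_obtain:
  assumes "assoc_S p1 p2 3 V"
  obtains a e c where "V = (\<lambda>(x, y). (a * y + c, - ((x + poly p1 y) / a) + e))" "a \<noteq> 0"
    "odd_at p1 (e - c / a)" "\<forall>y. poly p2 y = - (1 / a) * poly p1 ((y - c) / a)"
  using assms
proof cases
  case (S3 a e c)
  have "odd_around p1 ((e - c / a) / 2)" using S3(3) by simp
  from that[OF S3(1,2) odd_around_iff[THEN iffD1, OF this] S3(4)] show thesis .
qed simp_all

lemma assoc_R1_obtain:
  assumes "assoc_R p1 p2 1 R"
  obtains c where "R = (\<lambda>(x, y). (- x - poly p1 y + c, y))" "odd_at p2 c"
  using assms
proof cases
  case (R1 c)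
  show thesis by (rule that[OF R1(1) odd_around_iff[THEN iffD1, OF R1(2)]])
qed simp_all

lemma assoc_R3_obtain:
  assumes "assoc_R p1 p2 3 R"
  obtains c e where "R = (\<lambda>(x, y). (- x - poly p1 y + c, - y + e))" "even_at p1 e" "even_at p2 c"
  using assms
proof cases
  case (R3 e c)
  show thesis
    by (rule that[OF R3(1) even_around_iff[THEN iffD1, OF R3(2)] even_around_iff[THEN iffD1, OF R3(3)]])
qed simp_all

lemma assoc_S1_unique:
  assumes "degree p1 \<ge> 1" "degree p2 \<ge> 1" "assoc_S p1 p2 1 Z" "assoc_S p1 p2 1 Z'" shows "Z' = Z"
proof -
  from assms(3) obtain c e where Z: "Z = (\<lambda>(x, y). (- x + c, - y + e))" "odd_at p1 e" "odd_at p2 c"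
    by (rule assoc_S1_obtain)
  from assms(4) obtain c' e' where Z': "Z' = (\<lambda>(x, y). (- x + c', - y + e'))" "odd_at p1 e'" "odd_at p2 c'"
    by (rule assoc_S1_obtain)
  have "e' = e" "c' = c"
    by (rule odd_center_unique[OF Z'(2) Z(2) assms(1)], rule odd_center_unique[OF Z'(3) Z(3) assms(2)])
  then show ?thesis unfolding Z(1) Z'(1) by simp
qed

lemma assoc_S1_facts:
  assumes "assoc_S p1 p2 1 Z"
  shows "Z \<in> carrier PolyAut" "Z \<circ> Z = id" "Z \<noteq> id" "Z \<circ> std_map p1 p2 = std_map p1 p2 \<circ> Z"
proof -
  show "Z \<in> carrier PolyAut" "Z \<circ> std_map p1 p2 = std_map p1 p2 \<circ> Z"
    using assoc_S_symmetry[OF assms] by (auto simp: symmetries_iff)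
  from assms obtain c e where Z: "Z = (\<lambda>(x, y). (- x + c, - y + e))" by (rule assoc_S1_obtain)
  show "Z \<circ> Z = id" unfolding Z by auto
  show "Z \<noteq> id"
  proof
    assume "Z = id"
    then have "Z (0, 0) = (0, 0)" "Z (1, 0) = (1, 0)" by simp_all
    then show False unfolding Z by simp
  qed
qed

lemma assoc_S2_sq:
  assumes "assoc_S p1 p2 2 V" shows "V \<circ> V = std_map p1 p2"
proof -
  from assms obtain a e where V: "V = (\<lambda>(x, y). (a * y - e * a, (x + poly p1 y) / a + e))" and a: "a \<noteq> 0"
    and p2: "\<forall>y. poly p2 y = 1 / a * poly p1 (y / a + e)" by (rule assoc_S2_obtain)
  show ?thesis
  proof (rule ext, clarify)
    fix x y
    define X where "X = x + poly p1 y"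
    have "(V \<circ> V) (x, y) = (a * (X / a + e) - e * a, (a * y - e * a + poly p1 (X / a + e)) / a + e)"
      unfolding V X_def by simp
    also have "\<dots> = (X, y + poly p2 X)" unfolding p2[rule_format] using a by (simp add: field_simps)
    also have "\<dots> = std_map p1 p2 (x, y)" unfolding X_def std_map_def by (simp add: Let_def)
    finally show "(V \<circ> V) (x, y) = std_map p1 p2 (x, y)" .
  qed
qed

text \<open>The parameters of the two maps are chosen independently; uniqueness of the centre ties
  \<open>c\<close> to \<open>a\<close>, \<open>e\<close> and \<open>e1\<close>, and then the
  calculation closes.\<close>

lemma reflection_S2_R3:
  assumes deg: "degree p2 \<ge> 1" and V: "assoc_S p1 p2 2 V" and R: "assoc_R p1 p2 3 R"
  shows "V \<circ> R \<circ> V = R"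
proof -
  from V obtain a e where V: "V = (\<lambda>(x, y). (a * y - e * a, (x + poly p1 y) / a + e))" and a: "a \<noteq> 0"
    and p2': "\<forall>y. poly p2 y = 1 / a * poly p1 (y / a + e)" by (rule assoc_S2_obtain)
  from R obtain c e1 where R: "R = (\<lambda>(x, y). (- x - poly p1 y + c, - y + e1))"
    and e1: "even_at p1 e1" and c: "even_at p2 c" by (rule assoc_R3_obtain)
  have c_eq: "c = a * (e1 - 2 * e)"
    by (rule even_center_unique[OF c half_conj_even_center[OF a p2' e1] deg])
  show "V \<circ> R \<circ> V = R"
  proof (rule ext, clarify)
    fix x y
    define v where "v = (x + poly p1 y) / a + e"
    have "(V \<circ> R \<circ> V) (x, y) = (a * (- v + e1) - e * a, (- (a * y - e * a) - poly p1 v + c + poly p1 (- v + e1)) / a + e)"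
    proof -
      have "V (x, y) = (a * y - e * a, v)" unfolding V v_def by simp
      then have "(V \<circ> R \<circ> V) (x, y) = V (R (a * y - e * a, v))" by simp
      then show ?thesis unfolding V R by simp
    qed
    also have "\<dots> = (a * (- v + e1) - e * a, (- (a * y - e * a) + c) / a + e)"
      using e1 by simp
    also have "\<dots> = R (x, y)" unfolding R v_def c_eq using a by (simp add: field_simps)
    finally show "(V \<circ> R \<circ> V) (x, y) = R (x, y)" .
  qed
qed

text \<open>Placed between two copies of S2, R1 turns into R2, and R1 after R2 is S1. That S1
  appears here instead of the identity is the origin of the twist in the seventh
  possibility.\<close>

lemma S2_relations:
  assumes deg: "degree p1 \<ge> 1" "degree p2 \<ge> 1" and V: "assoc_S p1 p2 2 V" and R: "assoc_R p1 p2 1 R"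
    and Z: "assoc_S p1 p2 1 Z"
  shows "R \<circ> V \<circ> R \<circ> V = Z" "Z \<circ> V = V \<circ> Z"
proof -
  from V obtain a e where V: "V = (\<lambda>(x, y). (a * y - e * a, (x + poly p1 y) / a + e))" and a: "a \<noteq> 0"
    and p2': "\<forall>y. poly p2 y = 1 / a * poly p1 (y / a + e)" by (rule assoc_S2_obtain)
  from Z obtain c e1 where Z: "Z = (\<lambda>(x, y). (- x + c, - y + e1))"
    and e1: "odd_at p1 e1" and c: "odd_at p2 c" by (rule assoc_S1_obtain)
  from R obtain c' where R: "R = (\<lambda>(x, y). (- x - poly p1 y + c', y))"
    and "odd_at p2 c'" by (rule assoc_R1_obtain)
  from this(2) have c': "c' = c" by (rule odd_center_unique[OF _ c deg(2)])
  have c_eq: "c = a * (e1 - 2 * e)"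
    by (rule odd_center_unique[OF c half_conj_odd_center[OF a p2' e1] deg(2)])
  show "R \<circ> V \<circ> R \<circ> V = Z"
  proof (rule ext, clarify)
    fix x y
    define v where "v = (x + poly p1 y) / a + e"
    have "(V \<circ> R \<circ> V) (x, y) = (a * v - e * a, (- (a * y - e * a) + c) / a + e)"
      unfolding V R v_def c' by simp
    also have "\<dots> = (x + poly p1 y, - y + e1)" unfolding v_def c_eq using a by (simp add: field_simps)
    finally have w: "(V \<circ> R \<circ> V) (x, y) = (x + poly p1 y, - y + e1)" .
    have "(R \<circ> V \<circ> R \<circ> V) (x, y) = R ((V \<circ> R \<circ> V) (x, y))" by simp
    also have "\<dots> = (- (x + poly p1 y) - poly p1 (- y + e1) + c, - y + e1)"
      unfolding w unfolding R c' by simp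
    also have "\<dots> = Z (x, y)" unfolding Z using e1 by simp
    finally show "(R \<circ> V \<circ> R \<circ> V) (x, y) = Z (x, y)" .
  qed
  show "Z \<circ> V = V \<circ> Z"
  proof (rule ext, clarify)
    fix x y
    have "(V \<circ> Z) (x, y) = (a * (- y + e1) - e * a, (- x + c + poly p1 (- y + e1)) / a + e)"
      unfolding V Z by simp
    also have "\<dots> = (a * (- y + e1) - e * a, (- x + c - poly p1 y) / a + e)" using e1 by simp
    also have "\<dots> = (Z \<circ> V) (x, y)" unfolding V Z c_eq using a by (simp add: field_simps)
    finally show "(Z \<circ> V) (x, y) = (V \<circ> Z) (x, y)" ..
  qed
qed

text \<open>In contrast to S2, the involution S1 enters the square of the map and not its relation
  with R1, so the extension by R1 is untwisted.\<close>

lemma S3_relations: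
  assumes deg: "degree p1 \<ge> 1" "degree p2 \<ge> 1" and V: "assoc_S p1 p2 3 V" and R: "assoc_R p1 p2 1 R"
    and Z: "assoc_S p1 p2 1 Z"
  shows "V \<circ> R \<circ> V = R" "Z \<circ> V = V \<circ> Z" "V \<circ> V = Z \<circ> std_map p1 p2"
proof -
  from V obtain a e k where V: "V = (\<lambda>(x, y). (a * y + k, - ((x + poly p1 y) / a) + e))" and a: "a \<noteq> 0"
    and e': "odd_at p1 (e - k / a)" and p2: "\<forall>y. poly p2 y = - (1 / a) * poly p1 ((y - k) / a)"
    by (rule assoc_S3_obtain)
  from Z obtain c e1 where Z: "Z = (\<lambda>(x, y). (- x + c, - y + e1))"
    and e1: "odd_at p1 e1" and c: "odd_at p2 c" by (rule assoc_S1_obtain)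
  have e1_eq: "e1 = e - k / a" by (rule odd_center_unique[OF e1 e' deg(1)])
  from R obtain c' where R: "R = (\<lambda>(x, y). (- x - poly p1 y + c', y))"
    and "odd_at p2 c'" by (rule assoc_R1_obtain)
  from this(2) have c': "c' = c" by (rule odd_center_unique[OF _ c deg(2)])
  \<comment> \<open>The shift is rewritten as \<open>- k / a\<close>, the form in which the formula
    for the centre applies.\<close>
  have p2': "\<forall>y. poly p2 y = - 1 / a * poly p1 (y / a + - k / a)"
    using p2 by (simp add: diff_divide_distrib)
  have "c = a * (e1 - 2 * (- k / a))"
    by (rule odd_center_unique[OF c half_conj_odd_center[OF a p2' e1] deg(2)])
  also have "\<dots> = e * a + k" unfolding e1_eq using a by (simp add: field_simps)
  finally have c_eq: "c = e * a + k" .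
  show "V \<circ> R \<circ> V = R"
  proof (rule ext, clarify)
    fix x y
    define v where "v = - ((x + poly p1 y) / a) + e"
    have "(V \<circ> R \<circ> V) (x, y) = (a * v + k, - ((- (a * y + k) - poly p1 v + c + poly p1 v) / a) + e)"
      unfolding V R v_def c' by simp
    also have "\<dots> = R (x, y)" unfolding R v_def c' c_eq using a by (simp add: field_simps)
    finally show "(V \<circ> R \<circ> V) (x, y) = R (x, y)" .
  qed
  show "Z \<circ> V = V \<circ> Z"
  proof (rule ext, clarify)
    fix x y
    have "(V \<circ> Z) (x, y) = (a * (- y + e1) + k, - ((- x + c + poly p1 (- y + e1)) / a) + e)"
      unfolding V Z by simp
    also have "\<dots> = (a * (- y + e1) + k, - ((- x + c - poly p1 y) / a) + e)" using e1 by simp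
    also have "\<dots> = (Z \<circ> V) (x, y)" unfolding V Z c_eq e1_eq using a by (simp add: field_simps)
    finally show "(Z \<circ> V) (x, y) = (V \<circ> Z) (x, y)" ..
  qed
  show "V \<circ> V = Z \<circ> std_map p1 p2"
  proof (rule ext, clarify)
    fix x y
    define X where "X = x + poly p1 y"
    have "- (X / a) + e = - ((X - k) / a) + (e - k / a)" by (simp add: diff_divide_distrib)
    then have "poly p1 (- (X / a) + e) = - poly p1 ((X - k) / a)" using e' by (simp only:)
    then have p: "poly p1 (- (X / a) + e) = a * poly p2 X" using p2 a by simp
    have "(V \<circ> V) (x, y) = (a * (- (X / a) + e) + k, - ((a * y + k + poly p1 (- (X / a) + e)) / a) + e)"
      unfolding V X_def by simp
    also have "\<dots> = (- X + c, - (y + poly p2 X) + e1)"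
      unfolding p c_eq e1_eq using a by (simp add: field_simps)
    also have "\<dots> = (Z \<circ> std_map p1 p2) (x, y)" unfolding Z std_map_def X_def by (simp add: Let_def)
    finally show "(V \<circ> V) (x, y) = (Z \<circ> std_map p1 p2) (x, y)" .
  qed
qed

lemma R1_S1_commute:
  assumes deg: "degree p2 \<ge> 1" and R: "assoc_R p1 p2 1 R" and Z: "assoc_S p1 p2 1 Z"
  shows "R \<circ> Z = Z \<circ> R"
proof -
  from Z obtain c e1 where Z: "Z = (\<lambda>(x, y). (- x + c, - y + e1))"
    and e1: "odd_at p1 e1" and c: "odd_at p2 c" by (rule assoc_S1_obtain)
  from R obtain c' where R: "R = (\<lambda>(x, y). (- x - poly p1 y + c', y))"
    and "odd_at p2 c'" by (rule assoc_R1_obtain)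
  from this(2) have c': "c' = c" by (rule odd_center_unique[OF _ c deg])
  show ?thesis
  proof (rule ext, clarify)
    fix x y
    have "(R \<circ> Z) (x, y) = (- (- x + c) - poly p1 (- y + e1) + c, - y + e1)" unfolding R Z c' by simp
    also have "\<dots> = (Z \<circ> R) (x, y)" using e1 unfolding R Z c' by simp
    finally show "(R \<circ> Z) (x, y) = (Z \<circ> R) (x, y)" .
  qed
qed

section \<open>Symmetry groups when both degrees are at least two\<close>

context nonlinear begin

abbreviation "L \<equiv> std_map p1 p2"

lemma inf_order_L: "inf_order PolyAut L"
proof unfold_locales
  fix n :: int assume "L [^]\<^bsub>PolyAut\<^esub> n = \<one>\<^bsub>PolyAut\<^esub>"
  then show "n = 0" using pos.henon2_infinite_order[OF deg] unfolding std_map_eq_henon2 by simp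
qed auto

lemma deg1: "degree p1 \<ge> 1" "degree p2 \<ge> 1" using deg by auto

text \<open>By the normal form of symmetries only the maps S1, S2 and S3 have to be located; the
  powers of \<open>L\<close> are absorbed by \<open>K\<close>.\<close>

lemma symmetries_eqI:
  assumes K: "subgroup K PolyAut" "K \<subseteq> symmetries L" "L \<in> K"
    and V: "\<And>i V. i \<in> {1, 2, 3} \<Longrightarrow> assoc_S p1 p2 i V \<Longrightarrow> V \<in> K"
  shows "symmetries L = K"
proof
  show "symmetries L \<subseteq> K"
  proof
    fix S assume "S \<in> symmetries L"
    then show "S \<in> K"
    proof (rule std_symmetry_form[OF deg])
      fix m assume "S = ipow L m"
      then show ?thesis using PA.subgroup_int_pow_closed[OF K(1,3)] by simp
    next
      fix m i W assume "i \<in> {1, 2, 3}" "assoc_S p1 p2 i W" "S = W \<circ> ipow L m"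
      then show ?thesis using V PA.subgroup_int_pow_closed[OF K(1,3)] comp_in_subgroup[OF K(1)] by blast
    qed
  qed
qed fact

lemma sym_sub: "subgroup (symmetries L) PolyAut"
  by (rule symmetries_subgroup) auto

lemma L_sym: "L \<in> symmetries L"
  by (rule self_in_symmetries) auto

lemma reversing_eq_symmetries:
  assumes "\<forall>i\<in>{1, 2, 3, 4, 5}. \<not> holds_R p1 p2 i"
  shows "reversing_symmetries L = symmetries L"
proof -
  have "R \<notin> reversors L" for R
    using std_reversor_form[OF deg, of R] assms unfolding holds_R_def by blast
  then show ?thesis by (subst reversing_symmetries_eq) auto
qed

lemma reversing_coset:
  assumes "assoc_R p1 p2 i R" "i \<noteq> 5"
  shows "reversing_symmetries L = symmetries L <#>\<^bsub>PolyAut\<^esub> cyc R"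
  by (rule reversing_symmetries_coset[OF _ assoc_R_reversor[OF assms(1)] assoc_R_involution(1)[OF assms]]) auto

lemma reflection_locale:
  assumes "inf_order PolyAut f" "f \<in> carrier PolyAut" "R \<circ> R = id" "R \<in> reversors f"
  shows "inf_order_reflection PolyAut f R"
proof -
  interpret inf_order PolyAut f by fact
  show ?thesis
    using assms reversor_comp[OF assms(2,4)] PolyAut_inv[OF assms(2)]
    by unfold_locales (auto simp: reversors_def)
qed

lemma central_locale:
  assumes "inf_order PolyAut f" "assoc_S p1 p2 1 Z" "Z \<circ> f = f \<circ> Z"
  shows "inf_order_central PolyAut f Z"
proof -
  interpret inf_order PolyAut f by fact
  show ?thesis using assoc_S1_facts[OF assms(2)] assms(3) by unfold_locales auto
qed

lemma symmetries_no_S: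
  assumes "\<forall>i\<in>{1, 2, 3}. \<not> holds_S p1 p2 i"
  shows "symmetries L = cyc L"
proof (rule symmetries_eqI)
  show "cyc L \<subseteq> symmetries L" by (rule cyc_subset[OF sym_sub L_sym])
  fix i V assume "i \<in> {1, 2, 3}" "assoc_S p1 p2 i V"
  then show "V \<in> cyc L" using assms unfolding holds_S_def by blast
qed (auto intro: subgroup_cyc in_cyc)

lemma assoc_S_PolyAut: "assoc_S p1 p2 i V \<Longrightarrow> V \<in> carrier PolyAut"
  using assoc_S_symmetry by (auto simp: symmetries_iff)

text \<open>Two maps for S2 differ at most by S1, so in the absence of S1 there is just one, and
  \<open>L\<close> is its square.\<close>

lemma symmetries_S2:
  assumes V: "assoc_S p1 p2 2 V" and no: "\<not> holds_S p1 p2 1" "\<not> holds_S p1 p2 3"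
  shows "symmetries L = cyc V" "inf_order PolyAut V"
proof -
  have V_in: "V \<in> carrier PolyAut" using assoc_S_PolyAut V .
  show "symmetries L = cyc V"
  proof (rule symmetries_eqI)
    show sub: "subgroup (cyc V) PolyAut" by (rule subgroup_cyc[OF V_in])
    show "cyc V \<subseteq> symmetries L" by (rule cyc_subset[OF sym_sub assoc_S_symmetry[OF V]])
    show "L \<in> cyc V" using comp_in_subgroup[OF sub in_cyc in_cyc] assoc_S2_sq[OF V] by simp
    fix i W assume i: "i \<in> {1, 2, 3::nat}" and W: "assoc_S p1 p2 i W"
    then have "i = 2" using no unfolding holds_S_def by blast
    then have W: "assoc_S p1 p2 2 W" using W by simp
    have "W = V"
    proof (cases rule: assoc_S_half_unique[OF deg V W])
      case (3 Z)
      then show ?thesis using no unfolding holds_S_def by blast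
    qed auto
    then show "W \<in> cyc V" using in_cyc by simp
  qed
  show "inf_order PolyAut V"
    by (rule ipow_root_infinite_order[OF inf_order_L V_in, of 2 1])
       (simp_all add: ipow_2[OF V_in] assoc_S2_sq[OF V])
qed

lemma symmetries_S1:
  assumes Z: "assoc_S p1 p2 1 Z" and no: "\<not> holds_S p1 p2 2" "\<not> holds_S p1 p2 3"
  shows "symmetries L = cyc L <#>\<^bsub>PolyAut\<^esub> cyc Z" "inf_order_central PolyAut L Z"
proof -
  show c: "inf_order_central PolyAut L Z"
    by (rule central_locale[OF inf_order_L Z assoc_S1_facts(4)[OF Z]])
  interpret inf_order_central PolyAut L Z by fact
  show "symmetries L = cyc L <#>\<^bsub>PolyAut\<^esub> cyc Z"
  proof (rule symmetries_eqI[OF abelian_subgroup])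
    show "cyc L <#>\<^bsub>PolyAut\<^esub> cyc Z \<subseteq> symmetries L"
      by (intro set_mult_subset[OF sym_sub] cyc_subset[OF sym_sub] L_sym assoc_S_symmetry[OF Z])
    show "L \<in> cyc L <#>\<^bsub>PolyAut\<^esub> cyc Z" by (rule in_set_mult_left[OF central_subgroup in_cyc]) auto
    fix i W assume i: "i \<in> {1, 2, 3::nat}" and W: "assoc_S p1 p2 i W"
    then have "i = 1" using no unfolding holds_S_def by blast
    then have "W = Z" using assoc_S1_unique[OF deg1 Z] W by simp
    then show "W \<in> cyc L <#>\<^bsub>PolyAut\<^esub> cyc Z"
      using in_set_mult_right[OF cyclic_subgroup in_cyc] s by blast
  qed
qed

text \<open>One argument for S2 and S3 in the presence of S1, with \<open>5 - i\<close> the index of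
  the other condition. In both cases the fourth power of \<open>V\<close> is the square of
  \<open>L\<close>, since S1 is an involution commuting with \<open>L\<close>.\<close>

lemma symmetries_half_S1:
  assumes V: "assoc_S p1 p2 i V" and i: "i \<in> {2, 3}" and Z: "assoc_S p1 p2 1 Z"
    and no: "\<not> holds_S p1 p2 (5 - i)"
    and ZV: "Z \<circ> V = V \<circ> Z" and sq: "V \<circ> V = L \<or> V \<circ> V = Z \<circ> L"
  shows "symmetries L = cyc V <#>\<^bsub>PolyAut\<^esub> cyc Z" "inf_order_central PolyAut V Z"
proof -
  note Zf = assoc_S1_facts[OF Z]
  have V_in: "V \<in> carrier PolyAut" using assoc_S_PolyAut V .
  have VV: "ipow V 2 = V \<circ> V" by (rule ipow_2[OF V_in])
  have "ipow V 4 = ipow L 2"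
  proof -
    have "ipow V 4 = (V \<circ> V) \<circ> (V \<circ> V)" using ipow_add[OF V_in, of 2 2] VV by simp
    also have "\<dots> = L \<circ> L"
      using sq
    proof
      assume *: "V \<circ> V = Z \<circ> L"
      have "(Z \<circ> L) \<circ> (Z \<circ> L) = Z \<circ> (L \<circ> Z) \<circ> L" by (simp add: comp_assoc)
      also have "\<dots> = (Z \<circ> Z) \<circ> (L \<circ> L)" unfolding Zf(4)[symmetric] by (simp add: comp_assoc)
      finally show ?thesis unfolding * Zf(2) by simp
    qed simp
    finally show ?thesis by (simp add: ipow_2)
  qed
  then have inf: "inf_order PolyAut V"
    by (rule ipow_root_infinite_order[OF inf_order_L V_in]) simp
  show c: "inf_order_central PolyAut V Z" by (rule central_locale[OF inf Z ZV])
  interpret inf_order_central PolyAut V Z by fact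
  show "symmetries L = cyc V <#>\<^bsub>PolyAut\<^esub> cyc Z"
  proof (rule symmetries_eqI[OF abelian_subgroup])
    show "cyc V <#>\<^bsub>PolyAut\<^esub> cyc Z \<subseteq> symmetries L"
      by (intro set_mult_subset[OF sym_sub] cyc_subset[OF sym_sub] assoc_S_symmetry[OF V] assoc_S_symmetry[OF Z])
    have V_K: "V \<in> cyc V <#>\<^bsub>PolyAut\<^esub> cyc Z" by (rule in_set_mult_left[OF central_subgroup in_cyc]) auto
    have Z_K: "Z \<in> cyc V <#>\<^bsub>PolyAut\<^esub> cyc Z" by (rule in_set_mult_right[OF cyclic_subgroup in_cyc]) auto
    note K = comp_in_subgroup[OF abelian_subgroup]
    have "L = V \<circ> V \<or> L = Z \<circ> (V \<circ> V)"
      using sq Zf(2) by (metis comp_assoc id_comp)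
    then show "L \<in> cyc V <#>\<^bsub>PolyAut\<^esub> cyc Z" using K[OF V_K V_K] K[OF Z_K K[OF V_K V_K]] by (elim disjE) simp_all
    fix j W assume j: "j \<in> {1, 2, 3::nat}" and W: "assoc_S p1 p2 j W"
    consider "j = 1" | "j = i" using i j W no unfolding holds_S_def by auto
    then show "W \<in> cyc V <#>\<^bsub>PolyAut\<^esub> cyc Z"
    proof cases
      case 1
      then show ?thesis using assoc_S1_unique[OF deg1 Z] W Z_K by simp
    next
      case 2
      then have W: "assoc_S p1 p2 i W" using W by simp
      show ?thesis
      proof (cases rule: assoc_S_half_unique[OF deg V W i])
        case 1
        then show ?thesis using V_K by simp
      next
        case (2 Z')
        then show ?thesis using assoc_S1_unique[OF deg1 Z] K[OF Z_K V_K] by simp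
      qed
    qed
  qed
qed

end

text \<open>The coset description of the reversing symmetry group puts the reflection last, whereas
  the direct product has the central factor last.\<close>

lemma (in inf_order_reflection_central) dihedral_central_swap:
  "(generate G {a} <#> generate G {s}) <#> generate G {r} = (generate G {a} <#> generate G {r}) <#> generate G {s}"
proof -
  have c: "generate G {x} \<subseteq> carrier G" if "x \<in> carrier G" for x
    using that by (intro generate_incl) simp
  have "generate G {s} <#> generate G {r} = generate G {r} <#> generate G {s}"
    unfolding generate_involution[OF s s2] generate_involution[OF r r2] set_mult_def
    using rs by auto
  then show ?thesis using c by (simp add: set_mult_assoc)
qed

section \<open>One linear polynomial\<close>

text \<open>If one of the polynomials is linear, eliminating one coordinate turns the map into the Henon
  map \<open>(u, v) \<mapsto> (v, - u + 2 v + A q(v))\<close>, which is itself a square root of a map to which the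
  rigidity theorem applies.\<close>

lemma henon_affine_commute:
  fixes q :: "real poly"
  assumes q: "degree q \<ge> 2" and A: "A \<noteq> 0" and T: "T \<in> carrier PolyAut"
    and d1: "dgx T = 1" "dgy T = 1"
    and comm: "T \<circ> henon (- 1) ([:0, 2:] + smult A q) = henon (- 1) ([:0, 2:] + smult A q) \<circ> T"
  obtains "T = id" | e where "odd_at q e" "T = diag_map (- 1) e (- 1) e"
proof -
  let ?P = "[:0, 2:] + smult A q"
  have degP: "degree ?P = degree q" using q A by (subst degree_add_eq_right) auto
  obtain \<alpha> \<beta> \<gamma> where f: "\<And>x y. fst (T (x, y)) = \<alpha> * x + \<beta> * y + \<gamma>"
    using dg_le_1_imp_affine[OF PolyAut_rpf(1)[OF T]] d1 by (metis order_refl)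
  obtain \<delta> \<epsilon> \<zeta> where g: "\<And>x y. snd (T (x, y)) = \<delta> * x + \<epsilon> * y + \<zeta>"
    using dg_le_1_imp_affine[OF PolyAut_rpf(2)[OF T]] d1 by (metis order_refl)
  have eq: "T (v, - u + poly ?P v) = (snd (T (u, v)), - fst (T (u, v)) + poly ?P (snd (T (u, v))))" for u v
    using fun_cong[OF comm, of "(u, v)"] by (simp add: henon_def split_beta)
  have 1: "\<alpha> * v + \<beta> * (- u + poly ?P v) + \<gamma> = \<delta> * u + \<epsilon> * v + \<zeta>" for u v
    using arg_cong[OF eq[of v u], of fst] by (simp only: f g fst_conv)
  have \<beta>: "\<beta> = 0"
  proof (rule ccontr)
    assume "\<beta> \<noteq> 0"
    have "poly (smult \<beta> ?P) v = poly [:\<zeta> - \<gamma>, \<epsilon> - \<alpha>:] v" for v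
      using 1[of v 0] by (simp add: algebra_simps)
    then have "poly (smult \<beta> ?P) = poly [:\<zeta> - \<gamma>, \<epsilon> - \<alpha>:]" by blast
    then have "smult \<beta> ?P = [:\<zeta> - \<gamma>, \<epsilon> - \<alpha>:]" by (simp only: poly_eq_poly_eq_iff)
    then have "degree (smult \<beta> ?P) \<le> 1" by simp
    then show False using \<open>\<beta> \<noteq> 0\<close> degP q by simp
  qed
  have g': "snd (T (u, v)) = \<alpha> * v + \<gamma>" for u v
    using 1[of v u] g \<beta> by simp
  have f': "fst (T (u, v)) = \<alpha> * u + \<gamma>" for u v using f \<beta> by simp
  have 2: "\<alpha> * (- u + poly ?P v) + \<gamma> = - (\<alpha> * u + \<gamma>) + poly ?P (\<alpha> * v + \<gamma>)" for u v
    using arg_cong[OF eq[of v u], of snd] by (simp only: f' g' snd_conv)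
  \<comment> \<open>The coefficients 2 and -1 of the linear part add up to 1, so the constants and
    linear terms cancel and only an equation for \<open>q\<close> is left.\<close>
  have self: "\<alpha> * poly q v = poly q (\<alpha> * v + \<gamma>)" for v
    using 2[of 0 v] A by (simp add: algebra_simps)
  have T_eq: "T = diag_map \<alpha> \<gamma> \<alpha> \<gamma>"
    using f' g' by (auto simp: fun_eq_iff diag_map_def prod_eq_iff)
  have \<alpha>: "\<alpha> \<noteq> 0"
  proof
    assume "\<alpha> = 0"
    then have "T (0, 0) = T (1, 0)" unfolding T_eq by (simp add: diag_map_def)
    from injD[OF bij_is_inj[OF PolyAut_bij[OF T]] this] show False by simp
  qed
  have "q \<noteq> 0" using q by auto
  have "\<alpha> = \<alpha> ^ degree q" by (rule poly_self_scale[OF self \<alpha>]) fact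
  then consider "\<alpha> = 1" | "\<alpha> = - 1" using real_power_eq_self \<alpha> q by blast
  then show ?thesis
  proof cases
    case one: 1
    then have "\<gamma> = 0" using poly_translate_eq[of q \<gamma>] self q by simp
    then show ?thesis using that(1) one T_eq by (auto simp: diag_map_def)
  next
    case minus: 2
    have "poly q (- y + \<gamma>) = - poly q y" for y using self[of y] minus by simp
    then show ?thesis using that(2)[of \<gamma>] T_eq minus by blast
  qed
qed

abbreviation dihedral_times_C2 :: "plane_map \<Rightarrow> plane_map \<Rightarrow> plane_map \<Rightarrow> plane_map \<Rightarrow> bool" where
  "dihedral_times_C2 L f R Z \<equiv>
     internal_direct PolyAut (cyc f) (cyc Z) (symmetries L) \<and>
     as_group (symmetries L) \<cong> C_inf \<times>\<times> C2 \<and>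
     internal_semidirect PolyAut (cyc f) (cyc R) (cyc f <#>\<^bsub>PolyAut\<^esub> cyc R) \<and>
     internal_direct PolyAut (cyc f <#>\<^bsub>PolyAut\<^esub> cyc R) (cyc Z) (reversing_symmetries L) \<and>
     as_group (reversing_symmetries L) \<cong> D_inf \<times>\<times> C2"

text \<open>\<open>C\<close> records two successive values of the coordinate to which
  \<open>q\<close> is applied, and \<open>W e\<close> is the point reflection commuting with the
  Henon map, carried back to \<open>L\<close>. Both choices of the linear polynomial are
  instances.\<close>

locale linear_case =
  fixes q :: "real poly" and A :: real and C L R :: plane_map and W :: "real \<Rightarrow> plane_map"
  assumes q: "degree q \<ge> 2" and A: "A \<noteq> 0"
    and C: "C \<in> carrier PolyAut" and L: "L \<in> carrier PolyAut"
    and conj: "C \<circ> L = henon (- 1) ([:0, 2:] + smult A q) \<circ> C"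
    and R: "R \<in> reversors L" and R2: "R \<circ> R = id"
    and W: "odd_at q e \<Longrightarrow> W e \<in> carrier PolyAut \<and> C \<circ> W e = diag_map (- 1) e (- 1) e \<circ> C \<and>
      W e \<circ> W e = id \<and> W e \<noteq> id \<and> W e \<circ> L = L \<circ> W e \<and> R \<circ> W e = W e \<circ> R"
begin

abbreviation "H \<equiv> henon (- 1) ([:0, 2:] + smult A q)"

lemma degP: "degree ([:0, 2:] + smult A q) \<ge> 2"
  using q A by (subst degree_add_eq_right) auto

lemma H2: "henon2 (- 1) ([:0, 2:] + smult A q) ([:0, 2:] + smult A q) = ipow H 2"
  by (simp add: ipow_2 henon2_def)

lemma ipow_H2: "ipow (henon2 (- 1) ([:0, 2:] + smult A q) ([:0, 2:] + smult A q)) m = ipow H (2 * m)"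
  unfolding H2 by (simp add: PA.int_pow_pow)

lemma C_ipow: "C \<circ> ipow L m = ipow H m \<circ> C"
  by (rule intertwine_ipow[OF C L _ conj]) auto

lemma C_cancel: "C \<circ> f = C \<circ> g \<Longrightarrow> f = g"
  using bij_is_inj[OF PolyAut_bij[OF C]] by (metis fun.inj_map_strong inj_eq comp_apply ext)

lemma inf_order_L: "inf_order PolyAut L"
proof unfold_locales
  fix n :: int assume "L [^]\<^bsub>PolyAut\<^esub> n = \<one>\<^bsub>PolyAut\<^esub>"
  then have "ipow L n = id" by simp
  then have "ipow H n \<circ> (C \<circ> inv_into UNIV C) = C \<circ> inv_into UNIV C"
    using C_ipow[of n] by (simp add: comp_assoc[symmetric])
  then have "ipow H n = id" unfolding PolyAut_inv_comp(2)[OF C] by simp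
  then have "ipow H (2 * n) = id" using ipow_add[of H n n] by simp
  then show "n = 0" using neg.henon2_infinite_order[OF degP degP] unfolding ipow_H2 by blast
qed (rule L)

lemma symmetry_form:
  assumes "S \<in> symmetries L"
  obtains m where "S = ipow L m" | m e where "odd_at q e" "S = ipow L m \<circ> W e"
proof -
  have S: "S \<in> carrier PolyAut" "S \<circ> L = L \<circ> S" using assms by (auto simp: symmetries_iff)
  let ?D = "inv_into UNIV C" and ?P = "[:0, 2:] + smult A q"
  define S' where "S' = C \<circ> S \<circ> ?D"
  have D: "?D \<in> carrier PolyAut" using PA.inv_closed[OF C] PolyAut_inv[OF C] by simp
  have CD: "?D \<circ> C = id" "C \<circ> ?D = id" by (rule PolyAut_inv_comp[OF C])+
  have S'_in: "S' \<in> carrier PolyAut" unfolding S'_def by (intro PolyAut_comp C S D)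
  have DH: "?D \<circ> H = L \<circ> ?D"
  proof -
    have "?D \<circ> H = ?D \<circ> (H \<circ> C) \<circ> ?D" using CD by (simp add: comp_assoc)
    also have "\<dots> = (?D \<circ> C) \<circ> L \<circ> ?D" unfolding conj[symmetric] by (simp add: comp_assoc)
    finally show ?thesis using CD by simp
  qed
  have S'_H: "S' \<circ> H = H \<circ> S'"
  proof -
    have "S' \<circ> H = C \<circ> S \<circ> (?D \<circ> H)" by (simp add: S'_def comp_assoc)
    also have "\<dots> = C \<circ> (S \<circ> L) \<circ> ?D" unfolding DH by (simp add: comp_assoc)
    also have "\<dots> = (C \<circ> L) \<circ> S \<circ> ?D" unfolding S(2) by (simp add: comp_assoc)
    also have "\<dots> = H \<circ> S'" unfolding conj by (simp add: S'_def comp_assoc)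
    finally show ?thesis .
  qed
  \<comment> \<open>The rigidity theorem is about two-step maps. Here both steps equal
    \<open>H\<close>, so each window, even or odd, is a power of \<open>H\<close> after
    \<open>S'\<close> and commutes with \<open>H\<close> itself.\<close>
  have conj2: "S' \<circ> henon2 (- 1) ?P ?P = henon2 (- 1) ?P ?P \<circ> S'"
    unfolding henon2_def by (simp only: S'_H comp_assoc flip: comp_assoc[of S'])
  obtain a b T where reach: "neg.reach ?P ?P S' a b T"
    and d1: "dgx T = 1" "dgy T = 1"
    using neg.reach_affine[OF S'_in conj2 degP degP degP degP refl] .
  then obtain m where "T = ipow H (2 * m) \<circ> S' \<or> T = H \<circ> (ipow H (2 * m) \<circ> S')"
    unfolding neg.reach_def ipow_H2 by blast
  moreover have "H \<circ> (ipow H (2 * m) \<circ> S') = ipow H (1 + 2 * m) \<circ> S'"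
    using ipow_add[of H 1 "2 * m"] by (simp add: comp_assoc)
  ultimately obtain n where T: "T = ipow H n \<circ> S'" by auto
  have T_in: "T \<in> carrier PolyAut" unfolding T by (intro PolyAut_comp S'_in PA.int_pow_closed) auto
  have T_H: "T \<circ> H = H \<circ> T"
  proof -
    have "ipow H n \<circ> H = H \<circ> ipow H n" using ipow_add[of H n 1] ipow_add[of H 1 n] by (simp add: add.commute)
    moreover have "T \<circ> H = ipow H n \<circ> H \<circ> S'" unfolding T by (simp add: comp_assoc S'_H)
    ultimately show ?thesis unfolding T by (simp add: comp_assoc)
  qed
  have TC: "T \<circ> C = C \<circ> (ipow L n \<circ> S)"
  proof -
    have "T \<circ> C = ipow H n \<circ> C \<circ> S \<circ> (?D \<circ> C)" unfolding T S'_def by (simp add: comp_assoc)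
    then show ?thesis unfolding C_ipow[symmetric] CD by (simp add: comp_assoc)
  qed
  have S_back: "S = ipow L (- n) \<circ> (ipow L n \<circ> S)"
    using ipow_add[OF L, of "- n" n] by (simp add: comp_assoc[symmetric])
  show ?thesis
  proof (cases rule: henon_affine_commute[OF q A T_in d1 T_H])
    case 1
    then have "ipow L n \<circ> S = id" using TC C_cancel[of "ipow L n \<circ> S" id] by simp
    then show ?thesis using S_back that(1)[of "- n"] by simp
  next
    case (2 e)
    then have "C \<circ> (ipow L n \<circ> S) = C \<circ> W e" using TC W by simp
    then have "ipow L n \<circ> S = W e" by (rule C_cancel)
    then show ?thesis using S_back that(2)[of e "- n"] 2 by simp
  qed
qed

lemma sym_sub: "subgroup (symmetries L) PolyAut" by (rule symmetries_subgroup[OF L])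

lemma reflection: "inf_order_reflection PolyAut L R"
proof -
  interpret inf_order PolyAut L by (rule inf_order_L)
  show ?thesis
    using R R2 reversor_comp[OF L R] PolyAut_inv[OF L]
    by unfold_locales (auto simp: reversors_def)
qed

lemma not_odd_case:
  assumes "\<nexists>e. odd_at q e"
  shows "symmetries L = cyc L \<and> as_group (symmetries L) \<cong> C_inf \<and>
    internal_semidirect PolyAut (cyc L) (cyc R) (reversing_symmetries L) \<and>
    as_group (reversing_symmetries L) \<cong> D_inf"
proof -
  interpret inf_order_reflection PolyAut L R by (rule reflection)
  have "symmetries L \<subseteq> cyc L"
  proof
    fix S assume "S \<in> symmetries L"
    then show "S \<in> cyc L"
    proof (rule symmetry_form)
      fix m assume "S = ipow L m"
      then show ?thesis using PA.generate_pow[OF L] by blast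
    qed (use assms in blast)
  qed
  moreover have "cyc L \<subseteq> symmetries L" by (rule cyc_subset[OF sym_sub self_in_symmetries[OF L]])
  ultimately have sym: "symmetries L = cyc L" by blast
  have rev: "reversing_symmetries L = cyc L <#>\<^bsub>PolyAut\<^esub> cyc R"
    using reversing_symmetries_coset[OF L R R2] sym by simp
  show ?thesis unfolding rev unfolding sym
    using cyclic_iso dihedral_semidirect dihedral_iso by blast
qed

lemma odd_case:
  assumes e: "odd_at q e"
  shows "dihedral_times_C2 L L R (W e)"
proof -
  interpret inf_order_reflection PolyAut L R by (rule reflection)
  interpret inf_order_reflection_central PolyAut L R "W e"
    using W[OF e] by unfold_locales auto
  have Wsym: "W e \<in> symmetries L" using W[OF e] by (simp add: symmetries_iff)
  have "symmetries L \<subseteq> cyc L <#>\<^bsub>PolyAut\<^esub> cyc (W e)"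
  proof
    fix S assume "S \<in> symmetries L"
    then show "S \<in> cyc L <#>\<^bsub>PolyAut\<^esub> cyc (W e)"
    proof (rule symmetry_form)
      fix m assume "S = ipow L m"
      moreover have "ipow L m \<in> cyc L" using PA.generate_pow[OF L] by blast
      ultimately show ?thesis using in_set_mult_left[OF central_subgroup] PA.int_pow_closed[OF L] by blast
    next
      fix m e' assume e': "odd_at q e'" and "S = ipow L m \<circ> W e'"
      moreover have "e' = e" using odd_center_unique[OF e' e] q by simp
      moreover have "ipow L m \<in> cyc L" using PA.generate_pow[OF L] by blast
      ultimately show ?thesis using in_cyc[of "W e"] unfolding set_mult_def by auto
    qed
  qed
  moreover have "cyc L <#>\<^bsub>PolyAut\<^esub> cyc (W e) \<subseteq> symmetries L"
    by (intro set_mult_subset[OF sym_sub] cyc_subset[OF sym_sub] self_in_symmetries[OF L] Wsym)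
  ultimately have sym: "symmetries L = cyc L <#>\<^bsub>PolyAut\<^esub> cyc (W e)" by blast
  have rev: "reversing_symmetries L = (cyc L <#>\<^bsub>PolyAut\<^esub> cyc R) <#>\<^bsub>PolyAut\<^esub> cyc (W e)"
    using reversing_symmetries_coset[OF L R R2] sym dihedral_central_swap by simp
  show ?thesis unfolding rev unfolding sym
    using central_direct central_iso dihedral_semidirect dihedral_central_direct dihedral_central_iso by blast
qed

end

text \<open>With \<open>x' = x + A * y + B\<close> the pair \<open>(x, x')\<close> determines
  \<open>y\<close>, and the next value is \<open>- x + 2 * x' + A * poly p2 x'\<close>.\<close>

lemma linear_case_p1:
  assumes "A \<noteq> 0" "degree p2 \<ge> 2"
  shows "linear_case p2 A (\<lambda>(x, y). (x, x + A * y + B)) (std_map [:B, A:] p2)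
    (\<lambda>(x, y). (x, - y + poly p2 x - 2 * B / A)) (\<lambda>e (x, y). (- x + e, - y - 2 * B / A))"
proof unfold_locales
  let ?C = "\<lambda>(x, y). (x, x + A * y + B)" and ?L = "std_map [:B, A:] p2"
    and ?R = "\<lambda>(x, y). (x, - y + poly p2 x - 2 * B / A)"
    and ?W = "\<lambda>e (x, y). (- x + e, - y - 2 * B / A)"
  show "?C \<in> carrier PolyAut"
    by (rule in_PolyAutI(1)[where g = "\<lambda>(u, v). (u, (v - u - B) / A)"])
       (use assms in \<open>auto simp: fun_eq_iff split_beta intro!: rpf_intros\<close>)
  show "?C \<circ> ?L = henon (- 1) ([:0, 2:] + smult A p2) \<circ> ?C"
    by (auto simp: fun_eq_iff std_map_def henon_def Let_def algebra_simps)
  show RR: "?R \<circ> ?R = id" by auto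
  have "?R \<in> carrier PolyAut"
    by (rule involution_PolyAut[OF RR]) (auto simp: split_beta intro!: rpf_intros)
  moreover have "?L \<circ> ?R \<circ> ?L = ?R"
    using assms by (auto simp: fun_eq_iff std_map_def Let_def field_simps)
  ultimately show "?R \<in> reversors ?L" by (simp add: reversors_def)
  fix e assume e: "odd_at p2 e"
  have WW: "?W e \<circ> ?W e = id" by auto
  have "?W e \<in> carrier PolyAut"
    by (rule involution_PolyAut[OF WW]) (auto simp: split_beta intro!: rpf_intros)
  moreover have "?C \<circ> ?W e = diag_map (- 1) e (- 1) e \<circ> ?C"
    using assms by (auto simp: fun_eq_iff diag_map_def field_simps)
  moreover have "?W e \<noteq> id"
  proof
    assume "?W e = id"
    then have "?W e (0, 0) = (0, 0)" "?W e (1, 0) = (1, 0)" by (metis id_apply)+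
    then show False by simp
  qed
  moreover have "?W e \<circ> ?L = ?L \<circ> ?W e"
  proof (rule ext, clarify)
    fix x y
    define X where "X = x + (B + A * y)"
    have X': "- x + e + (B + A * (- y - 2 * B / A)) = - X + e" unfolding X_def using assms by (simp add: field_simps)
    have "(?L \<circ> ?W e) (x, y) = (- X + e, - y - 2 * B / A + poly p2 (- X + e))"
      unfolding X'[symmetric] by (simp add: std_map_def Let_def algebra_simps)
    also have "\<dots> = (- X + e, - y - 2 * B / A - poly p2 X)" using e by simp
    also have "\<dots> = (?W e \<circ> ?L) (x, y)" unfolding X_def by (simp add: std_map_def Let_def algebra_simps)
    finally show "(?W e \<circ> ?L) (x, y) = (?L \<circ> ?W e) (x, y)" ..
  qed
  moreover have "?R \<circ> ?W e = ?W e \<circ> ?R"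
  proof (rule ext, clarify)
    fix x y
    have "(?R \<circ> ?W e) (x, y) = (- x + e, y + 2 * B / A + poly p2 (- x + e) - 2 * B / A)" by simp
    also have "\<dots> = (?W e \<circ> ?R) (x, y)" using e by simp
    finally show "(?R \<circ> ?W e) (x, y) = (?W e \<circ> ?R) (x, y)" .
  qed
  ultimately show "?W e \<in> carrier PolyAut \<and> ?C \<circ> ?W e = diag_map (- 1) e (- 1) e \<circ> ?C \<and>
      ?W e \<circ> ?W e = id \<and> ?W e \<noteq> id \<and> ?W e \<circ> ?L = ?L \<circ> ?W e \<and> ?R \<circ> ?W e = ?W e \<circ> ?R"
    using WW by blast
qed (use assms in auto)

text \<open>Successive second coordinates \<open>(y, y')\<close> are used here; the first coordinate
  is recovered as \<open>(y' - y - B) / A - poly p1 y\<close>.\<close>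

lemma linear_case_p2:
  assumes "A \<noteq> 0" "degree p1 \<ge> 2"
  shows "linear_case p1 A (\<lambda>(x, y). (y, y + A * (x + poly p1 y) + B)) (std_map p1 [:B, A:])
    (\<lambda>(x, y). (- x - poly p1 y - 2 * B / A, y)) (\<lambda>e (x, y). (- x - 2 * B / A, - y + e))"
proof unfold_locales
  let ?C = "\<lambda>(x, y). (y, y + A * (x + poly p1 y) + B)" and ?L = "std_map p1 [:B, A:]"
    and ?R = "\<lambda>(x, y). (- x - poly p1 y - 2 * B / A, y)"
    and ?W = "\<lambda>e (x, y). (- x - 2 * B / A, - y + e)"
  show "?C \<in> carrier PolyAut"
    by (rule in_PolyAutI(1)[where g = "\<lambda>(u, v). ((v - u - B) / A - poly p1 u, u)"])
       (use assms in \<open>auto simp: fun_eq_iff split_beta intro!: rpf_intros\<close>)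
  show "?C \<circ> ?L = henon (- 1) ([:0, 2:] + smult A p1) \<circ> ?C"
    by (auto simp: fun_eq_iff std_map_def henon_def Let_def algebra_simps)
  show RR: "?R \<circ> ?R = id" by auto
  have "?R \<in> carrier PolyAut"
    by (rule involution_PolyAut[OF RR]) (auto simp: split_beta intro!: rpf_intros)
  moreover have "?L \<circ> ?R \<circ> ?L = ?R"
  proof (rule ext)
    fix z :: "real \<times> real"
    obtain x y where z: "z = (x, y)" by (cases z)
    define X where "X = x + poly p1 y"
    define Y where "Y = y + (B + A * X)"
    have "(?L \<circ> ?R \<circ> ?L) (x, y) = (- X - 2 * B / A, Y + (B + A * (- X - 2 * B / A)))"
      unfolding Y_def X_def by (simp add: std_map_def Let_def algebra_simps)
    also have "\<dots> = ?R (x, y)" unfolding Y_def X_def using assms by (simp add: field_simps)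
    finally show "(?L \<circ> ?R \<circ> ?L) z = ?R z" unfolding z .
  qed
  ultimately show "?R \<in> reversors ?L" by (simp add: reversors_def)
  fix e assume e: "odd_at p1 e"
  have WW: "?W e \<circ> ?W e = id" by auto
  have "?W e \<in> carrier PolyAut"
    by (rule involution_PolyAut[OF WW]) (auto simp: split_beta intro!: rpf_intros)
  moreover have "?C \<circ> ?W e = diag_map (- 1) e (- 1) e \<circ> ?C"
  proof (rule ext, clarify)
    fix x y
    have "(?C \<circ> ?W e) (x, y) = (- y + e, - y + e + A * (- x - 2 * B / A + poly p1 (- y + e)) + B)" by simp
    also have "\<dots> = (- y + e, - y + e + A * (- x - 2 * B / A - poly p1 y) + B)" using e by simp
    also have "\<dots> = (diag_map (- 1) e (- 1) e \<circ> ?C) (x, y)"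
      using assms by (simp add: diag_map_def field_simps)
    finally show "(?C \<circ> ?W e) (x, y) = (diag_map (- 1) e (- 1) e \<circ> ?C) (x, y)" .
  qed
  moreover have "?W e \<noteq> id"
  proof
    assume "?W e = id"
    then have "?W e (0, 0) = (0, 0)" "?W e (0, 1) = (0, 1)" by (metis id_apply)+
    then show False by simp
  qed
  moreover have "?W e \<circ> ?L = ?L \<circ> ?W e"
  proof (rule ext, clarify)
    fix x y
    have "(?L \<circ> ?W e) (x, y) = (- x - 2 * B / A + poly p1 (- y + e),
        - y + e + (B + A * (- x - 2 * B / A + poly p1 (- y + e))))"
      by (simp add: std_map_def Let_def algebra_simps)
    also have "\<dots> = (- x - 2 * B / A - poly p1 y, - y + e + (B + A * (- x - 2 * B / A - poly p1 y)))"
      using e by simp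
    also have "\<dots> = (?W e \<circ> ?L) (x, y)" using assms by (simp add: std_map_def Let_def field_simps)
    finally show "(?W e \<circ> ?L) (x, y) = (?L \<circ> ?W e) (x, y)" ..
  qed
  moreover have "?R \<circ> ?W e = ?W e \<circ> ?R"
  proof (rule ext, clarify)
    fix x y
    have "(?R \<circ> ?W e) (x, y) = (x + 2 * B / A - poly p1 (- y + e) - 2 * B / A, - y + e)" by simp
    also have "\<dots> = (?W e \<circ> ?R) (x, y)" using e by simp
    finally show "(?R \<circ> ?W e) (x, y) = (?W e \<circ> ?R) (x, y)" .
  qed
  ultimately show "?W e \<in> carrier PolyAut \<and> ?C \<circ> ?W e = diag_map (- 1) e (- 1) e \<circ> ?C \<and>
      ?W e \<circ> ?W e = id \<and> ?W e \<noteq> id \<and> ?W e \<circ> ?L = ?L \<circ> ?W e \<and> ?R \<circ> ?W e = ?W e \<circ> ?R"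
    using WW by blast
qed (use assms in auto)

section \<open>The seven possibilities\<close>

context nonlinear begin

lemma no_S_iff: "(\<forall>i\<in>{1, 2, 3}. \<not> holds_S p1 p2 i) \<longleftrightarrow> \<not> (O1 \<and> O2) \<and> \<not> P \<and> \<not> (O1 \<and> M)"
  unfolding ball_simps holds_iffs by blast

lemma no_R_iff: "(\<forall>i\<in>{1, 2, 3, 4, 5}. \<not> holds_R p1 p2 i) \<longleftrightarrow> \<not> O1 \<and> \<not> O2 \<and> \<not> (E1 \<and> E2) \<and> \<not> M"
  unfolding ball_simps holds_iffs by blast

lemma R_reflection:
  assumes "inf_order PolyAut f" "f \<in> carrier PolyAut" "assoc_R p1 p2 i R" "i \<noteq> 5" "f \<circ> R \<circ> f = R"
  shows "inf_order_reflection PolyAut f R"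
  using assms assoc_R_involution[OF assms(3,4)] by (intro reflection_locale) (auto simp: reversors_def)

lemma possibility_1:
  assumes "possibility p1 p2 1"
  shows "symmetries L = cyc L \<and> reversing_symmetries L = cyc L \<and> as_group (cyc L) \<cong> C_inf"
proof -
  have "\<not> O1" "\<not> O2" "\<not> (E1 \<and> E2)" "\<not> P" "\<not> M" using assms unfolding possibility_iff by auto
  then have "symmetries L = cyc L" "reversing_symmetries L = symmetries L"
    using no_S_iff no_R_iff by (blast intro!: symmetries_no_S reversing_eq_symmetries)+
  then show ?thesis using inf_order.cyclic_iso[OF inf_order_L] by simp
qed

lemma possibility_2:
  assumes "possibility p1 p2 2" and V: "assoc_S p1 p2 2 V"
  shows "symmetries L = cyc V \<and> reversing_symmetries L = cyc V \<and> as_group (cyc V) \<cong> C_inf"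
proof -
  have *: "\<not> O1" "\<not> O2" "\<not> (E1 \<and> E2)" "\<not> M" using assms unfolding possibility_iff by auto
  then have "\<not> holds_S p1 p2 1" "\<not> holds_S p1 p2 3" unfolding holds_iffs by blast+
  note S = symmetries_S2[OF V this]
  have "reversing_symmetries L = symmetries L"
    using * no_R_iff by (blast intro!: reversing_eq_symmetries)
  then show ?thesis using S(1) inf_order.cyclic_iso[OF S(2)] by simp
qed

lemma possibility_3:
  assumes "possibility p1 p2 3" "i \<in> {1, 2, 3, 4}" and R: "assoc_R p1 p2 i R"
  shows "symmetries L = cyc L \<and> as_group (symmetries L) \<cong> C_inf \<and>
    internal_semidirect PolyAut (cyc L) (cyc R) (reversing_symmetries L) \<and>
    as_group (reversing_symmetries L) \<cong> D_inf"
proof -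
  have "\<not> (O1 \<and> O2)" "\<not> P" "\<not> (O1 \<and> M)" using assms(1) unfolding possibility_iff by auto
  then have sym: "symmetries L = cyc L" using no_S_iff by (blast intro!: symmetries_no_S)
  have i: "i \<noteq> 5" using assms(2) by auto
  have "L \<circ> R \<circ> L = R" using assoc_R_reversor[OF R] by (simp add: reversors_def)
  then interpret inf_order_reflection PolyAut L R
    using R_reflection[OF inf_order_L _ R i] by blast
  have rev: "reversing_symmetries L = cyc L <#>\<^bsub>PolyAut\<^esub> cyc R"
    using reversing_coset[OF R i] sym by simp
  show ?thesis unfolding rev unfolding sym
    using cyclic_iso dihedral_semidirect dihedral_iso by blast
qed

lemma possibility_4:
  assumes "possibility p1 p2 4" and V: "assoc_S p1 p2 2 V" and R: "assoc_R p1 p2 3 R"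
  shows "symmetries L = cyc V \<and> as_group (symmetries L) \<cong> C_inf \<and>
    internal_semidirect PolyAut (cyc V) (cyc R) (reversing_symmetries L) \<and>
    as_group (reversing_symmetries L) \<cong> D_inf"
proof -
  have "E1" "E2" using assms(1) unfolding possibility_iff by auto
  then have "\<not> O1" "\<not> O2" using condition_rules(8,9) by blast+
  then have "\<not> holds_S p1 p2 1" "\<not> holds_S p1 p2 3" unfolding holds_iffs by blast+
  note S = symmetries_S2[OF V this]
  interpret inf_order_reflection PolyAut V R
    by (rule R_reflection[OF S(2) assoc_S_PolyAut[OF V] R _ reflection_S2_R3[OF deg1(2) V R]]) simp
  have rev: "reversing_symmetries L = cyc V <#>\<^bsub>PolyAut\<^esub> cyc R"
    using reversing_coset[OF R] S(1) by simp
  show ?thesis unfolding rev unfolding S(1)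
    using cyclic_iso dihedral_semidirect dihedral_iso by blast
qed

text \<open>Shared by the fifth and the sixth possibility, where \<open>f\<close> is
  \<open>L\<close> and S3 respectively.\<close>

lemma reflection_times_S1:
  assumes f: "inf_order_central PolyAut f Z" and sym: "symmetries L = cyc f <#>\<^bsub>PolyAut\<^esub> cyc Z"
    and Z: "assoc_S p1 p2 1 Z" and R: "assoc_R p1 p2 1 R" and refl: "f \<circ> R \<circ> f = R"
  shows "dihedral_times_C2 L f R Z"
proof -
  interpret inf_order_central PolyAut f Z by fact
  interpret inf_order_reflection PolyAut f R
    by (rule R_reflection[OF inf_order_axioms a R _ refl]) simp
  interpret inf_order_reflection_central PolyAut f R Z
    using R1_S1_commute[OF deg1(2) R Z] by unfold_locales simp
  have rev: "reversing_symmetries L = (cyc f <#>\<^bsub>PolyAut\<^esub> cyc R) <#>\<^bsub>PolyAut\<^esub> cyc Z"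
    using reversing_coset[OF R] sym dihedral_central_swap by simp
  show ?thesis unfolding rev unfolding sym
    using central_direct central_iso dihedral_semidirect dihedral_central_direct dihedral_central_iso by blast
qed

lemma possibility_5:
  assumes "possibility p1 p2 5"
  shows "holds_R p1 p2 1 \<and> holds_R p1 p2 2 \<and>
    (\<forall>Z R. assoc_S p1 p2 1 Z \<longrightarrow> assoc_R p1 p2 1 R \<longrightarrow>
      dihedral_times_C2 L L R Z)"
proof -
  have *: "O1" "O2" "\<not> P" "\<not> M" using assms unfolding possibility_iff by auto
  then have holds: "holds_R p1 p2 1" "holds_R p1 p2 2" unfolding holds_iffs by blast+
  have no: "\<not> holds_S p1 p2 2" "\<not> holds_S p1 p2 3" unfolding holds_iffs using * by blast+
  have "dihedral_times_C2 L L R Z" if Z: "assoc_S p1 p2 1 Z" and R: "assoc_R p1 p2 1 R" for Z R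
  proof (rule reflection_times_S1[OF symmetries_S1(2,1)[OF Z no] Z R])
    show "L \<circ> R \<circ> L = R" using assoc_R_reversor[OF R] by (simp add: reversors_def)
  qed
  then show ?thesis using holds by blast
qed

lemma possibility_6:
  assumes "possibility p1 p2 6"
  shows "holds_S p1 p2 1 \<and> holds_R p1 p2 1 \<and> holds_R p1 p2 2 \<and> holds_R p1 p2 4 \<and>
    (\<forall>V Z R. assoc_S p1 p2 3 V \<longrightarrow> assoc_S p1 p2 1 Z \<longrightarrow> assoc_R p1 p2 1 R \<longrightarrow>
      dihedral_times_C2 L V R Z)"
proof -
  have *: "O1" "M" using assms unfolding possibility_iff by auto
  then have "O2" "\<not> P" using condition_rules(2,5,8) by blast+
  note * = * this
  have holds: "holds_S p1 p2 1" "holds_R p1 p2 1" "holds_R p1 p2 2" "holds_R p1 p2 4"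
    unfolding holds_iffs using * by blast+
  have no: "\<not> holds_S p1 p2 (5 - 3)" using * holds_iffs(2) by simp
  have "dihedral_times_C2 L V R Z"
    if V: "assoc_S p1 p2 3 V" and Z: "assoc_S p1 p2 1 Z" and R: "assoc_R p1 p2 1 R" for V Z R
  proof -
    note rel = S3_relations[OF deg1 V R Z]
    note S = symmetries_half_S1[OF V _ Z no rel(2) disjI2[OF rel(3)]]
    show ?thesis by (rule reflection_times_S1[OF S(2,1) Z R rel(1)]) simp_all
  qed
  then show ?thesis using holds by blast
qed

lemma possibility_7:
  assumes "possibility p1 p2 7"
  shows "holds_R p1 p2 1 \<and> holds_R p1 p2 2 \<and>
    (\<forall>V Z R. assoc_S p1 p2 2 V \<longrightarrow> assoc_S p1 p2 1 Z \<longrightarrow> assoc_R p1 p2 1 R \<longrightarrow>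
      internal_direct PolyAut (cyc V) (cyc Z) (symmetries L) \<and>
      as_group (symmetries L) \<cong> C_inf \<times>\<times> C2 \<and>
      internal_semidirect PolyAut (cyc V <#>\<^bsub>PolyAut\<^esub> cyc Z) (cyc R) (reversing_symmetries L) \<and>
      R \<circ> V \<circ> R = Z \<circ> inv_into UNIV V \<and>
      as_group (reversing_symmetries L) \<cong> twisted_prod)"
proof (intro conjI allI impI)
  have *: "O1" "O2" "P" using assms unfolding possibility_iff by auto
  then have "\<not> M" using condition_rules(5,8) by blast
  note * = * this
  show "holds_R p1 p2 1" "holds_R p1 p2 2" unfolding holds_iffs using * by blast+
  have no: "\<not> holds_S p1 p2 (5 - 2)" using * holds_iffs(3) by simp
  fix V Z R assume V: "assoc_S p1 p2 2 V" and Z: "assoc_S p1 p2 1 Z" and R: "assoc_R p1 p2 1 R"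
  note rel = S2_relations[OF deg1 V R Z]
  note S = symmetries_half_S1[OF V _ Z no rel(2) disjI1[OF assoc_S2_sq[OF V]]]
  have V_in: "V \<in> carrier PolyAut" by (rule assoc_S_PolyAut[OF V])
  note RR = assoc_R_involution[OF R]
  show RVR: "R \<circ> V \<circ> R = Z \<circ> inv_into UNIV V"
  proof -
    have "Z \<circ> inv_into UNIV V = R \<circ> V \<circ> R \<circ> (V \<circ> inv_into UNIV V)"
      unfolding rel(1)[symmetric] by (simp add: comp_assoc)
    then show ?thesis unfolding PolyAut_inv_comp(2)[OF V_in] by simp
  qed
  interpret inf_order_central PolyAut V Z using S(2) by simp
  interpret inf_order_twisted PolyAut V Z R
  proof unfold_locales
    show "R \<in> carrier PolyAut" "R \<otimes>\<^bsub>PolyAut\<^esub> R = \<one>\<^bsub>PolyAut\<^esub>" using RR by simp_all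
    show "R \<otimes>\<^bsub>PolyAut\<^esub> Z = Z \<otimes>\<^bsub>PolyAut\<^esub> R" using R1_S1_commute[OF deg1(2) R Z] by simp
    have "R \<circ> V = R \<circ> V \<circ> R \<circ> R" using RR by (simp add: comp_assoc)
    then show "R \<otimes>\<^bsub>PolyAut\<^esub> V = Z \<otimes>\<^bsub>PolyAut\<^esub> inv\<^bsub>PolyAut\<^esub> V \<otimes>\<^bsub>PolyAut\<^esub> R"
      unfolding RVR by (simp add: PolyAut_inv[OF V_in])
  qed
  have sym: "symmetries L = cyc V <#>\<^bsub>PolyAut\<^esub> cyc Z" using S(1) by simp
  have rev: "reversing_symmetries L = (cyc V <#>\<^bsub>PolyAut\<^esub> cyc Z) <#>\<^bsub>PolyAut\<^esub> cyc R"
    using reversing_coset[OF R] sym by simp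
  show "internal_direct PolyAut (cyc V) (cyc Z) (symmetries L)"
    "as_group (symmetries L) \<cong> C_inf \<times>\<times> C2"
    unfolding sym by (rule central_direct, rule central_iso)
  show "internal_semidirect PolyAut (cyc V <#>\<^bsub>PolyAut\<^esub> cyc Z) (cyc R) (reversing_symmetries L)"
    "as_group (reversing_symmetries L) \<cong> twisted_prod"
    unfolding rev by (rule twisted_semidirect, rule twisted_iso)
qed

text \<open>Given S2, condition R4 makes \<open>p1\<close> even by comparison of the two signs, and
  evenness passes to \<open>p2\<close>; conversely evenness gives R4 by reversing the sign of
  \<open>a\<close>.\<close>

lemma S2_R3_iff_R4: "holds_S p1 p2 2 \<and> holds_R p1 p2 3 \<longleftrightarrow> holds_S p1 p2 2 \<and> holds_R p1 p2 4"
  unfolding holds_iffs using condition_rules(3,5,6) by blast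

lemma S1_S2_iff_R5: "holds_S p1 p2 1 \<and> holds_S p1 p2 2 \<longleftrightarrow> holds_R p1 p2 5"
  unfolding holds_iffs using condition_rules(1) by blast

end

theorem mainTheorem3:
  fixes p1 p2 :: "real poly" and L :: plane_map
  assumes L: "L = std_map p1 p2"
  shows
    "(\<forall>q R2 S1.
      (\<exists>A B. A \<noteq> 0 \<and> p1 = [:B, A:] \<and> degree p2 \<ge> 2 \<and> q = p2 \<and>
         R2 = (\<lambda>(x, y). (x, - y + poly p2 x - 2 * B / A)) \<and>
         S1 = (\<lambda>e (x, y). (- x + e, - y - 2 * B / A))) \<or>
      (\<exists>A B. A \<noteq> 0 \<and> p2 = [:B, A:] \<and> degree p1 \<ge> 2 \<and> q = p1 \<and>
         R2 = (\<lambda>(x, y). (- x - poly p1 y - 2 * B / A, y)) \<and>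
         S1 = (\<lambda>e (x, y). (- x - 2 * B / A, - y + e))) \<longrightarrow>
      ((\<nexists>b. odd_around q b) \<longrightarrow>
         symmetries L = cyc L \<and>
         as_group (symmetries L) \<cong> C_inf \<and>
         internal_semidirect PolyAut (cyc L) (cyc R2) (reversing_symmetries L) \<and>
         as_group (reversing_symmetries L) \<cong> D_inf) \<and>
      (\<forall>e. odd_around q (e / 2) \<longrightarrow>
         internal_direct PolyAut (cyc L) (cyc (S1 e)) (symmetries L) \<and>
         as_group (symmetries L) \<cong> C_inf \<times>\<times> C2 \<and>
         internal_semidirect PolyAut (cyc L) (cyc R2) (cyc L <#>\<^bsub>PolyAut\<^esub> cyc R2) \<and>
         internal_direct PolyAut (cyc L <#>\<^bsub>PolyAut\<^esub> cyc R2) (cyc (S1 e)) (reversing_symmetries L) \<and>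
         as_group (reversing_symmetries L) \<cong> D_inf \<times>\<times> C2)) \<and>
     (degree p1 \<ge> 2 \<and> degree p2 \<ge> 2 \<longrightarrow>
      (\<exists>!k. possibility p1 p2 k) \<and>
      (possibility p1 p2 1 \<longrightarrow>
         symmetries L = cyc L \<and>
         reversing_symmetries L = cyc L \<and>
         as_group (cyc L) \<cong> C_inf) \<and>
      (possibility p1 p2 2 \<longrightarrow>
         (\<forall>S2. assoc_S p1 p2 2 S2 \<longrightarrow>
            symmetries L = cyc S2 \<and>
            reversing_symmetries L = cyc S2 \<and>
            as_group (cyc S2) \<cong> C_inf)) \<and>
      (possibility p1 p2 3 \<longrightarrow>
         (\<forall>i\<in>{1,2,3,4}. \<forall>R. assoc_R p1 p2 i R \<longrightarrow>
            symmetries L = cyc L \<and>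
            as_group (symmetries L) \<cong> C_inf \<and>
            internal_semidirect PolyAut (cyc L) (cyc R) (reversing_symmetries L) \<and>
            as_group (reversing_symmetries L) \<cong> D_inf)) \<and>
      (holds_S p1 p2 2 \<and> holds_R p1 p2 3 \<longleftrightarrow> holds_S p1 p2 2 \<and> holds_R p1 p2 4) \<and>
      (possibility p1 p2 4 \<longrightarrow>
         (\<forall>S2 R3. assoc_S p1 p2 2 S2 \<longrightarrow> assoc_R p1 p2 3 R3 \<longrightarrow>
            symmetries L = cyc S2 \<and>
            as_group (symmetries L) \<cong> C_inf \<and>
            internal_semidirect PolyAut (cyc S2) (cyc R3) (reversing_symmetries L) \<and>
            as_group (reversing_symmetries L) \<cong> D_inf)) \<and>
      (possibility p1 p2 5 \<longrightarrow>
         holds_R p1 p2 1 \<and> holds_R p1 p2 2 \<and>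
         (\<forall>S1 R1. assoc_S p1 p2 1 S1 \<longrightarrow> assoc_R p1 p2 1 R1 \<longrightarrow>
            internal_direct PolyAut (cyc L) (cyc S1) (symmetries L) \<and>
            as_group (symmetries L) \<cong> C_inf \<times>\<times> C2 \<and>
            internal_semidirect PolyAut (cyc L) (cyc R1) (cyc L <#>\<^bsub>PolyAut\<^esub> cyc R1) \<and>
            internal_direct PolyAut (cyc L <#>\<^bsub>PolyAut\<^esub> cyc R1) (cyc S1) (reversing_symmetries L) \<and>
            as_group (reversing_symmetries L) \<cong> D_inf \<times>\<times> C2)) \<and>
      (possibility p1 p2 6 \<longrightarrow>
         holds_S p1 p2 1 \<and> holds_R p1 p2 1 \<and> holds_R p1 p2 2 \<and> holds_R p1 p2 4 \<and>
         (\<forall>S3 S1 R1. assoc_S p1 p2 3 S3 \<longrightarrow> assoc_S p1 p2 1 S1 \<longrightarrow> assoc_R p1 p2 1 R1 \<longrightarrow>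
            internal_direct PolyAut (cyc S3) (cyc S1) (symmetries L) \<and>
            as_group (symmetries L) \<cong> C_inf \<times>\<times> C2 \<and>
            internal_semidirect PolyAut (cyc S3) (cyc R1) (cyc S3 <#>\<^bsub>PolyAut\<^esub> cyc R1) \<and>
            internal_direct PolyAut (cyc S3 <#>\<^bsub>PolyAut\<^esub> cyc R1) (cyc S1) (reversing_symmetries L) \<and>
            as_group (reversing_symmetries L) \<cong> D_inf \<times>\<times> C2)) \<and>
      (holds_S p1 p2 1 \<and> holds_S p1 p2 2 \<longleftrightarrow> holds_R p1 p2 5) \<and>
      (possibility p1 p2 7 \<longrightarrow>
         holds_R p1 p2 1 \<and> holds_R p1 p2 2 \<and>
         (\<forall>S2 S1 R1. assoc_S p1 p2 2 S2 \<longrightarrow> assoc_S p1 p2 1 S1 \<longrightarrow> assoc_R p1 p2 1 R1 \<longrightarrow>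
            internal_direct PolyAut (cyc S2) (cyc S1) (symmetries L) \<and>
            as_group (symmetries L) \<cong> C_inf \<times>\<times> C2 \<and>
            internal_semidirect PolyAut (cyc S2 <#>\<^bsub>PolyAut\<^esub> cyc S1) (cyc R1)
              (reversing_symmetries L) \<and>
            R1 \<circ> S2 \<circ> R1 = S1 \<circ> inv_into UNIV S2 \<and>
            as_group (reversing_symmetries L) \<cong> twisted_prod)))"
proof (rule conjI, goal_cases)
  case 1
  show ?case
  proof (intro allI impI, goal_cases)
    case (1 q R2 S1)
    \<comment> \<open>The conclusions mention only \<open>q\<close>, \<open>R2\<close> and
      \<open>S1\<close>, so the two linear cases merge once the conjugacy \<open>C\<close> is known
      to exist.\<close>
    obtain A C where lc: "linear_case q A C L R2 S1"
      using 1
    proof (elim disjE exE conjE)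
      fix A B assume H: "A \<noteq> 0" "p1 = [:B, A:]" "degree p2 \<ge> 2" "q = p2"
        "R2 = (\<lambda>(x, y). (x, - y + poly p2 x - 2 * B / A))"
        "S1 = (\<lambda>e (x, y). (- x + e, - y - 2 * B / A))"
      show thesis using that linear_case_p1[OF H(1,3), of B] unfolding L H(2,4-6) by blast
    next
      fix A B assume H: "A \<noteq> 0" "p2 = [:B, A:]" "degree p1 \<ge> 2" "q = p1"
        "R2 = (\<lambda>(x, y). (- x - poly p1 y - 2 * B / A, y))"
        "S1 = (\<lambda>e (x, y). (- x - 2 * B / A, - y + e))"
      show thesis using that linear_case_p2[OF H(1,3), of B] unfolding L H(2,4-6) by blast
    qed
    show ?case
      unfolding odd_around_ex odd_around_iff
      by (rule conjI; (intro allI impI)?)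
        (rule linear_case.not_odd_case[OF lc], assumption, rule linear_case.odd_case[OF lc], assumption)
  qed
next
  case 2
  show ?case
  proof (rule impI, goal_cases)
    case 1
    then interpret nl: nonlinear p1 p2 by unfold_locales auto
    show ?case
      unfolding L
      by (rule conjI[OF nl.unique_possibility], rule conjI, rule impI, rule nl.possibility_1, assumption,
        rule conjI, (intro impI allI, rule nl.possibility_2; assumption),
        rule conjI, (intro impI ballI allI, rule nl.possibility_3; assumption),
        rule conjI[OF nl.S2_R3_iff_R4], rule conjI, (intro impI allI, rule nl.possibility_4; assumption),
        rule conjI, rule impI, rule nl.possibility_5, assumption,
        rule conjI, rule impI, rule nl.possibility_6, assumption,
        rule conjI[OF nl.S1_S2_iff_R5], rule impI, rule nl.possibility_7, assumption)
  qed
qed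

end
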